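(* Let $\alpha \in (1,2)$, let $d \geq 2$ be an integer, let $\nu_\alpha$ be a non-degenerate symmetric $\alpha$-stable L\'evy measure on $\mathbb{R}^d$ and let $p \in (1,d/(\alpha-1))$. Set $p_\alpha^*=pd/(d-p(\alpha-1))$ and let $f \in \dot{W}^{\alpha-1,p}(\mathbb{R}^d,dx)$. Then, there exists a sequence of functions $(f_n)_{n \geq 1}$ in $\mathcal{C}^{\infty}_c(\mathbb{R}^d)$ such that, as $n\to+\infty$, $f_n \longrightarrow f$ in $L^{p^*_\alpha}(\mathbb{R}^d,dx)$ and $D^{\alpha-1}(f_n) \longrightarrow D^{\alpha-1}(f)$ in $L^{p}(\mathbb{R}^d,\mathbb{R}^d,dx)$.
   Context: $\langle\cdot;\cdot\rangle$ between vectors is the Euclidean inner product, and $\mathbb{S}^{d-1}$ the Euclidean unit sphere. A symmetric $\alpha$-stable L\'evy measure is $\nu_\alpha(B)=\int_{\mathbb{S}^{d-1}}\int_0^{+\infty} \mathbf{1}_B(ry)\,\frac{dr}{r^{\alpha+1}}\,\sigma(dy)$, where $\sigma$ is a finite positive symmetric ($\sigma(B)=\sigma(-B)$) Borel measure on $\mathbb{S}^{d-1}$. With $\lambda_1 = -\cos(\alpha\pi/2)\frac{\Gamma(2-\alpha)}{\alpha(\alpha-1)}\sigma$, it is non-degenerate if $\inf_{y\in\mathbb{S}^{d-1}}\int_{\mathbb{S}^{d-1}}|\langle y;x\rangle|^\alpha\lambda_1(dx)>0$. For $f\in L^q(\mathbb{R}^d,dx)$, $q\in[1,+\infty)$, $D^{\alpha-1}(f)$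 is the $\mathbb{R}^d$-valued tempered distribution with components $\langle D^{\alpha-1}_k(f);\varphi\rangle=\int_{\mathbb{R}^d}f(x)(D^{\alpha-1}_k)^*(\varphi)(x)dx$, $\varphi\in\mathcal{S}(\mathbb{R}^d)$, where $(D^{\alpha-1}_k)^*(\varphi)(x)=\int_{\mathbb{R}^d}(\varphi(x-u)-\varphi(x))u_k\nu_\alpha(du)$ (for $f\in\mathcal{S}(\mathbb{R}^d)$, $D^{\alpha-1}(f)(x)=\int_{\mathbb{R}^d}(f(x+u)-f(x))u\,\nu_\alpha(du)$). $\dot{W}^{\alpha-1,p}(\mathbb{R}^d,dx)$ is the set of $f\in L^{p_\alpha^*}(\mathbb{R}^d,dx)$ such that $D^{\alpha-1}(f)\in L^p(\mathbb{R}^d,\mathbb{R}^d,dx)$. *)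

theory Defs
  imports "HOL-Analysis.Analysis"
begin

definition symmetric_spherical_measure :: "(real ^ 'n) measure \<Rightarrow> bool" where
  "symmetric_spherical_measure \<sigma> \<longleftrightarrow>
     finite_measure \<sigma> \<and>
     sets \<sigma> = sets (restrict_space borel (sphere 0 1)) \<and>
     (\<forall>B \<in> sets \<sigma>. emeasure \<sigma> (uminus ` B) = emeasure \<sigma> B)"

definition stable_levy_measure :: "real \<Rightarrow> (real ^ 'n) measure \<Rightarrow> (real ^ 'n) measure" where
  "stable_levy_measure \<alpha> \<sigma> = measure_of UNIV (sets borel)
     (\<lambda>B. \<integral>\<^sup>+ y. (\<integral>\<^sup>+ r \<in> {0<..}. indicator B (r *\<^sub>R y) * ennreal (1 / r powr (\<alpha> + 1)) \<partial>lborel) \<partial>\<sigma>)"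

lemma sets_stable_levy_measure [simp, measurable_cong]:
  "sets (stable_levy_measure \<alpha> \<sigma>) = sets borel"
  unfolding stable_levy_measure_def
  using sets.sigma_sets_eq[of borel] by (subst sets_measure_of) simp_all

lemma space_stable_levy_measure [simp]: "space (stable_levy_measure \<alpha> \<sigma>) = UNIV"
  using sets_eq_imp_space_eq[OF sets_stable_levy_measure] by simp

text \<open>
  The set function above is countably additive, so \<^const>\<open>measure_of\<close> does not fall back to the
  null measure.
\<close>

lemma emeasure_stable_levy_measure:
  fixes \<sigma> :: "(real ^ 'n) measure"
  assumes \<sigma>: "symmetric_spherical_measure \<sigma>" and B: "B \<in> sets borel"
  shows "emeasure (stable_levy_measure \<alpha> \<sigma>) B =
    (\<integral>\<^sup>+ y. (\<integral>\<^sup>+ r \<in> {0<..}. indicator B (r *\<^sub>R y) * ennreal (1 / r powr (\<alpha> + 1)) \<partial>lborel) \<partial>\<sigma>)"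
proof -
  let ?h = "\<lambda>B y r. indicator B (r *\<^sub>R y) * ennreal (1 / r powr (\<alpha> + 1)) * indicator {0<..} r"
  let ?\<mu> = "\<lambda>B. \<integral>\<^sup>+ y. (\<integral>\<^sup>+ r. ?h B y r \<partial>lborel) \<partial>\<sigma>"
  have s: "sets \<sigma> = sets (restrict_space borel (sphere 0 1))"
    using \<sigma> by (simp add: symmetric_spherical_measure_def)
  have [measurable]: "(\<lambda>y. y) \<in> borel_measurable \<sigma>"
    using measurable_cong_sets[OF s refl] measurable_restrict_space1[OF measurable_ident_sets[OF refl]]
    by blast
  have m: "(\<lambda>(y, r). ?h C y r) \<in> borel_measurable (\<sigma> \<Otimes>\<^sub>M lborel)" if [measurable]: "C \<in> sets borel" for C
    by measurable
  have m1: "(\<lambda>r. ?h C y r) \<in> borel_measurable lborel" if [measurable]: "C \<in> sets borel" for C :: "(real ^ 'n) set" and y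
    by measurable
  have m2: "(\<lambda>y. \<integral>\<^sup>+ r. ?h C y r \<partial>lborel) \<in> borel_measurable \<sigma>" if "C \<in> sets borel" for C
    using lborel.borel_measurable_nn_integral[OF m[OF that]] .
  have "countably_additive (sets borel) ?\<mu>"
  proof (rule countably_additiveI)
    fix A :: "nat \<Rightarrow> (real ^ 'n) set"
    assume A: "range A \<subseteq> sets borel" "disjoint_family A"
    have Ai: "A i \<in> sets borel" for i using A by auto
    have "(\<Sum>i. ?\<mu> (A i)) = (\<integral>\<^sup>+ y. (\<Sum>i. \<integral>\<^sup>+ r. ?h (A i) y r \<partial>lborel) \<partial>\<sigma>)"
      by (rule nn_integral_suminf[symmetric]) (rule m2[OF Ai])
    also have "\<dots> = (\<integral>\<^sup>+ y. (\<integral>\<^sup>+ r. (\<Sum>i. ?h (A i) y r) \<partial>lborel) \<partial>\<sigma>)"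
      by (intro nn_integral_cong nn_integral_suminf[symmetric] m1 Ai)
    also have "\<dots> = ?\<mu> (\<Union>i. A i)"
    proof (intro nn_integral_cong)
      fix y r
      have "(\<Sum>i. ?h (A i) y r) =
          (\<Sum>i. indicator (A i) (r *\<^sub>R y)) * (ennreal (1 / r powr (\<alpha> + 1)) * indicator {0<..} r)"
        unfolding mult.assoc by (rule ennreal_suminf_multc)
      then show "(\<Sum>i. ?h (A i) y r) = ?h (\<Union>i. A i) y r"
        by (simp only: suminf_indicator[OF A(2)] mult.assoc)
    qed
    finally show "(\<Sum>i. ?\<mu> (A i)) = ?\<mu> (\<Union>i. A i)" .
  qed
  moreover have "positive (sets borel) ?\<mu>"
    by (simp add: positive_def)
  moreover have "sigma_algebra UNIV (sets (borel :: (real ^ 'n) measure))"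
    using sets.sigma_algebra_axioms[of "borel :: (real ^ 'n) measure"] by simp
  ultimately show ?thesis
    unfolding stable_levy_measure_def using B by (intro emeasure_measure_of_sigma)
qed

definition nondegenerate :: "real \<Rightarrow> (real ^ 'n) measure \<Rightarrow> bool" where
  "nondegenerate \<alpha> \<sigma> \<longleftrightarrow>
     (let \<Lambda> = scale_measure
                (ennreal (- cos (\<alpha> * pi / 2) * Gamma (2 - \<alpha>) / (\<alpha> * (\<alpha> - 1)))) \<sigma>
      in (INF y \<in> sphere 0 1. \<integral>x. \<bar>y \<bullet> x\<bar> powr \<alpha> \<partial>\<Lambda>) > 0)"

definition partial_deriv :: "'n \<Rightarrow> (real ^ 'n \<Rightarrow> real) \<Rightarrow> real ^ 'n \<Rightarrow> real" where
  "partial_deriv i f x = frechet_derivative f (at x) (axis i 1)"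

definition partial_derivs :: "'n list \<Rightarrow> (real ^ 'n \<Rightarrow> real) \<Rightarrow> real ^ 'n \<Rightarrow> real" where
  "partial_derivs is f = foldr partial_deriv is f"

text \<open>
  Requiring Frechet differentiability of every iterated partial derivative is the same as requiring
  that all of them exist and are continuous.
\<close>

definition C_inf :: "(real ^ 'n \<Rightarrow> real) set" where
  "C_inf = {f. \<forall>is. partial_derivs is f differentiable_on UNIV}"

definition C_inf_c :: "(real ^ 'n \<Rightarrow> real) set" where
  "C_inf_c = {f \<in> C_inf. compact (closure {x. f x \<noteq> 0})}"

definition schwartz :: "(real ^ 'n \<Rightarrow> real) set" where
  "schwartz = {\<phi> \<in> C_inf. \<forall>m is. bounded (range (\<lambda>x. norm x ^ m * partial_derivs is \<phi> x))}"

text \<open>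
  \<open>Lp_space\<close> consists of functions, not of classes modulo null sets; every Lebesgue class
  contains a Borel representative.
\<close>

definition Lp_space :: "real \<Rightarrow> (real ^ 'n \<Rightarrow> 'b :: {banach, second_countable_topology}) set" where
  "Lp_space q = {f \<in> borel_measurable lborel. integrable lborel (\<lambda>x. norm (f x) powr q)}"

definition Lp_norm :: "real \<Rightarrow> (real ^ 'n \<Rightarrow> 'b :: {banach, second_countable_topology}) \<Rightarrow> real" where
  "Lp_norm q f = (\<integral>x. norm (f x) powr q \<partial>lborel) powr (1 / q)"

definition Lp_tendsto ::
  "real \<Rightarrow> (nat \<Rightarrow> real ^ 'n \<Rightarrow> 'b :: {banach, second_countable_topology}) \<Rightarrow> (real ^ 'n \<Rightarrow> 'b) \<Rightarrow> bool" where
  "Lp_tendsto q F f \<longleftrightarrow>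
     (\<forall>n\<ge>1. F n \<in> Lp_space q) \<and> f \<in> Lp_space q \<and>
     (\<lambda>n. Lp_norm q (\<lambda>x. F n x - f x)) \<longlonglongrightarrow> 0"

definition frac_grad_adj ::
  "(real ^ 'n) measure \<Rightarrow> 'n \<Rightarrow> (real ^ 'n \<Rightarrow> real) \<Rightarrow> real ^ 'n \<Rightarrow> real" where
  "frac_grad_adj \<nu> k \<phi> x = (\<integral>u. (\<phi> (x - u) - \<phi> x) * u $ k \<partial>\<nu>)"

text \<open>
  An \<open>\<real>\<^sup>d\<close>-valued tempered distribution is represented by the family of its components, each
  acting on test functions; only the values on \<^const>\<open>schwartz\<close> are meaningful.
\<close>

type_synonym 'n vec_distr = "'n \<Rightarrow> (real ^ 'n \<Rightarrow> real) \<Rightarrow> real"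

definition frac_grad :: "(real ^ 'n) measure \<Rightarrow> (real ^ 'n \<Rightarrow> real) \<Rightarrow> ('n :: finite) vec_distr" where
  "frac_grad \<nu> f k \<phi> = (\<integral>x. f x * frac_grad_adj \<nu> k \<phi> x \<partial>lborel)"

definition distr_represents :: "(real ^ 'n \<Rightarrow> real ^ 'n) \<Rightarrow> ('n :: finite) vec_distr \<Rightarrow> bool" where
  "distr_represents g T \<longleftrightarrow> (\<forall>k. \<forall>\<phi> \<in> schwartz. T k \<phi> = (\<integral>x. g x $ k * \<phi> x \<partial>lborel))"

definition distr_in_Lp :: "real \<Rightarrow> ('n :: finite) vec_distr \<Rightarrow> bool" where
  "distr_in_Lp p T \<longleftrightarrow> (\<exists>g \<in> Lp_space p. distr_represents g T)"

text \<open>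
  The representing functions below are unique up to null sets, so it does not matter which ones
  are chosen.
\<close>

definition distr_Lp_tendsto :: "real \<Rightarrow> (nat \<Rightarrow> ('n :: finite) vec_distr) \<Rightarrow> 'n vec_distr \<Rightarrow> bool" where
  "distr_Lp_tendsto p S T \<longleftrightarrow>
     (\<exists>G g. (\<forall>n\<ge>1. distr_represents (G n) (S n)) \<and> distr_represents g T \<and> Lp_tendsto p G g)"

definition sobolev_exponent :: "real \<Rightarrow> real \<Rightarrow> real \<Rightarrow> real" where
  "sobolev_exponent d \<alpha> p = p * d / (d - p * (\<alpha> - 1))"

definition frac_sobolev ::
  "(real ^ 'n) measure \<Rightarrow> real \<Rightarrow> real \<Rightarrow> (real ^ 'n \<Rightarrow> real) set" where
  "frac_sobolev \<nu> \<alpha> p =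
     {f \<in> Lp_space (sobolev_exponent CARD('n) \<alpha> p). distr_in_Lp p (frac_grad \<nu> f)}"

end

theory Submission
  imports Defs
begin

text \<open>
  Write \<open>D\<close> for the fractional gradient and \<open>D\<^sup>*\<close> for its formal adjoint, and let
  \<open>\<eta>\<^sub>R x = \<eta> (x / R)\<close> be smooth cutoffs. Testing against \<open>\<eta>\<^sub>R \<phi>\<close> gives the exact identity
  \<open>D (\<eta>\<^sub>R f) = \<eta>\<^sub>R D f + E\<^sub>R\<close> with the single remainder
  \<open>E\<^sub>R y = \<integral> f (y + u) (\<eta>\<^sub>R (y + u) - \<eta>\<^sub>R y) u \<nu>(du)\<close>. The weight
  \<open>min 1 (\<bar>u\<bar> / R) \<bar>u\<bar>\<close> has \<open>\<nu>\<close>-mass of order \<open>R powr (1 - \<alpha>)\<close>, and the integrand vanishes unless \<open>y\<close> or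
  \<open>y + u\<close> lies in the ball of radius \<open>R\<close>. Jensen's inequality and Hoelder's inequality on that ball
  therefore bound the \<open>L\<^sup>p\<close> norm of \<open>E\<^sub>R\<close> by the \<open>L\<^sup>q\<close> norm of \<open>f\<close> uniformly in \<open>R\<close>, where
  \<open>q = sobolev_exponent d \<alpha> p\<close> is exactly the exponent for which the powers of \<open>R\<close> cancel. For bounded
  support of \<open>f\<close> the bound even decays, so splitting off the tail of \<open>f\<close> shows that \<open>E\<^sub>R\<close> tends to \<open>0\<close> in \<open>L\<^sup>p\<close>.
  Finally \<open>D\<^sup>*\<close> commutes with translations, so mollifying the compactly supported \<open>\<eta>\<^sub>R f\<close>
  mollifies its fractional gradient.
\<close>

section \<open>Smooth and Schwartz functions\<close>

text \<open>For \<open>f\<close> merely in \<open>L\<^sup>q\<close> the gradient \<open>D f\<close>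
  is known only through its pairings with Schwartz functions; the integral formula for
  \<open>D f\<close> has no pointwise meaning a priori. Hence cutoff and mollification are both
  transferred to the test function, and most preparatory work concerns the adjoint:
  \<open>D\<^sup>*\<close> of a Schwartz function is shown to be integrable and bounded, so that it
  pairs with every \<open>L\<^sup>q\<close> function and Fubini applies.

  The obstacle in estimating \<open>E\<^sub>R\<close> is that \<open>L\<^sup>p\<close> need not
  contain \<open>f\<close>, so convolving \<open>f\<close> with the kernel cannot be bounded in
  \<open>L\<^sup>p\<close> over the whole space. The localisation to the ball is essential: Hoelder
  there costs the factor R^(d(1 - p/q)) = R^(p(\<alpha> - 1)), and the p-th power of the kernel mass
  repays R^(-p(\<alpha> - 1)). Nothing is left over, so decay has to come from the smallness of the
  tail of \<open>f\<close>.

  The cutoff must precede the mollification: a bounded support survives averaging over small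
  translates, so the result is both smooth and compactly supported.\<close>

lemma partial_deriv_eq:
  assumes "(f has_derivative f') (at x)"
  shows "partial_deriv i f x = f' (axis i 1)"
  unfolding partial_deriv_def using frechet_derivative_at[OF assms] by simp

lemma has_derivative_partial_deriv:
  fixes f :: "real ^ 'n \<Rightarrow> real"
  assumes "f differentiable_on UNIV"
  shows "(f has_derivative (\<lambda>v. \<Sum>i\<in>UNIV. v $ i * partial_deriv i f x)) (at x)"
proof -
  let ?D = "frechet_derivative f (at x)"
  have D: "(f has_derivative ?D) (at x)"
    using assms by (simp add: differentiable_on_def frechet_derivative_works)
  then interpret bounded_linear ?D by (rule has_derivative_bounded_linear)
  have "?D v = (\<Sum>i\<in>UNIV. v $ i * partial_deriv i f x)" for v
  proof -
    have "?D v = ?D (\<Sum>i\<in>UNIV. v $ i *\<^sub>R axis i 1)"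
      by (subst basis_expansion[of v, symmetric]) (simp add: scalar_mult_eq_scaleR)
    then show ?thesis by (simp add: sum scaleR partial_deriv_def)
  qed
  then have "?D = (\<lambda>v. \<Sum>i\<in>UNIV. v $ i * partial_deriv i f x)" by auto
  with D show ?thesis by simp
qed

lemma partial_derivs_Nil [simp]: "partial_derivs [] f = f"
  and partial_derivs_Cons [simp]: "partial_derivs (i # is) f = partial_deriv i (partial_derivs is f)"
  and partial_derivs_snoc: "partial_derivs (is @ [i]) f = partial_derivs is (partial_deriv i f)"
  by (simp_all add: partial_derivs_def)

lemma partial_derivs_mem:
  assumes "f \<in> S" "\<And>g i. g \<in> S \<Longrightarrow> partial_deriv i g \<in> S"
  shows "partial_derivs is f \<in> S"
  using assms by (induction "is") auto

text \<open>\<open>C_inf\<close> quantifies over all finite lists of indices. A set of functions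
  closed under \<open>partial_deriv\<close> reduces this to a single differentiation, so smoothness
  proofs below mostly consist in finding such an invariant set.\<close>

lemma C_inf_coinduct:
  assumes "f \<in> S" "\<And>g. g \<in> S \<Longrightarrow> g differentiable_on UNIV"
    and "\<And>g i. g \<in> S \<Longrightarrow> partial_deriv i g \<in> S"
  shows "f \<in> C_inf"
  using assms partial_derivs_mem[OF assms(1,3)] by (auto simp: C_inf_def)

lemma schwartz_coinduct:
  assumes "f \<in> S" "\<And>g. g \<in> S \<Longrightarrow> g differentiable_on UNIV"
    and "\<And>g i. g \<in> S \<Longrightarrow> partial_deriv i g \<in> S"
    and "\<And>g m. g \<in> S \<Longrightarrow> bounded (range (\<lambda>x. norm x ^ m * g x))"
  shows "f \<in> schwartz"
  using assms partial_derivs_mem[OF assms(1,3)] C_inf_coinduct[OF assms(1-3)]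
  by (auto simp: schwartz_def)

text \<open>These functions serve as multipliers of Schwartz functions. The class contains the
  cutoffs as well as the Schwartz functions themselves and is stable under
  \<open>partial_deriv\<close>.\<close>

definition C_inf_b :: "(real ^ 'n \<Rightarrow> real) set" where
  "C_inf_b = {f \<in> C_inf. \<forall>is. bounded (range (partial_derivs is f))}"

lemma C_inf_differentiable: "f \<in> C_inf \<Longrightarrow> f differentiable_on UNIV"
  unfolding C_inf_def by (auto dest: spec[of _ "[]"])

lemma C_inf_partial_deriv: "f \<in> C_inf \<Longrightarrow> partial_deriv i f \<in> C_inf"
  by (simp add: C_inf_def flip: partial_derivs_snoc)

lemma C_inf_continuous: "f \<in> C_inf \<Longrightarrow> continuous_on UNIV f"
  by (intro differentiable_imp_continuous_on C_inf_differentiable)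

lemma C_inf_b_bounded: "f \<in> C_inf_b \<Longrightarrow> bounded (range f)"
  unfolding C_inf_b_def by (auto dest: spec[of _ "[]"])

lemma C_inf_b_partial_deriv: "f \<in> C_inf_b \<Longrightarrow> partial_deriv i f \<in> C_inf_b"
  by (simp add: C_inf_b_def C_inf_partial_deriv flip: partial_derivs_snoc)

lemma C_inf_b_C_inf: "f \<in> C_inf_b \<Longrightarrow> f \<in> C_inf"
  by (simp add: C_inf_b_def)

lemma schwartz_C_inf: "f \<in> schwartz \<Longrightarrow> f \<in> C_inf"
  by (simp add: schwartz_def)

lemma schwartz_partial_deriv: "f \<in> schwartz \<Longrightarrow> partial_deriv i f \<in> schwartz"
  by (simp add: schwartz_def C_inf_partial_deriv flip: partial_derivs_snoc)

lemma schwartz_bounded: "f \<in> schwartz \<Longrightarrow> bounded (range (\<lambda>x. norm x ^ m * f x))"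
proof -
  assume "f \<in> schwartz"
  then have "bounded (range (\<lambda>x. norm x ^ m * partial_derivs [] f x))"
    unfolding schwartz_def by blast
  then show ?thesis by simp
qed

lemma schwartz_C_inf_b:
  assumes "f \<in> schwartz" shows "f \<in> C_inf_b"
proof -
  have "bounded (range (\<lambda>x. norm x ^ 0 * partial_derivs is f x))" for "is"
    using assms unfolding schwartz_def by blast
  then show ?thesis using assms by (auto simp: C_inf_b_def schwartz_def)
qed

lemma C_inf_c_vanishes:
  assumes "f \<in> C_inf_c"
  obtains R where "R > 0" "\<And>x. norm x > R \<Longrightarrow> f x = 0"
proof -
  have "bounded {x. f x \<noteq> 0}"
    using assms bounded_subset[OF compact_imp_bounded closure_subset] by (auto simp: C_inf_c_def)
  then obtain R where "R > 0" "\<And>x. f x \<noteq> 0 \<Longrightarrow> norm x \<le> R"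
    by (force simp: bounded_pos)
  then show ?thesis using that by force
qed

lemma C_inf_cI:
  assumes "f \<in> C_inf" "\<And>x. norm x > R \<Longrightarrow> f x = 0"
  shows "f \<in> C_inf_c"
proof -
  have "bounded {x. f x \<noteq> 0}"
    unfolding bounded_iff using assms(2) by (auto intro!: exI[of _ R] simp: not_less[symmetric])
  then show ?thesis using assms by (simp add: C_inf_c_def compact_closure)
qed

text \<open>Where \<open>norm x > R\<close> the function is locally zero, as this set is open, so
  its derivatives vanish there too. Every iterated derivative is therefore continuous and zero
  outside one fixed ball.\<close>

lemma C_inf_c_C_inf_b:
  fixes f :: "real ^ 'n \<Rightarrow> real"
  assumes "f \<in> C_inf_c" shows "f \<in> C_inf_b"
proof -
  obtain R where R: "\<And>x. norm x > R \<Longrightarrow> f x = 0" using C_inf_c_vanishes[OF assms] by blast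
  define S where "S = {g :: real ^ 'n \<Rightarrow> real. g \<in> C_inf \<and> (\<forall>x. norm x > R \<longrightarrow> g x = 0)}"
  have "partial_deriv i g \<in> S" if g: "g \<in> S" for g i
  proof -
    have "partial_deriv i g x = 0" if "norm x > R" for x
    proof -
      have "open {x :: real ^ 'n. norm x > R}"
        by (intro open_Collect_less continuous_intros)
      with that g have "(g has_derivative (\<lambda>_. 0)) (at x)"
        by (intro has_derivative_transform_within_open[OF has_derivative_const[of 0]])
           (auto simp: S_def)
      then show ?thesis by (simp add: partial_deriv_eq)
    qed
    with g show ?thesis by (simp add: S_def C_inf_partial_deriv)
  qed
  then have *: "partial_derivs is f \<in> S" for "is"
    using assms R by (intro partial_derivs_mem) (auto simp: S_def C_inf_c_def)
  have "bounded (range g)" if "g \<in> S" for g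
  proof -
    have "compact (g ` cball 0 R)"
      using that by (intro compact_continuous_image)
        (auto simp: S_def intro: continuous_on_subset[OF C_inf_continuous])
    then have "bounded (insert 0 (g ` cball 0 R))" by (simp add: compact_imp_bounded)
    moreover have "range g \<subseteq> insert 0 (g ` cball 0 R)"
    proof
      fix y assume "y \<in> range g"
      then obtain x where x: "y = g x" by auto
      show "y \<in> insert 0 (g ` cball 0 R)"
        using that x by (cases "norm x > R") (auto simp: S_def)
    qed
    ultimately show ?thesis by (rule bounded_subset)
  qed
  then show ?thesis using * assms by (auto simp: C_inf_b_def C_inf_c_def)
qed

lemma partial_deriv_mult:
  fixes f g :: "real ^ 'n \<Rightarrow> real"
  assumes "f differentiable_on UNIV" "g differentiable_on UNIV"
  shows "partial_deriv i (\<lambda>x. f x * g x) = (\<lambda>x. partial_deriv i f x * g x + f x * partial_deriv i g x)"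
proof
  fix x
  have f: "(f has_derivative frechet_derivative f (at x)) (at x)"
    and g: "(g has_derivative frechet_derivative g (at x)) (at x)"
    using assms by (simp_all add: differentiable_on_def frechet_derivative_works)
  show "partial_deriv i (\<lambda>x. f x * g x) x = partial_deriv i f x * g x + f x * partial_deriv i g x"
    using partial_deriv_eq[OF has_derivative_mult[OF f g]] by (simp add: partial_deriv_def)
qed

lemma partial_deriv_add:
  fixes f g :: "real ^ 'n \<Rightarrow> real"
  assumes "f differentiable_on UNIV" "g differentiable_on UNIV"
  shows "partial_deriv i (\<lambda>x. f x + g x) = (\<lambda>x. partial_deriv i f x + partial_deriv i g x)"
proof
  fix x
  have f: "(f has_derivative frechet_derivative f (at x)) (at x)"
    and g: "(g has_derivative frechet_derivative g (at x)) (at x)"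
    using assms by (simp_all add: differentiable_on_def frechet_derivative_works)
  show "partial_deriv i (\<lambda>x. f x + g x) x = partial_deriv i f x + partial_deriv i g x"
    using partial_deriv_eq[OF has_derivative_add[OF f g]] by (simp add: partial_deriv_def)
qed

lemma bounded_range_mult:
  fixes a b :: "'a \<Rightarrow> real"
  assumes "bounded (range a)" "bounded (range b)"
  shows "bounded (range (\<lambda>x. a x * b x))"
proof -
  obtain A B where "\<And>x. \<bar>a x\<bar> \<le> A" "\<And>x. \<bar>b x\<bar> \<le> B" "A > 0"
    using assms unfolding bounded_pos by auto
  then have "\<bar>a x * b x\<bar> \<le> A * B" for x by (simp add: abs_mult mult_mono')
  then show ?thesis unfolding bounded_iff by auto
qed

text \<open>The product rule turns one product into a sum of two, so single products are not an
  invariant set for \<open>schwartz_coinduct\<close>, but their finite sums are.\<close>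

inductive_set schwartz_products :: "(real ^ 'n \<Rightarrow> real) set" where
  mult: "a \<in> C_inf_b \<Longrightarrow> b \<in> schwartz \<Longrightarrow> (\<lambda>x. a x * b x) \<in> schwartz_products"
| add: "f \<in> schwartz_products \<Longrightarrow> g \<in> schwartz_products \<Longrightarrow> (\<lambda>x. f x + g x) \<in> schwartz_products"

lemma schwartz_mult:
  assumes "a \<in> C_inf_b" "b \<in> schwartz"
  shows "(\<lambda>x. a x * b x) \<in> schwartz"
proof (rule schwartz_coinduct)
  show "(\<lambda>x. a x * b x) \<in> schwartz_products" using assms by (rule schwartz_products.mult)
next
  fix g :: "real ^ 'n \<Rightarrow> real"
  assume "g \<in> schwartz_products"
  then have *: "g differentiable_on UNIV \<and> (\<forall>i. partial_deriv i g \<in> schwartz_products) \<and>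
      (\<forall>m. bounded (range (\<lambda>x. norm x ^ m * g x)))"
  proof induction
    case (mult a b)
    have d: "a differentiable_on UNIV" "b differentiable_on UNIV"
      using mult by (auto intro: C_inf_differentiable C_inf_b_C_inf schwartz_C_inf)
    have "(\<lambda>x. partial_deriv i a x * b x + a x * partial_deriv i b x) \<in> schwartz_products" for i
      using mult by (intro schwartz_products.intros C_inf_b_partial_deriv schwartz_partial_deriv)
    moreover have "bounded (range (\<lambda>x. norm x ^ m * (a x * b x)))" for m
      using bounded_range_mult[OF C_inf_b_bounded[OF mult(1)] schwartz_bounded[OF mult(2)], of m]
      by (simp add: algebra_simps)
    ultimately show ?case using d by (simp add: partial_deriv_mult differentiable_on_mult)
  next
    case (add f g)
    have "bounded (range (\<lambda>x. norm x ^ m * f x + norm x ^ m * g x))" for m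
      using add.IH by (intro bounded_plus_comp) auto
    moreover have "(\<lambda>x. partial_deriv i f x + partial_deriv i g x) \<in> schwartz_products" for i
      using add.IH by (intro schwartz_products.add) auto
    ultimately show ?case
      using add.IH by (simp add: partial_deriv_add distrib_left differentiable_on_add)
  qed
  from * show "g differentiable_on UNIV" by blast
  from * show "partial_deriv i g \<in> schwartz_products" for i by blast
  from * show "bounded (range (\<lambda>x. norm x ^ m * g x))" for m by blast
qed

lemma partial_deriv_affine:
  fixes f :: "real ^ 'n \<Rightarrow> real"
  assumes "f differentiable_on UNIV"
  shows "(\<lambda>x. a * f (c *\<^sub>R x + z)) differentiable_on UNIV"
    and "partial_deriv i (\<lambda>x. a * f (c *\<^sub>R x + z)) = (\<lambda>x. (a * c) * partial_deriv i f (c *\<^sub>R x + z))"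
proof -
  have 1: "((\<lambda>x. a * f (c *\<^sub>R x + z)) has_derivative (\<lambda>v. a * frechet_derivative f (at (c *\<^sub>R x + z)) (c *\<^sub>R v))) (at x)"
    and 2: "linear (frechet_derivative f (at (c *\<^sub>R x + z)))" for x
  proof -
    have f: "(f has_derivative frechet_derivative f (at (c *\<^sub>R x + z))) (at (c *\<^sub>R x + z))"
      using assms by (simp add: differentiable_on_def frechet_derivative_works)
    have "((\<lambda>x. c *\<^sub>R x + z) has_derivative (\<lambda>v. c *\<^sub>R v)) (at x)"
      by (auto intro!: derivative_eq_intros)
    from has_derivative_compose[OF this f] show "((\<lambda>x. a * f (c *\<^sub>R x + z)) has_derivative (\<lambda>v. a * frechet_derivative f (at (c *\<^sub>R x + z)) (c *\<^sub>R v))) (at x)"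
      by (rule has_derivative_mult_right)
    show "linear (frechet_derivative f (at (c *\<^sub>R x + z)))"
      by (rule has_derivative_linear[OF f])
  qed
  show "(\<lambda>x. a * f (c *\<^sub>R x + z)) differentiable_on UNIV"
    using 1 by (auto simp: differentiable_on_def differentiable_def)
  show "partial_deriv i (\<lambda>x. a * f (c *\<^sub>R x + z)) = (\<lambda>x. (a * c) * partial_deriv i f (c *\<^sub>R x + z))"
    using partial_deriv_eq[OF 1] by (auto simp: partial_deriv_def linear_cmul[OF 2])
qed

lemma C_inf_affine:
  fixes f :: "real ^ 'n \<Rightarrow> real"
  assumes "f \<in> C_inf"
  shows "(\<lambda>x. a * f (c *\<^sub>R x + z)) \<in> C_inf"
proof (rule C_inf_coinduct)
  let ?S = "{(\<lambda>x. a * g (c *\<^sub>R x + z)) |a g. g \<in> C_inf}"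
  show "(\<lambda>x. a * f (c *\<^sub>R x + z)) \<in> ?S" using assms by auto
  show "g differentiable_on UNIV" if "g \<in> ?S" for g
    using that by (auto intro: partial_deriv_affine C_inf_differentiable)
  show "partial_deriv i g \<in> ?S" if "g \<in> ?S" for g i
    using that by (auto simp: partial_deriv_affine C_inf_differentiable) (metis C_inf_partial_deriv)
qed

lemma norm_add_power_le:
  fixes x y :: "'a :: real_normed_vector"
  shows "norm (x + y) ^ m \<le> 2 ^ m * (norm x ^ m + norm y ^ m)"
proof -
  have "norm (x + y) ^ m \<le> (2 * max (norm x) (norm y)) ^ m"
    using norm_triangle_ineq[of x y] by (intro power_mono) auto
  also have "\<dots> \<le> 2 ^ m * (norm x ^ m + norm y ^ m)"
    by (auto simp: power_mult_distrib max_def)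
  finally show ?thesis .
qed

lemma schwartz_translate:
  fixes f :: "real ^ 'n \<Rightarrow> real"
  assumes "f \<in> schwartz"
  shows "(\<lambda>x. f (x + z)) \<in> schwartz"
proof (rule schwartz_coinduct)
  let ?S = "{(\<lambda>x. g (x + z)) |g. g \<in> schwartz}"
  show "(\<lambda>x. f (x + z)) \<in> ?S" using assms by auto
  have d: "g differentiable_on UNIV" if "g \<in> schwartz" for g :: "real ^ 'n \<Rightarrow> real"
    using that by (intro C_inf_differentiable schwartz_C_inf)
  show "g differentiable_on UNIV" if "g \<in> ?S" for g
    using that partial_deriv_affine(1)[OF d, of _ 1 1 z] by auto
  show "partial_deriv i g \<in> ?S" if gS: "g \<in> ?S" for g i
  proof -
    obtain h where h: "h \<in> schwartz" "g = (\<lambda>x. h (x + z))" using gS by blast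
    then show ?thesis
      using partial_deriv_affine(2)[OF d[OF h(1)], of i 1 1 z] schwartz_partial_deriv[OF h(1), of i]
      by auto
  qed
  show "bounded (range (\<lambda>x. norm x ^ m * g x))" if gS: "g \<in> ?S" for g m
  proof -
    obtain h where h: "h \<in> schwartz" "g = (\<lambda>x. h (x + z))" using gS by blast
    obtain A where A: "\<And>x. \<bar>norm x ^ m * h x\<bar> \<le> A"
      using schwartz_bounded[OF h(1), of m] unfolding bounded_iff by auto
    obtain B where B: "\<And>x. \<bar>h x\<bar> \<le> B"
      using schwartz_bounded[OF h(1), of 0] unfolding bounded_iff by auto
    have "\<bar>norm x ^ m * g x\<bar> \<le> 2 ^ m * (A + norm z ^ m * B)" for x
    proof -
      have "norm x ^ m \<le> 2 ^ m * (norm (x + z) ^ m + norm z ^ m)"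
        using norm_add_power_le[of "x + z" "- z" m] by simp
      then have "\<bar>norm x ^ m * g x\<bar> \<le> 2 ^ m * (norm (x + z) ^ m + norm z ^ m) * \<bar>h (x + z)\<bar>"
        by (simp add: h(2) abs_mult mult_right_mono)
      also have "\<dots> = 2 ^ m * (\<bar>norm (x + z) ^ m * h (x + z)\<bar> + norm z ^ m * \<bar>h (x + z)\<bar>)"
        by (simp add: abs_mult algebra_simps)
      also have "\<dots> \<le> 2 ^ m * (A + norm z ^ m * B)"
        using A B by (intro mult_left_mono add_mono) auto
      finally show ?thesis .
    qed
    then show ?thesis unfolding bounded_iff by auto
  qed
qed

section \<open>A smooth bump function supported in the unit ball\<close>

definition flat :: "nat \<Rightarrow> real \<Rightarrow> real" where
  "flat k t = (if t > 0 then (1 / t) ^ k * exp (- (1 / t)) else 0)"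

lemma flat_tendsto_0: "(flat k \<longlongrightarrow> 0) (at 0)"
proof -
  have "((\<lambda>t. (1 / t) ^ k / exp (1 / t)) \<longlongrightarrow> (0 :: real)) (at_right 0)"
    using filterlim_compose[OF tendsto_power_div_exp_0 filterlim_inverse_at_top_right]
    by (simp add: field_simps)
  then have "(flat k \<longlongrightarrow> 0) (at_right 0)"
    by (rule Lim_transform_eventually)
       (auto simp: flat_def exp_minus field_simps eventually_at_right_less intro!: eventually_mono[OF eventually_at_right_less])
  moreover have "(flat k \<longlongrightarrow> 0) (at_left 0)"
    by (rule Lim_transform_eventually[OF tendsto_const])
       (auto simp: flat_def eventually_at_filter)
  ultimately show ?thesis by (simp add: filterlim_split_at)
qed

text \<open>Differentiating \<open>exp (- (1 / t))\<close> brings down a factor (1/t)^2. This is why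
  \<open>flat\<close> carries a power \<open>k\<close>: the family is then closed under
  differentiation up to linear combinations, also at \<open>t = 0\<close>.\<close>

lemma DERIV_flat: "(flat k has_real_derivative (flat (k + 2) t - k * flat (k + 1) t)) (at t)"
proof (cases t "0 :: real" rule: linorder_cases)
  case less
  have "((\<lambda>_. 0) has_real_derivative 0) (at t)" by simp
  then have "(flat k has_real_derivative 0) (at t)"
    using less by (rule_tac has_field_derivative_transform_within_open[where S = "{..<0}"])
      (auto simp: flat_def)
  then show ?thesis using less by (simp add: flat_def)
next
  case equal
  \<comment> \<open>Away from 0 the difference quotient of \<open>flat k\<close> at 0 is
    \<open>flat (k + 1)\<close> itself, so \<open>flat_tendsto_0\<close> gives its limit.\<close>
  have "((\<lambda>s. (flat k s - flat k 0) / (s - 0)) \<longlongrightarrow> 0) (at 0)"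
    by (rule Lim_transform_eventually[OF flat_tendsto_0[of "k + 1"]])
       (auto simp: flat_def eventually_at_filter)
  then show ?thesis using equal by (simp add: has_field_derivative_iff flat_def)
next
  case greater
  have "((\<lambda>t. (1 / t) ^ k * exp (- (1 / t))) has_real_derivative
      (flat (k + 2) t - k * flat (k + 1) t)) (at t)"
    using greater
    apply (auto intro!: derivative_eq_intros simp: flat_def)
    apply (cases k)
     apply (auto simp: field_simps power2_eq_square)
    done
  then show ?thesis
    using greater by (rule_tac has_field_derivative_transform_within_open[where S = "{0<..}"])
      (auto simp: flat_def)
qed

text \<open>The chain rule for \<open>flat k (1 - x \<bullet> x)\<close> produces a factor
  \<open>- 2 * x $ i\<close>, so constants and coordinates are adjoined to obtain an algebra stable
  under \<open>partial_deriv\<close>.\<close>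

inductive_set bump_algebra :: "(real ^ 'n \<Rightarrow> real) set" where
  const: "(\<lambda>_. c) \<in> bump_algebra"
| coord: "(\<lambda>x. x $ i) \<in> bump_algebra"
| flat: "(\<lambda>x. flat k (1 - x \<bullet> x)) \<in> bump_algebra"
| mult: "f \<in> bump_algebra \<Longrightarrow> g \<in> bump_algebra \<Longrightarrow> (\<lambda>x. f x * g x) \<in> bump_algebra"
| add: "f \<in> bump_algebra \<Longrightarrow> g \<in> bump_algebra \<Longrightarrow> (\<lambda>x. f x + g x) \<in> bump_algebra"

lemma bump_algebra_C_inf:
  assumes "f \<in> bump_algebra" shows "f \<in> C_inf"
proof (rule C_inf_coinduct[OF assms])
  fix g :: "real ^ 'n \<Rightarrow> real"
  assume "g \<in> bump_algebra"
  then have "g differentiable_on UNIV \<and> (\<forall>i. partial_deriv i g \<in> bump_algebra)"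
  proof induction
    case (const c)
    have d: "((\<lambda>_. c) has_derivative (\<lambda>_. 0)) (at x)" for x :: "real ^ 'n" by simp
    have "partial_deriv i (\<lambda>_. c) = (\<lambda>_. 0)" for i :: 'n using partial_deriv_eq[OF d] by auto
    then show ?case by (simp add: bump_algebra.const)
  next
    case (coord j)
    have d: "((\<lambda>x :: real ^ 'n. x $ j) has_derivative (\<lambda>v. v $ j)) (at x)" for x
      by (rule bounded_linear_imp_has_derivative[OF bounded_linear_vec_nth])
    have "partial_deriv i (\<lambda>x. x $ j) = (\<lambda>_. axis i 1 $ j)" for i :: 'n using partial_deriv_eq[OF d] by auto
    then show ?case
      using d by (auto simp: bump_algebra.const differentiable_on_def differentiable_def)
  next
    case (flat k)
    have d: "((\<lambda>x :: real ^ 'n. flat k (1 - x \<bullet> x)) has_derivative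
       (\<lambda>v. (flat (k + 2) (1 - x \<bullet> x) - k * flat (k + 1) (1 - x \<bullet> x)) * (- (x \<bullet> v + v \<bullet> x)))) (at x)" for x
      by (rule has_derivative_compose[OF _ DERIV_flat[unfolded has_field_derivative_def]])
         (auto intro!: derivative_eq_intros)
    have "partial_deriv i (\<lambda>x. flat k (1 - x \<bullet> x)) =
       (\<lambda>x. (flat (k + 2) (1 - x \<bullet> x) + (- real k) * flat (k + 1) (1 - x \<bullet> x)) * (- 2 * x $ i))" for i :: 'n
      using partial_deriv_eq[OF d] by (auto simp: inner_axis inner_axis' algebra_simps)
    moreover have "(\<lambda>x. (flat (k + 2) (1 - x \<bullet> x) + (- real k) * flat (k + 1) (1 - x \<bullet> x)) * (- 2 * x $ i)) \<in> bump_algebra" for i :: 'n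
      by (intro bump_algebra.intros)
    ultimately show ?case
      using d by (auto simp: differentiable_on_def differentiable_def)
  next
    case (mult f g)
    then have "(\<lambda>x. partial_deriv i f x * g x + f x * partial_deriv i g x) \<in> bump_algebra" for i
      by (intro bump_algebra.add bump_algebra.mult) auto
    with mult.IH show ?case by (simp add: partial_deriv_mult differentiable_on_mult)
  next
    case (add f g)
    then have "(\<lambda>x. partial_deriv i f x + partial_deriv i g x) \<in> bump_algebra" for i
      by (intro bump_algebra.add) auto
    with add.IH show ?case by (simp add: partial_deriv_add differentiable_on_add)
  qed
  then show "g differentiable_on UNIV" "\<And>i. partial_deriv i g \<in> bump_algebra" by auto
qed

definition bump :: "real ^ 'n \<Rightarrow> real" where
  "bump x = flat 0 (1 - x \<bullet> x)"

lemma bump_C_inf: "bump \<in> C_inf"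
  unfolding bump_def[abs_def] by (intro bump_algebra_C_inf bump_algebra.flat)

lemma bump_nonneg: "bump x \<ge> 0" and bump_0: "bump 0 > 0"
  by (simp_all add: bump_def flat_def)

lemma bump_eq_0: "norm x \<ge> 1 \<Longrightarrow> bump x = 0"
  by (simp add: bump_def flat_def dot_square_norm power2_eq_square mult_ge1_I not_less)

section \<open>Mean value estimates and smoothness of convolutions\<close>

lemma abs_diff_le_partial_deriv:
  fixes f :: "real ^ 'n \<Rightarrow> real" and B :: real
  assumes f: "f differentiable_on UNIV" and "convex S" "x \<in> S" "y \<in> S"
    and B: "\<And>z i. z \<in> S \<Longrightarrow> \<bar>partial_deriv i f z\<bar> \<le> B"
  shows "\<bar>f x - f y\<bar> \<le> CARD('n) * B * norm (x - y)"
proof -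
  have "norm (f x - f y) \<le> CARD('n) * B * norm (x - y)"
  proof (rule differentiable_bound[OF \<open>convex S\<close> _ _ \<open>x \<in> S\<close> \<open>y \<in> S\<close>])
    fix z assume z: "z \<in> S"
    show "(f has_derivative (\<lambda>v. \<Sum>i\<in>UNIV. v $ i * partial_deriv i f z)) (at z within S)"
      using has_derivative_partial_deriv[OF f] by (rule has_derivative_at_withinI)
    have "norm (\<Sum>i\<in>UNIV. v $ i * partial_deriv i f z) \<le> CARD('n) * B * norm v" for v
    proof -
      have "norm (\<Sum>i\<in>UNIV. v $ i * partial_deriv i f z) \<le> (\<Sum>i\<in>(UNIV :: 'n set). norm v * B)"
        by (rule sum_norm_le)
          (auto simp: abs_mult intro!: mult_mono component_le_norm_cart B z)
      then show ?thesis by (simp add: mult_ac)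
    qed
    then show "onorm (\<lambda>v. \<Sum>i\<in>UNIV. v $ i * partial_deriv i f z) \<le> CARD('n) * B"
      by (rule onorm_le)
  qed
  then show ?thesis by simp
qed

lemma C_inf_b_partial_deriv_bound:
  fixes f :: "real ^ 'n \<Rightarrow> real"
  assumes "f \<in> C_inf_b"
  obtains B where "B > 0" "\<And>x. \<bar>f x\<bar> \<le> B" "\<And>x i. \<bar>partial_deriv i f x\<bar> \<le> B"
proof -
  have "\<exists>B. \<forall>x. \<bar>partial_deriv i f x\<bar> \<le> B" for i
    using C_inf_b_bounded[OF C_inf_b_partial_deriv[OF assms]] by (simp add: bounded_iff)
  then obtain B where B: "\<And>i x. \<bar>partial_deriv i f x\<bar> \<le> B i" by metis
  obtain B' where B': "\<And>x. \<bar>f x\<bar> \<le> B'"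
    using C_inf_b_bounded[OF assms] by (auto simp: bounded_iff)
  let ?B = "\<Sum>i\<in>UNIV. B i"
  have nn: "B i \<ge> 0" for i using B[of i 0] by simp
  have nn': "B' \<ge> 0" using B'[of 0] by simp
  have le: "\<bar>partial_deriv i f x\<bar> \<le> ?B" for i x
    using B[of i x] member_le_sum[of i UNIV B] nn by (meson finite_UNIV UNIV_I finite order_trans)
  have "?B \<ge> 0" using nn by (simp add: sum_nonneg)
  show ?thesis
  proof (intro that[of "?B + B' + 1"])
    show "\<bar>f x\<bar> \<le> ?B + B' + 1" for x using B'[of x] \<open>?B \<ge> 0\<close> by linarith
    show "\<bar>partial_deriv i f x\<bar> \<le> ?B + B' + 1" for x i using le[of i x] nn' by linarith
  qed (use nn' \<open>?B \<ge> 0\<close> in linarith)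
qed

lemma C_inf_borel: "f \<in> C_inf \<Longrightarrow> f \<in> borel_measurable borel"
  by (intro borel_measurable_continuous_onI C_inf_continuous)

lemma C_inf_b_integrable_mult:
  assumes "integrable lborel h" "\<phi> \<in> C_inf_b"
  shows "integrable lborel (\<lambda>y. h y * \<phi> (x - y))"
proof -
  obtain B where B: "B > 0" "\<And>x. \<bar>\<phi> x\<bar> \<le> B" "\<And>x i. \<bar>partial_deriv i \<phi> x\<bar> \<le> B"
    using C_inf_b_partial_deriv_bound[OF assms(2)] by blast
  have [measurable]: "\<phi> \<in> borel_measurable borel"
    using assms(2) by (intro C_inf_borel C_inf_b_C_inf)
  have [measurable]: "h \<in> borel_measurable lborel" using assms(1) by auto
  show ?thesis
    by (rule Bochner_Integration.integrable_bound[of _ "\<lambda>y. B * h y"])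
      (use assms(1) B in \<open>auto simp: abs_mult mult.commute[of "\<bar>h _\<bar>"] intro!: mult_right_mono intro: order_trans[OF _ abs_ge_self]\<close>)
qed

text \<open>The normalised error of the claimed derivative is the integral of \<open>h\<close>
  against the normalised Taylor remainder of \<open>\<phi>\<close>. That remainder is uniformly
  bounded and tends to 0 pointwise, so dominated convergence with a multiple of
  \<open>\<bar>h y\<bar>\<close> applies.\<close>

lemma has_derivative_convolution:
  fixes \<phi> :: "real ^ 'n \<Rightarrow> real"
  assumes h: "integrable lborel h" and \<phi>: "\<phi> \<in> C_inf_b"
  shows "((\<lambda>x. \<integral>y. h y * \<phi> (x - y) \<partial>lborel) has_derivative
    (\<lambda>v. \<Sum>i\<in>UNIV. v $ i * (\<integral>y. h y * partial_deriv i \<phi> (x - y) \<partial>lborel))) (at x)"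
proof -
  let ?F = "\<lambda>x. \<integral>y. h y * \<phi> (x - y) \<partial>lborel"
  let ?D = "\<lambda>v. \<Sum>i\<in>UNIV. v $ i * (\<integral>y. h y * partial_deriv i \<phi> (x - y) \<partial>lborel)"
  \<comment> \<open>First-order Taylor remainder at \<open>a\<close>, divided by
    \<open>norm v\<close>. For \<open>v = 0\<close> the division by zero yields 0, so the bound
    below needs no exception.\<close>
  define r where "r v a = (\<phi> (a + v) - \<phi> a - (\<Sum>i\<in>UNIV. v $ i * partial_deriv i \<phi> a)) / norm v" for v a
  have d: "\<phi> differentiable_on UNIV" using \<phi> by (intro C_inf_differentiable C_inf_b_C_inf)
  obtain B where B: "B > 0" "\<And>x. \<bar>\<phi> x\<bar> \<le> B" "\<And>x i. \<bar>partial_deriv i \<phi> x\<bar> \<le> B"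
    using C_inf_b_partial_deriv_bound[OF \<phi>] by blast
  have [measurable]: "\<phi> \<in> borel_measurable borel" "partial_deriv i \<phi> \<in> borel_measurable borel" for i
    using \<phi> by (auto intro!: C_inf_borel C_inf_b_C_inf C_inf_b_partial_deriv)
  have [measurable]: "h \<in> borel_measurable lborel" using h by auto
  have r_bound: "\<bar>r v a\<bar> \<le> 2 * (real CARD('n) * B)" for v a
  proof (cases "v = 0")
    case False
    have "\<bar>\<phi> (a + v) - \<phi> a\<bar> \<le> CARD('n) * B * norm v"
      using abs_diff_le_partial_deriv[OF d convex_UNIV, where x = "a + v" and y = a and B = B] B(3) by simp
    moreover have "\<bar>\<Sum>i\<in>UNIV. v $ i * partial_deriv i \<phi> a\<bar> \<le> (\<Sum>i\<in>(UNIV :: 'n set). norm v * B)"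
      by (rule order_trans[OF sum_abs sum_mono])
        (auto simp: abs_mult intro!: mult_mono component_le_norm_cart B)
    ultimately have "\<bar>\<phi> (a + v) - \<phi> a - (\<Sum>i\<in>UNIV. v $ i * partial_deriv i \<phi> a)\<bar> \<le> 2 * (real CARD('n) * B) * norm v"
      by (simp add: algebra_simps)
    then show ?thesis using False by (simp add: r_def divide_simps)
  qed (use B in \<open>simp add: r_def\<close>)
  have eq: "norm (?F z - ?F x - ?D (z - x)) / norm (z - x) = norm (\<integral>y. h y * r (z - x) (x - y) \<partial>lborel)" for z
  proof -
    have "(\<integral>y. h y * r (z - x) (x - y) \<partial>lborel) =
       (\<integral>y. (h y * \<phi> (z - y) - h y * \<phi> (x - y) -
          (\<Sum>i\<in>UNIV. (z - x) $ i * (h y * partial_deriv i \<phi> (x - y)))) / norm (z - x) \<partial>lborel)"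
      unfolding r_def by (simp add: algebra_simps sum_distrib_left)
    also have "\<dots> = (?F z - ?F x - ?D (z - x)) / norm (z - x)"
      using C_inf_b_integrable_mult[OF h \<phi>] C_inf_b_integrable_mult[OF h C_inf_b_partial_deriv[OF \<phi>]]
      by (simp add: Bochner_Integration.integral_diff Bochner_Integration.integral_sum del: vector_minus_component)
    finally show ?thesis by simp
  qed
  show ?thesis
    unfolding has_derivative_iff_norm
  proof
    show "bounded_linear ?D"
      by (intro bounded_linear_sum bounded_linear_mult_const bounded_linear_vec_nth)
    show "((\<lambda>z. norm (?F z - ?F x - ?D (z - x)) / norm (z - x)) \<longlongrightarrow> 0) (at x)"
      unfolding eq
    proof (subst tendsto_norm_zero_iff, subst tendsto_at_iff_sequentially, intro allI impI)
      fix X assume X: "\<forall>i. X i \<in> UNIV - {x}" "X \<longlonglongrightarrow> x"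
      have "(\<lambda>n. \<integral>y. h y * r (X n - x) (x - y) \<partial>lborel) \<longlonglongrightarrow> (\<integral>y. 0 \<partial>(lborel :: (real ^ 'n) measure))"
      proof (rule integral_dominated_convergence[where s = "\<lambda>n y. h y * r (X n - x) (x - y)"
            and f = "\<lambda>_. 0" and w = "\<lambda>y. 2 * (real CARD('n) * B) * \<bar>h y\<bar>"])
        show "AE y in lborel. (\<lambda>n. h y * r (X n - x) (x - y)) \<longlonglongrightarrow> 0"
        proof (rule AE_I2)
          fix y
          have L: "((\<lambda>w. norm (\<phi> w - \<phi> (x - y) - (\<Sum>i\<in>UNIV. (w - (x - y)) $ i * partial_deriv i \<phi> (x - y))) / norm (w - (x - y))) \<longlongrightarrow> 0) (at (x - y))"
            using has_derivative_partial_deriv[OF d, of "x - y"] unfolding has_derivative_iff_norm by blast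
          have "(\<lambda>n. X n - y) \<longlonglongrightarrow> x - y" "\<forall>n. X n - y \<in> UNIV - {x - y}"
            using X by (auto intro!: tendsto_intros)
          then have "((\<lambda>w. norm (\<phi> w - \<phi> (x - y) - (\<Sum>i\<in>UNIV. (w - (x - y)) $ i * partial_deriv i \<phi> (x - y))) / norm (w - (x - y))) \<circ> (\<lambda>n. X n - y)) \<longlonglongrightarrow> 0"
            by (intro L[unfolded tendsto_at_iff_sequentially, rule_format]) auto
          moreover have "X n - y - (x - y) = X n - x" "x - y + (X n - x) = X n - y" for n
            by simp_all
          ultimately have "(\<lambda>n. norm (r (X n - x) (x - y))) \<longlonglongrightarrow> 0"
            unfolding r_def o_def by simp
          then have "(\<lambda>n. r (X n - x) (x - y)) \<longlonglongrightarrow> 0" by (simp only: tendsto_norm_zero_iff)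
          then show "(\<lambda>n. h y * r (X n - x) (x - y)) \<longlonglongrightarrow> 0" by (rule tendsto_mult_right_zero)
        qed
        show "AE y in lborel. norm (h y * r (X n - x) (x - y)) \<le> 2 * (real CARD('n) * B) * \<bar>h y\<bar>" for n
          using r_bound by (auto simp: abs_mult mult.commute[of "\<bar>h _\<bar>"] intro!: mult_right_mono)
      qed (use h in \<open>auto simp: r_def\<close>)
      then show "((\<lambda>z. \<integral>y. h y * r (z - x) (x - y) \<partial>lborel) \<circ> X) \<longlonglongrightarrow> 0"
        by (simp add: o_def)
    qed
  qed
qed

text \<open>All derivatives fall on the smooth factor, so the convolutions of the fixed
  \<open>h\<close> with members of \<open>C_inf_b\<close> form an invariant set.\<close>

lemma convolution_C_inf:
  fixes \<phi> :: "real ^ 'n \<Rightarrow> real"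
  assumes h: "integrable lborel h" and \<phi>: "\<phi> \<in> C_inf_b"
  shows "(\<lambda>x. \<integral>y. h y * \<phi> (x - y) \<partial>lborel) \<in> C_inf"
proof (rule C_inf_coinduct)
  let ?S = "{(\<lambda>x. \<integral>y. h y * \<psi> (x - y) \<partial>lborel) |\<psi>. \<psi> \<in> C_inf_b}"
  show "(\<lambda>x. \<integral>y. h y * \<phi> (x - y) \<partial>lborel) \<in> ?S" using \<phi> by auto
  show "g differentiable_on UNIV" if "g \<in> ?S" for g
    using that has_derivative_convolution[OF h]
    by (fastforce simp: differentiable_on_def differentiable_def)
  show "partial_deriv i g \<in> ?S" if "g \<in> ?S" for g i
  proof -
    from that obtain \<psi> where \<psi>: "\<psi> \<in> C_inf_b" "g = (\<lambda>x. \<integral>y. h y * \<psi> (x - y) \<partial>lborel)" by blast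
    have "partial_deriv i g x = (\<integral>y. h y * partial_deriv i \<psi> (x - y) \<partial>lborel)" for x
      using partial_deriv_eq[OF has_derivative_convolution[OF h \<psi>(1)], of i x]
      by (simp add: \<psi>(2) axis_def if_distrib[of "\<lambda>a. a * _"] cong: if_cong)
    then show ?thesis using C_inf_b_partial_deriv[OF \<psi>(1), of i] by blast
  qed
qed

section \<open>Decay and integrability of Schwartz functions\<close>

lemma one_add_power_le: "(0 :: real) \<le> t \<Longrightarrow> (1 + t) ^ N \<le> 2 ^ N * (1 + t ^ N)"
  using norm_add_power_le[of "1 :: real" t N] by simp

lemma schwartz_decay:
  assumes "\<phi> \<in> schwartz"
  obtains C where "C > 0" "\<And>x. \<bar>\<phi> x\<bar> \<le> C / (1 + norm x) ^ N"
proof -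
  obtain A where A: "\<And>x. \<bar>norm x ^ N * \<phi> x\<bar> \<le> A"
    using schwartz_bounded[OF assms, of N] by (auto simp: bounded_iff)
  obtain B where B: "\<And>x. \<bar>\<phi> x\<bar> \<le> B"
    using schwartz_bounded[OF assms, of 0] by (auto simp: bounded_iff)
  have nn: "A \<ge> 0" "B \<ge> 0" using A[of 0] B[of 0] by linarith+
  have "\<bar>\<phi> x\<bar> \<le> (2 ^ N * (B + A) + 1) / (1 + norm x) ^ N" for x
  proof -
    have "\<bar>\<phi> x\<bar> * (1 + norm x) ^ N \<le> \<bar>\<phi> x\<bar> * (2 ^ N * (1 + norm x ^ N))"
      by (intro mult_left_mono one_add_power_le) auto
    also have "\<dots> = 2 ^ N * (\<bar>\<phi> x\<bar> + \<bar>norm x ^ N * \<phi> x\<bar>)" by (simp add: abs_mult algebra_simps)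
    also have "\<dots> \<le> 2 ^ N * (B + A) + 1"
      by (intro order_trans[OF mult_left_mono[OF add_mono[OF B[of x] A[of x]]]]) auto
    finally show ?thesis
      by (subst pos_le_divide_eq) (auto intro!: zero_less_power simp: add_pos_nonneg)
  qed
  then show ?thesis using nn by (intro that[of "2 ^ N * (B + A) + 1"]) (auto intro: add_nonneg_pos)
qed

text \<open>The function is dominated by a sum over full balls of radius 1 + n, where
  \<open>n\<close> is the integer part of \<open>norm x\<close>. Ball volumes grow like (1 + n)^d,
  so the power d + 2 leaves the convergent series of inverse squares and no volumes of shells have
  to be computed.\<close>

lemma integrable_decay:
  "integrable lborel (\<lambda>x :: real ^ 'n. 1 / (1 + norm x) ^ (CARD('n) + 2))"
proof (rule integrableI_bounded)
  let ?d = "CARD('n)"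
  let ?f = "\<lambda>x :: real ^ 'n. 1 / (1 + norm x) ^ (?d + 2)"
  let ?g = "\<lambda>n x. ennreal (1 / (1 + real n) ^ (?d + 2)) * indicator (cball (0 :: real ^ 'n) (1 + real n)) x"
  have [simp]: "1 + norm x > 0" for x :: "real ^ 'n" by (simp add: add_pos_nonneg)
  show "?f \<in> borel_measurable lborel" by measurable
  have "(\<integral>\<^sup>+x. ennreal (norm (?f x)) \<partial>lborel) \<le> (\<integral>\<^sup>+x. (\<Sum>n. ?g n x) \<partial>lborel)"
  proof (rule nn_integral_mono)
    fix x :: "real ^ 'n"
    define n where "n = nat \<lfloor>norm x\<rfloor>"
    have n: "real n \<le> norm x" "norm x \<le> 1 + real n"
      unfolding n_def by (simp_all add: of_nat_floor, linarith)
    have "ennreal (norm (?f x)) \<le> ?g n x"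
      using n power_mono[of "1 + real n" "1 + norm x" "?d + 2"]
      by (auto intro!: ennreal_leI divide_left_mono mult_pos_pos zero_less_power
          simp: add_pos_nonneg indicator_def simp del: power_Suc)
    also have "\<dots> \<le> (\<Sum>n. ?g n x)"
    proof -
      have "(\<Sum>m\<in>{n}. ?g m x) \<le> (\<Sum>m. ?g m x)"
        by (rule sum_le_suminf) (auto simp del: sum.insert)
      then show ?thesis by (simp only: sum.insert finite.emptyI sum.empty empty_iff not_False_eq_True add_0_right)
    qed
    finally show "ennreal (norm (?f x)) \<le> (\<Sum>n. ?g n x)" .
  qed
  also have "\<dots> = (\<Sum>n. \<integral>\<^sup>+x. ?g n x \<partial>lborel)"
    by (rule nn_integral_suminf) (auto intro!: borel_measurable_times_ennreal borel_measurable_indicator)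
  also have "\<dots> = (\<Sum>n. ennreal (unit_ball_vol ?d * inverse (real (Suc n) ^ 2)))"
  proof (rule suminf_cong)
    fix n
    have "(\<integral>\<^sup>+x. ?g n x \<partial>lborel) = ennreal (1 / (1 + real n) ^ (?d + 2)) * ennreal (unit_ball_vol ?d * (1 + real n) ^ ?d)"
      by (subst nn_integral_cmult_indicator) (auto simp: emeasure_cball)
    also have "\<dots> = ennreal (unit_ball_vol ?d * inverse (real (Suc n) ^ 2))"
    proof -
      have "1 / a ^ (?d + 2) * (c * a ^ ?d) = c * inverse (a ^ 2)" if "a > 0" for a c :: real
        using that by (simp add: power_add divide_simps power2_eq_square)
      from this[of "1 + real n"] show ?thesis
        by (subst ennreal_mult[symmetric]) (auto simp: add.commute)
    qed
    finally show "(\<integral>\<^sup>+x. ?g n x \<partial>lborel) = ennreal (unit_ball_vol ?d * inverse (real (Suc n) ^ 2))" .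
  qed
  also have "\<dots> < \<infinity>"
  proof -
    have "summable (\<lambda>n. unit_ball_vol ?d * inverse (real (Suc n) ^ 2))"
      using inverse_squares_sums by (intro summable_mult) (auto simp: sums_iff inverse_eq_divide add.commute)
    then show ?thesis by (subst suminf_ennreal2) auto
  qed
  finally show "(\<integral>\<^sup>+x. ennreal (norm (?f x)) \<partial>lborel) < \<infinity>" .
qed

lemma schwartz_integrable:
  fixes \<phi> :: "real ^ 'n \<Rightarrow> real"
  assumes "\<phi> \<in> schwartz"
  shows "integrable lborel \<phi>"
proof -
  obtain C where C: "C > 0" "\<And>x. \<bar>\<phi> x\<bar> \<le> C / (1 + norm x) ^ (CARD('n) + 2)"
    using schwartz_decay[OF assms] by blast
  have [measurable]: "\<phi> \<in> borel_measurable borel" using assms by (intro C_inf_borel schwartz_C_inf)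
  show ?thesis
    by (rule Bochner_Integration.integrable_bound[OF integrable_mult_right[OF integrable_decay, of C]])
       (use C in \<open>auto simp: power_add\<close>)
qed

section \<open>Powers of \<open>L\<^sup>p\<close> norms\<close>

text \<open>Convexity in tangent form. Integrating it against a weight proves Jensen's inequality
  without normalising the weight to a probability measure. The cases \<open>m = 0\<close> and
  \<open>t = 0\<close> are separate because the convexity argument runs on the open
  half-line.\<close>

lemma powr_tangent_le:
  fixes m t r :: real
  assumes "m \<ge> 0" "t \<ge> 0" "r \<ge> 1"
  shows "m powr r + r * m powr (r - 1) * (t - m) \<le> t powr r"
proof (cases "m = 0 \<or> t = 0")
  case True
  then show ?thesis
  proof
    assume "t = 0"
    have "m powr r \<le> r * (m powr (r - 1) * m)"
      using assms by (cases "m = 0") (auto simp: powr_mult_base mult.commute)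
    then show ?thesis using \<open>t = 0\<close> by simp
  qed simp
next
  case False
  then have "m > 0" "t > 0" using assms by auto
  have "t powr r - m powr r \<ge> (r * m powr (r - 1)) * (t - m)"
  proof (rule convex_on_imp_above_tangent[where A = "{0<..}"])
    show "((\<lambda>x. x powr r) has_real_derivative r * m powr (r - 1)) (at m within {0<..})"
      using \<open>m > 0\<close> by (intro has_real_derivative_powr has_field_derivative_at_within) auto
  qed (use \<open>m > 0\<close> \<open>t > 0\<close> assms powr_convex in \<open>auto simp: interior_open\<close>)
  then show ?thesis by simp
qed

lemma powr_add_le:
  fixes a b r :: real
  assumes "r \<ge> 0"
  shows "\<bar>a + b\<bar> powr r \<le> 2 powr r * (\<bar>a\<bar> powr r + \<bar>b\<bar> powr r)"
proof -
  have "\<bar>a + b\<bar> powr r \<le> (2 * max \<bar>a\<bar> \<bar>b\<bar>) powr r"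
    using assms by (intro powr_mono2) auto
  also have "\<dots> \<le> 2 powr r * (\<bar>a\<bar> powr r + \<bar>b\<bar> powr r)"
    by (auto simp: powr_mult max_def)
  finally show ?thesis .
qed

lemma le_one_add_powr: "0 \<le> t \<Longrightarrow> 1 \<le> r \<Longrightarrow> t \<le> 1 + t powr r" for t :: real
  using powr_mono[of 1 r t] by (cases "t \<le> 1") (auto intro: add_increasing2)

text \<open>
  Integrability of \<open>c\<close> is not required: a non-integrable \<open>c\<close> has integral \<open>0\<close> by convention.
\<close>

lemma kernel_jensen:
  fixes c b \<kappa> :: "'a \<Rightarrow> real"
  assumes [measurable]: "b \<in> borel_measurable M" and \<kappa>: "integrable M \<kappa>"
    and nn: "\<And>u. \<kappa> u \<ge> 0" "\<And>u. b u \<ge> 0" and c: "\<And>u. \<bar>c u\<bar> \<le> b u * \<kappa> u"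
    and k: "(\<integral>u. \<kappa> u \<partial>M) \<le> k" "k > 0" and r: "r \<ge> 1"
  shows "ennreal (\<bar>\<integral>u. c u \<partial>M\<bar> powr r) \<le> ennreal (k powr (r - 1)) * (\<integral>\<^sup>+u. ennreal (b u powr r * \<kappa> u) \<partial>M)"
proof (cases "(\<integral>\<^sup>+u. ennreal (b u powr r * \<kappa> u) \<partial>M) = \<infinity>")
  case True
  then show ?thesis using k by (simp add: ennreal_mult_eq_top_iff)
next
  case False
  have [measurable]: "\<kappa> \<in> borel_measurable M" using \<kappa> by auto
  have i1: "integrable M (\<lambda>u. b u powr r * \<kappa> u)"
    using False nn by (intro integrableI_nonneg) (auto simp: less_top)
  have i2: "integrable M (\<lambda>u. b u * \<kappa> u)"
  proof (rule Bochner_Integration.integrable_bound[OF Bochner_Integration.integrable_add[OF \<kappa> i1]])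
    have "b u * \<kappa> u \<le> (1 + b u powr r) * \<kappa> u" for u
      using nn r by (intro mult_right_mono le_one_add_powr) auto
    then show "AE u in M. norm (b u * \<kappa> u) \<le> norm (\<kappa> u + b u powr r * \<kappa> u)"
      using nn by (auto simp: algebra_simps)
  qed measurable
  have le: "\<bar>\<integral>u. c u \<partial>M\<bar> \<le> (\<integral>u. b u * \<kappa> u \<partial>M)"
  proof (cases "integrable M c")
    case True
    have "\<bar>\<integral>u. c u \<partial>M\<bar> \<le> (\<integral>u. \<bar>c u\<bar> \<partial>M)" by (rule integral_abs_bound)
    also have "\<dots> \<le> (\<integral>u. b u * \<kappa> u \<partial>M)" by (rule integral_mono[OF integrable_abs[OF True] i2 c])
    finally show ?thesis .
  next
    case False
    moreover have "0 \<le> (\<integral>u. b u * \<kappa> u \<partial>M)"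
      by (intro Bochner_Integration.integral_nonneg mult_nonneg_nonneg nn)
    ultimately show ?thesis using not_integrable_integral_eq[OF False] by simp
  qed
  \<comment> \<open>A mean of \<open>b\<close> relative to the bound \<open>k\<close>, not to the
    true mass of \<open>\<kappa>\<close>. Integrating the tangent inequality at \<open>m\<close>
    still gives the claim: for \<open>r \<ge> 1\<close> the term r m^r (k - \<open>?K\<close>)
    compensates the missing mass \<open>k - ?K\<close>.\<close>
  define m where "m = (\<integral>u. b u * \<kappa> u \<partial>M) / k"
  let ?K = "\<integral>u. \<kappa> u \<partial>M"
  have m: "m \<ge> 0" "(\<integral>u. b u * \<kappa> u \<partial>M) = m * k"
    using k(2) by (auto simp: m_def intro!: divide_nonneg_pos Bochner_Integration.integral_nonneg mult_nonneg_nonneg nn)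
  have "m powr r * k \<le> m powr r * ?K + r * (m powr r) * (k - ?K)"
  proof -
    have "m powr r * (k - ?K) \<le> r * (m powr r * (k - ?K))"
      using k r mult_right_mono[of 1 r "m powr r * (k - ?K)"] by simp
    then show ?thesis by (simp add: algebra_simps)
  qed
  also have "\<dots> = (\<integral>u. m powr r * \<kappa> u + r * m powr (r - 1) * (b u * \<kappa> u - m * \<kappa> u) \<partial>M)"
  proof -
    have "m powr r = m powr (r - 1) * m"
      using m by (cases "m = 0") (auto simp: powr_mult_base mult.commute)
    moreover have "(\<integral>u. m powr r * \<kappa> u + r * m powr (r - 1) * (b u * \<kappa> u - m * \<kappa> u) \<partial>M) =
        m powr r * ?K + r * m powr (r - 1) * (m * k - m * ?K)"
      using \<kappa> i2 m(2) by (subst Bochner_Integration.integral_add) auto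
    ultimately show ?thesis by (simp add: algebra_simps)
  qed
  also have "\<dots> \<le> (\<integral>u. b u powr r * \<kappa> u \<partial>M)"
  proof (rule integral_mono)
    show "m powr r * \<kappa> u + r * m powr (r - 1) * (b u * \<kappa> u - m * \<kappa> u) \<le> b u powr r * \<kappa> u" for u
      using mult_right_mono[OF powr_tangent_le[OF m(1) nn(2) r, of u] nn(1)[of u]]
      by (simp add: algebra_simps)
  qed (use \<kappa> i2 i1 in auto)
  finally have main: "m powr r * k \<le> (\<integral>u. b u powr r * \<kappa> u \<partial>M)" .
  have "\<bar>\<integral>u. c u \<partial>M\<bar> powr r \<le> (m * k) powr r"
    using le m r by (intro powr_mono2) auto
  also have "\<dots> = k powr (r - 1) * (m powr r * k)"
    using m k by (simp add: powr_mult powr_diff)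
  also have "\<dots> \<le> k powr (r - 1) * (\<integral>u. b u powr r * \<kappa> u \<partial>M)"
    using main by (intro mult_left_mono) auto
  finally have "ennreal (\<bar>\<integral>u. c u \<partial>M\<bar> powr r) \<le> ennreal (k powr (r - 1) * (\<integral>u. b u powr r * \<kappa> u \<partial>M))"
    by (rule ennreal_leI)
  also have "\<dots> = ennreal (k powr (r - 1)) * (\<integral>\<^sup>+u. ennreal (b u powr r * \<kappa> u) \<partial>M)"
    using i1 nn by (subst nn_integral_eq_integral) (auto simp: ennreal_mult')
  finally show ?thesis .
qed

text \<open>The r-th power of the norm, with values in \<open>ennreal\<close>: infinite values need
  no side conditions and Tonelli applies directly. The price is the constant \<open>2 powr r\<close>
  in the triangle inequality \<open>Lp_mass_add\<close>.\<close>

definition Lp_mass :: "real \<Rightarrow> ('a :: euclidean_space \<Rightarrow> real) \<Rightarrow> ennreal" where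
  "Lp_mass r f = (\<integral>\<^sup>+x. ennreal (\<bar>f x\<bar> powr r) \<partial>lborel)"

lemma Lp_mass_add:
  assumes [measurable]: "f \<in> borel_measurable borel" "g \<in> borel_measurable borel" and "r \<ge> 0"
  shows "Lp_mass r (\<lambda>x. f x + g x) \<le> ennreal (2 powr r) * (Lp_mass r f + Lp_mass r g)"
proof -
  have "Lp_mass r (\<lambda>x. f x + g x) \<le> (\<integral>\<^sup>+x. ennreal (2 powr r) * (ennreal (\<bar>f x\<bar> powr r) + ennreal (\<bar>g x\<bar> powr r)) \<partial>lborel)"
    unfolding Lp_mass_def using powr_add_le[OF \<open>r \<ge> 0\<close>]
    by (intro nn_integral_mono) (auto simp: ennreal_mult'[symmetric] ennreal_plus[symmetric] simp del: ennreal_plus intro!: ennreal_leI)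
  also have "\<dots> = ennreal (2 powr r) * (Lp_mass r f + Lp_mass r g)"
    unfolding Lp_mass_def by (simp add: nn_integral_cmult nn_integral_add)
  finally show ?thesis .
qed

section \<open>Continuity of translations in the mean\<close>

lemma nn_integral_lborel_translate:
  fixes f :: "'a :: euclidean_space \<Rightarrow> ennreal"
  assumes [measurable]: "f \<in> borel_measurable borel"
  shows "(\<integral>\<^sup>+x. f (x + u) \<partial>lborel) = (\<integral>\<^sup>+x. f x \<partial>lborel)"
  by (subst (2) lborel_distr_plus[of u, symmetric]) (simp add: nn_integral_distr add.commute)

lemma integrable_lborel_translate:
  fixes f :: "'a :: euclidean_space \<Rightarrow> 'b :: {banach, second_countable_topology}"
  assumes "integrable lborel f"
  shows "integrable lborel (\<lambda>x. f (x + u))"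
proof -
  have [measurable]: "f \<in> borel_measurable borel" using borel_measurable_integrable[OF assms] by simp
  have "integrable (distr lborel borel ((+) u)) f" using assms by (simp add: lborel_distr_plus)
  then show ?thesis by (subst (asm) integrable_distr_eq) (auto simp: add.commute)
qed

lemma integral_lborel_translate:
  fixes f :: "'a :: euclidean_space \<Rightarrow> 'b :: {banach, second_countable_topology}"
  assumes [measurable]: "f \<in> borel_measurable borel"
  shows "(\<integral>x. f (x + u) \<partial>lborel) = (\<integral>x. f x \<partial>lborel)"
  by (subst (2) lborel_distr_plus[of u, symmetric]) (simp add: integral_distr add.commute)

text \<open>A point of an open set stays in it under small translations, so the integrand tends to 0
  pointwise, dominated by \<open>indicator U\<close>. Openness is what makes pointwise convergence
  available.\<close>

lemma translation_continuity_open: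
  fixes U :: "'a :: euclidean_space set"
  assumes "open U" "emeasure lborel U < \<infinity>"
  shows "((\<lambda>u. \<integral>x. indicator U x * (1 - indicator U (x + u)) \<partial>lborel) \<longlongrightarrow> (0 :: real)) (at 0)"
proof (subst tendsto_at_iff_sequentially, intro allI impI)
  fix X :: "nat \<Rightarrow> 'a" assume X: "X \<longlonglongrightarrow> 0"
  have [measurable]: "U \<in> sets borel" using assms by auto
  have "(\<lambda>n. \<integral>x. indicator U x * (1 - indicator U (x + X n)) \<partial>lborel) \<longlonglongrightarrow> (\<integral>x. (0 :: real) \<partial>(lborel :: 'a measure))"
  proof (rule integral_dominated_convergence[where w = "indicator U"])
    show "AE x in lborel. (\<lambda>n. indicator U x * (1 - indicator U (x + X n))) \<longlonglongrightarrow> (0::real)"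
    proof (rule AE_I2)
      fix x
      show "(\<lambda>n. indicator U x * (1 - indicator U (x + X n))) \<longlonglongrightarrow> (0::real)"
      proof (cases "x \<in> U")
        case True
        have "(\<lambda>n. x + X n) \<longlonglongrightarrow> x" using tendsto_add[OF tendsto_const X, of x] by simp
        from topological_tendstoD[OF this assms(1) True]
        have "\<forall>\<^sub>F n in sequentially. 0 = indicator U x * (1 - indicator U (x + X n) :: real)"
          by eventually_elim simp
        then show ?thesis by (rule Lim_transform_eventually[OF tendsto_const])
      qed simp
    qed
  qed (use assms in \<open>auto simp: indicator_def\<close>)
  then show "((\<lambda>u. \<integral>x. indicator U x * (1 - indicator U (x + u)) \<partial>lborel) \<circ> X) \<longlonglongrightarrow> (0 :: real)"
    by (simp add: o_def)
qed

definition L1_modulus :: "('a :: euclidean_space \<Rightarrow> real) \<Rightarrow> 'a \<Rightarrow> real" where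
  "L1_modulus f u = (\<integral>x. \<bar>f (x + u) - f x\<bar> \<partial>lborel)"

lemma L1_modulus_nonneg: "L1_modulus f u \<ge> 0"
  by (simp add: L1_modulus_def)

lemma L1_modulus_triangle:
  assumes f: "integrable lborel f" and g: "integrable lborel g"
  shows "L1_modulus f u \<le> L1_modulus g u + 2 * (\<integral>x. \<bar>f x - g x\<bar> \<partial>lborel)"
proof -
  have d: "integrable lborel (\<lambda>x. f x - g x)" using f g by auto
  note t = integrable_lborel_translate[of _ u]
  have "L1_modulus f u \<le> (\<integral>x. (\<bar>g (x + u) - g x\<bar> + \<bar>f (x + u) - g (x + u)\<bar>) + \<bar>f x - g x\<bar> \<partial>lborel)"
    unfolding L1_modulus_def
    by (intro integral_mono) (use f g t[OF f] t[OF g] in auto)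
  also have "\<dots> = L1_modulus g u + (\<integral>x. \<bar>f (x + u) - g (x + u)\<bar> \<partial>lborel) + (\<integral>x. \<bar>f x - g x\<bar> \<partial>lborel)"
    unfolding L1_modulus_def
    by (subst Bochner_Integration.integral_add, (use f g t[OF f] t[OF g] in auto)[2])+ simp
  also have "(\<integral>x. \<bar>f (x + u) - g (x + u)\<bar> \<partial>lborel) = (\<integral>x. \<bar>f x - g x\<bar> \<partial>lborel)"
    using borel_measurable_integrable[OF d]
    by (intro integral_lborel_translate[of "\<lambda>x. \<bar>f x - g x\<bar>"]) auto
  finally show ?thesis by simp
qed

text \<open>Functions whose modulus vanishes at 0 form a closed set in L^1, since the modulus
  changes by at most twice the L^1 distance. This reduces the claim to indicators, and there to open
  sets.\<close>

lemma L1_modulus_tendsto_0I: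
  assumes f: "integrable lborel f"
    and "\<And>\<epsilon>. \<epsilon> > 0 \<Longrightarrow> \<exists>g. integrable lborel g \<and> (L1_modulus g \<longlongrightarrow> 0) (at 0) \<and> (\<integral>x. \<bar>f x - g x\<bar> \<partial>lborel) \<le> \<epsilon>"
  shows "(L1_modulus f \<longlongrightarrow> 0) (at 0)"
proof (rule tendstoI)
  fix \<epsilon> :: real assume "\<epsilon> > 0"
  then obtain g where g: "integrable lborel g" "(L1_modulus g \<longlongrightarrow> 0) (at 0)" "(\<integral>x. \<bar>f x - g x\<bar> \<partial>lborel) \<le> \<epsilon> / 4"
    using assms(2)[of "\<epsilon> / 4"] by auto
  from tendstoD[OF g(2), of "\<epsilon> / 2"] \<open>\<epsilon> > 0\<close>
  have "\<forall>\<^sub>F u in at 0. L1_modulus g u < \<epsilon> / 2" by (auto simp: L1_modulus_nonneg)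
  then show "\<forall>\<^sub>F u in at 0. dist (L1_modulus f u) 0 < \<epsilon>"
  proof eventually_elim
    case (elim u)
    then show ?case using L1_modulus_triangle[OF f g(1), of u] g(3) L1_modulus_nonneg[of f u] by simp
  qed
qed

text \<open>Outer regularity replaces \<open>A\<close> by an open \<open>U\<close> at small cost in
  L^1, and open sets are covered by \<open>translation_continuity_open\<close>.\<close>

lemma L1_modulus_indicator:
  fixes A :: "'a :: euclidean_space set"
  assumes A: "A \<in> sets borel" "emeasure lborel A < \<infinity>"
  shows "(L1_modulus (indicator A) \<longlongrightarrow> 0) (at 0)"
proof (rule L1_modulus_tendsto_0I)
  show "integrable lborel (indicator A :: 'a \<Rightarrow> real)" using A by simp
  fix \<epsilon> :: real assume "\<epsilon> > 0"
  from outer_regular_lborel[OF A(1) this] obtain U where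
    U: "open U" "A \<subseteq> U" "emeasure lborel (U - A) < \<epsilon>" by blast
  have [measurable]: "U \<in> sets borel" "A \<in> sets borel" using U A by auto
  have "emeasure lborel U \<le> emeasure lborel A + emeasure lborel (U - A)"
    using U(2) emeasure_subadditive[of A lborel "U - A"] by (simp add: Un_absorb1)
  also have "\<dots> < \<infinity>" using A U(3) by (auto simp: less_top[symmetric])
  finally have fin: "emeasure lborel U < \<infinity>" .
  let ?D = "\<lambda>u. \<integral>x. indicator U x * (1 - indicator U (x + u)) \<partial>lborel :: real"
  have D: "(?D \<longlongrightarrow> 0) (at 0)" by (rule translation_continuity_open[OF U(1) fin])
  have D': "((\<lambda>u. ?D (- u)) \<longlongrightarrow> 0) (at 0)"
    by (rule filterlim_compose[OF D]) (auto simp: filterlim_at intro!: tendsto_eq_intros simp: eventually_at_filter)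
  have iU: "integrable lborel (indicator U :: 'a \<Rightarrow> real)" using fin by simp
  have iUu: "integrable lborel (\<lambda>x. indicator U x * (1 - indicator U (x + u)) :: real)" for u
    by (rule Bochner_Integration.integrable_bound[OF iU]) (auto simp: indicator_def)
  \<comment> \<open>The points that leave \<open>U\<close> under the shift by \<open>u\<close>
    contribute \<open>?D u\<close>. The points that enter \<open>U\<close> are, after a change of
    variables, those that leave it under the shift by \<open>- u\<close>.\<close>
  have "L1_modulus (indicator U) = (\<lambda>u. ?D u + ?D (- u))"
  proof
    fix u
    have "(\<integral>x. indicator U (x + - u + u) * (1 - indicator U (x + - u)) \<partial>lborel) =
        (\<integral>x. indicator U (x + u) * (1 - indicator U x) \<partial>lborel :: real)"
      by (rule integral_lborel_translate[of "\<lambda>x. indicator U (x + u) * (1 - indicator U x)"]) measurable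
    then have *: "?D (- u) = (\<integral>x. indicator U (x + u) * (1 - indicator U x) \<partial>lborel)" by simp
    have i: "integrable lborel (\<lambda>x. indicator U (x + u) * (1 - indicator U x) :: real)"
      using integrable_lborel_translate[OF iUu[of "- u"], of u] by simp
    show "L1_modulus (indicator U) u = ?D u + ?D (- u)"
      unfolding * L1_modulus_def
      by (subst Bochner_Integration.integral_add[symmetric, OF iUu i]) (auto intro!: Bochner_Integration.integral_cong simp: indicator_def)
  qed
  then have "(L1_modulus (indicator U) \<longlongrightarrow> 0) (at 0)"
    using tendsto_add[OF D D'] by simp
  moreover have "(\<integral>x. \<bar>indicator A x - indicator U x\<bar> \<partial>lborel) \<le> \<epsilon>"
  proof -
    have "(\<integral>x. \<bar>indicator A x - indicator U x :: real\<bar> \<partial>lborel) = (\<integral>x. indicator (U - A) x \<partial>lborel)"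
      using U(2) by (intro Bochner_Integration.integral_cong) (auto simp: indicator_def)
    also have "\<dots> \<le> \<epsilon>" using U(3) \<open>\<epsilon> > 0\<close> by (simp add: measure_def enn2real_leI less_imp_le)
    finally show ?thesis .
  qed
  ultimately show "\<exists>g. integrable lborel g \<and> (L1_modulus g \<longlongrightarrow> 0) (at 0) \<and> (\<integral>x. \<bar>indicator A x - g x\<bar> \<partial>lborel) \<le> \<epsilon>"
    using iU by blast
qed

lemma L1_modulus_tendsto_0:
  fixes f :: "'a :: euclidean_space \<Rightarrow> real"
  assumes "integrable lborel f"
  shows "(L1_modulus f \<longlongrightarrow> 0) (at 0)"
  using assms
proof (induction rule: integrable_induct)
  case (base A c)
  then have "(L1_modulus (indicator A) \<longlongrightarrow> 0) (at 0)" by (intro L1_modulus_indicator) auto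
  moreover have "L1_modulus (\<lambda>x. indicator A x *\<^sub>R c) u = \<bar>c\<bar> * L1_modulus (indicator A) u" for u
    unfolding L1_modulus_def by (simp add: abs_mult flip: left_diff_distrib)
  ultimately show ?case by (auto intro!: tendsto_mult_right_zero)
next
  case (add f g)
  have "L1_modulus (\<lambda>x. f x + g x) u \<le> L1_modulus f u + L1_modulus g u" for u
  proof -
    note i = add.hyps integrable_lborel_translate[OF add.hyps(1), of u] integrable_lborel_translate[OF add.hyps(2), of u]
    have "L1_modulus (\<lambda>x. f x + g x) u \<le> (\<integral>x. \<bar>f (x + u) - f x\<bar> + \<bar>g (x + u) - g x\<bar> \<partial>lborel)"
      unfolding L1_modulus_def by (rule integral_mono) (use i in auto)
    also have "\<dots> = L1_modulus f u + L1_modulus g u"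
      unfolding L1_modulus_def using i by (intro Bochner_Integration.integral_add) auto
    finally show ?thesis .
  qed
  then show ?case
    by (intro tendsto_sandwich[OF _ _ tendsto_const tendsto_add_zero[OF add.IH]]) (auto simp: L1_modulus_nonneg)
next
  case (lim f s)
  show ?case
  proof (rule L1_modulus_tendsto_0I[OF lim.hyps(4)])
    fix \<epsilon> :: real assume "\<epsilon> > 0"
    \<comment> \<open>The induction rule supplies approximants bounded by
      \<open>2 * \<bar>f x\<bar>\<close>, whence the majorant \<open>3 * \<bar>f x\<bar>\<close> for
      the difference.\<close>
    have "(\<lambda>i. \<integral>x. \<bar>f x - s i x\<bar> \<partial>lborel) \<longlonglongrightarrow> (\<integral>x. 0 \<partial>(lborel :: 'a measure))"
    proof (rule integral_dominated_convergence[where w = "\<lambda>x. 3 * \<bar>f x\<bar>"])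
      show "AE x in lborel. (\<lambda>i. \<bar>f x - s i x\<bar>) \<longlonglongrightarrow> 0"
      proof (rule AE_I2)
        fix x
        have "(\<lambda>i. \<bar>f x - s i x\<bar>) \<longlonglongrightarrow> \<bar>f x - f x\<bar>"
          by (intro tendsto_intros lim.hyps(2)) simp
        then show "(\<lambda>i. \<bar>f x - s i x\<bar>) \<longlonglongrightarrow> 0" by simp
      qed
      show "AE x in lborel. norm \<bar>f x - s i x\<bar> \<le> 3 * \<bar>f x\<bar>" for i
        using lim.hyps(3)[of _ i] by (intro AE_I2) (smt (verit) real_norm_def space_lborel UNIV_I)
    qed (use lim.hyps in auto)
    from tendstoD[OF this \<open>\<epsilon> > 0\<close>] obtain i where "(\<integral>x. \<bar>f x - s i x\<bar> \<partial>lborel) < \<epsilon>"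
      by (auto simp: eventually_sequentially)
    then show "\<exists>g. integrable lborel g \<and> (L1_modulus g \<longlongrightarrow> 0) (at 0) \<and> (\<integral>x. \<bar>f x - g x\<bar> \<partial>lborel) \<le> \<epsilon>"
      using lim by (intro exI[of _ "s i"]) auto
  qed
qed

lemma Lp_mass_dominated:
  fixes f :: "'a :: euclidean_space \<Rightarrow> real"
  assumes [measurable]: "f \<in> borel_measurable borel" "\<And>n. g n \<in> borel_measurable borel"
    and f: "Lp_mass r f < \<infinity>" and r: "r > 0"
    and le: "\<And>n x. \<bar>g n x\<bar> \<le> \<bar>f x\<bar>" and lim: "\<And>x. (\<lambda>n. g n x) \<longlonglongrightarrow> 0"
  shows "(\<lambda>n. Lp_mass r (g n)) \<longlonglongrightarrow> 0"
proof -
  have "(\<lambda>n. \<integral>\<^sup>+x. ennreal (\<bar>g n x\<bar> powr r) \<partial>lborel) \<longlonglongrightarrow> (\<integral>\<^sup>+x. ennreal 0 \<partial>(lborel :: 'a measure))"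
  proof (rule nn_integral_dominated_convergence[where w = "\<lambda>x. ennreal (\<bar>f x\<bar> powr r)"])
    show "AE x in lborel. (\<lambda>n. ennreal (\<bar>g n x\<bar> powr r)) \<longlonglongrightarrow> ennreal 0"
    proof (rule AE_I2)
      fix x
      have "(\<lambda>n. \<bar>g n x\<bar> powr r) \<longlonglongrightarrow> 0 powr r"
        using tendsto_rabs[OF lim[of x]] r by (intro tendsto_powr') auto
      then show "(\<lambda>n. ennreal (\<bar>g n x\<bar> powr r)) \<longlonglongrightarrow> ennreal 0"
        by (intro tendsto_ennrealI) simp
    qed
    show "AE x in lborel. ennreal (\<bar>g n x\<bar> powr r) \<le> ennreal (\<bar>f x\<bar> powr r)" for n
      using le r by (intro AE_I2 ennreal_leI powr_mono2) auto
  qed (use f in \<open>auto simp: Lp_mass_def\<close>)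
  then show ?thesis by (simp add: Lp_mass_def)
qed

lemma tendsto_0_ennrealD:
  fixes f :: "nat \<Rightarrow> ennreal"
  assumes "f \<longlonglongrightarrow> 0" "\<epsilon> > (0 :: real)"
  shows "\<forall>\<^sub>F n in sequentially. f n \<le> ennreal \<epsilon>"
  using order_tendstoD(2)[OF assms(1), of "ennreal \<epsilon>"] assms(2) by (auto elim: eventually_mono)

lemma Lp_mass_diff_le:
  assumes [measurable]: "f \<in> borel_measurable borel" "g \<in> borel_measurable borel" and "r \<ge> 0"
  shows "Lp_mass r (\<lambda>x. f x - g x) \<le> ennreal (2 powr r) * (Lp_mass r f + Lp_mass r g)"
  using Lp_mass_add[of f "\<lambda>x. - g x" r] assms by (simp add: Lp_mass_def)

lemma Lp_mass_translate:
  assumes [measurable]: "f \<in> borel_measurable borel"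
  shows "Lp_mass r (\<lambda>x. f (x + u)) = Lp_mass r f"
  unfolding Lp_mass_def by (rule nn_integral_lborel_translate) measurable

text \<open>Truncating both the domain and the values of \<open>f\<close> leaves a bounded
  integrable part, whose increments have r-th powers at most (2M)^(r-1) times their absolute value.
  The L^1 statement therefore suffices for this part, and the discarded part is small in
  mass.\<close>

lemma Lp_translation_continuity:
  fixes f :: "'a :: euclidean_space \<Rightarrow> real" and \<epsilon> :: real
  assumes [measurable]: "f \<in> borel_measurable borel"
    and f: "Lp_mass r f < \<infinity>" and r: "r \<ge> 1" and \<epsilon>: "\<epsilon> > 0"
  shows "\<exists>\<delta>>0. \<forall>u. norm u < \<delta> \<longrightarrow> Lp_mass r (\<lambda>x. f (x + u) - f x) \<le> ennreal \<epsilon>"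
proof -
  define t where "t M x = (if norm x \<le> M \<and> \<bar>f x\<bar> \<le> M then f x else 0)" for M x
  have [measurable]: "t M \<in> borel_measurable borel" for M unfolding t_def by measurable
  \<comment> \<open>The discarded part occurs twice in the increment and passes through two
    applications of the quasi-triangle inequality. With this choice it accounts for exactly half of
    \<open>\<epsilon>\<close>; \<open>\<delta>\<close> below is chosen so that the truncated part
    takes the other half.\<close>
  define \<epsilon>' where "\<epsilon>' = \<epsilon> / (2 * (2 powr r * (2 powr r * 2)))"
  have \<epsilon>': "\<epsilon>' > 0" using \<epsilon> by (simp add: \<epsilon>'_def)
  have "(\<lambda>n. Lp_mass r (\<lambda>x. f x - t (real n) x)) \<longlonglongrightarrow> 0"
  proof (rule Lp_mass_dominated[OF _ _ f])
    fix x
    have "\<forall>\<^sub>F n in sequentially. f x - t (real n) x = 0"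
      using eventually_ge_at_top[of "nat \<lceil>max (norm x) \<bar>f x\<bar>\<rceil>"]
      by eventually_elim (auto simp: t_def nat_le_iff ceiling_le_iff)
    then show "(\<lambda>n. f x - t (real n) x) \<longlonglongrightarrow> 0"
      by (rule tendsto_eventually)
  qed (use r in \<open>auto simp: t_def\<close>)
  then have "\<forall>\<^sub>F n in sequentially. n > 0 \<and> Lp_mass r (\<lambda>x. f x - t (real n) x) \<le> ennreal \<epsilon>'"
    by (intro eventually_conj eventually_gt_at_top tendsto_0_ennrealD \<epsilon>')
  then obtain n where "n > 0" and n: "Lp_mass r (\<lambda>x. f x - t (real n) x) \<le> ennreal \<epsilon>'"
    using eventually_happens'[OF sequentially_bot] by blast
  define M where "M = real n"
  have M: "M > 0" using \<open>n > 0\<close> by (simp add: M_def)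
  let ?e = "\<lambda>x. f x - t M x"
  have tM: "\<bar>t M x\<bar> \<le> M" for x using M by (auto simp: t_def)
  have int: "integrable lborel (t M)"
  proof (rule Bochner_Integration.integrable_bound)
    show "integrable lborel (\<lambda>x :: 'a. M * indicator (cball 0 M) x :: real)"
      using emeasure_lborel_cball_finite[of "0 :: 'a" M] by (intro integrable_mult_right integrable_real_indicator) auto
    show "AE x in lborel. norm (t M x) \<le> norm (M * indicator (cball 0 M) x :: real)"
      using M by (auto simp: t_def indicator_def)
  qed measurable
  define c where "c = (2 * M) powr (r - 1)"
  have c: "c > 0" using M by (simp add: c_def)
  have "\<epsilon> / (2 * (2 powr r * c)) > 0" using \<epsilon> c by simp
  from tendstoD[OF L1_modulus_tendsto_0[OF int] this]
  obtain \<delta> where \<delta>: "\<delta> > 0" "\<And>u. u \<noteq> 0 \<Longrightarrow> norm u < \<delta> \<Longrightarrow> L1_modulus (t M) u < \<epsilon> / (2 * (2 powr r * c))"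
    by (auto simp: eventually_at L1_modulus_nonneg)
  have "Lp_mass r (\<lambda>x. f (x + u) - f x) \<le> ennreal \<epsilon>" if u: "norm u < \<delta>" for u
  proof (cases "u = 0")
    case False
    have 1: "Lp_mass r (\<lambda>x. t M (x + u) - t M x) \<le> ennreal (c * L1_modulus (t M) u)"
    proof -
      have "\<bar>t M (x + u) - t M x\<bar> powr r \<le> c * \<bar>t M (x + u) - t M x\<bar>" for x
      proof -
        have "\<bar>t M (x + u) - t M x\<bar> powr r = \<bar>t M (x + u) - t M x\<bar> powr (r - 1) * \<bar>t M (x + u) - t M x\<bar>"
          by (cases "t M (x + u) = t M x") (auto simp: powr_mult_base mult.commute)
        also have "\<dots> \<le> c * \<bar>t M (x + u) - t M x\<bar>"
          unfolding c_def using tM[of x] tM[of "x + u"] r by (intro mult_right_mono powr_mono2) auto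
        finally show ?thesis .
      qed
      then have "Lp_mass r (\<lambda>x. t M (x + u) - t M x) \<le> (\<integral>\<^sup>+x. ennreal (c * \<bar>t M (x + u) - t M x\<bar>) \<partial>lborel)"
        unfolding Lp_mass_def by (intro nn_integral_mono ennreal_leI)
      also have "\<dots> = ennreal (c * L1_modulus (t M) u)"
        unfolding L1_modulus_def using c int integrable_lborel_translate[OF int, of u]
        by (subst nn_integral_eq_integral) auto
      finally show ?thesis .
    qed
    have 2: "Lp_mass r (\<lambda>x. ?e (x + u) - ?e x) \<le> ennreal (2 powr r * (2 * \<epsilon>'))"
    proof -
      have "Lp_mass r (\<lambda>x. ?e (x + u) - ?e x) \<le> ennreal (2 powr r) * (Lp_mass r ?e + Lp_mass r ?e)"
        using Lp_mass_diff_le[of "\<lambda>x. ?e (x + u)" ?e r] Lp_mass_translate[of ?e r u] r by simp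
      also have "\<dots> \<le> ennreal (2 powr r) * (ennreal \<epsilon>' + ennreal \<epsilon>')"
        using n by (intro mult_left_mono add_mono) (auto simp: M_def)
      also have "\<dots> = ennreal (2 powr r * (2 * \<epsilon>'))"
        using \<epsilon>' by (simp add: ennreal_mult'[symmetric] ennreal_plus[symmetric] del: ennreal_plus)
      finally show ?thesis .
    qed
    have "Lp_mass r (\<lambda>x. f (x + u) - f x) = Lp_mass r (\<lambda>x. (t M (x + u) - t M x) + (?e (x + u) - ?e x))"
      by (simp add: Lp_mass_def)
    also have "\<dots> \<le> ennreal (2 powr r) * (Lp_mass r (\<lambda>x. t M (x + u) - t M x) + Lp_mass r (\<lambda>x. ?e (x + u) - ?e x))"
      using r by (intro Lp_mass_add) auto
    also have "\<dots> \<le> ennreal (2 powr r) * (ennreal (c * L1_modulus (t M) u) + ennreal (2 powr r * (2 * \<epsilon>')))"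
      by (intro mult_left_mono add_mono 1 2) auto
    also have "\<dots> = ennreal (2 powr r * (c * L1_modulus (t M) u + 2 powr r * (2 * \<epsilon>')))"
      using c \<epsilon>' by (simp add: ennreal_mult'[symmetric] ennreal_plus[symmetric] L1_modulus_nonneg del: ennreal_plus)
    also have "\<dots> \<le> ennreal \<epsilon>"
    proof (rule ennreal_leI)
      have "L1_modulus (t M) u * (2 * (2 powr r * c)) \<le> \<epsilon>"
        using \<delta>(2)[OF False u] c by (simp add: pos_less_divide_eq)
      moreover have "2 powr r * (2 powr r * (2 * \<epsilon>')) = \<epsilon> / 2"
        by (simp add: \<epsilon>'_def)
      ultimately show "2 powr r * (c * L1_modulus (t M) u + 2 powr r * (2 * \<epsilon>')) \<le> \<epsilon>"
        by (simp add: algebra_simps)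
    qed
    finally show ?thesis .
  qed (use r in \<open>simp add: Lp_mass_def\<close>)
  then show ?thesis using \<delta>(1) by blast
qed

text \<open>Hoelder's inequality on \<open>B\<close>, obtained from \<open>kernel_jensen\<close>
  with the indicator of \<open>B\<close> as weight, the function |f|^p, and the exponent
  \<open>q / p\<close>. An upper bound \<open>V\<close> of the volume suffices because
  \<open>kernel_jensen\<close> allows one for the mass of the weight.\<close>

lemma Lp_mass_local_le:
  fixes f :: "'a :: euclidean_space \<Rightarrow> real"
  assumes [measurable]: "f \<in> borel_measurable borel" "B \<in> sets borel"
    and V: "emeasure lborel B < \<infinity>" "measure lborel B \<le> V" "V > 0"
    and f: "Lp_mass q f \<le> ennreal Q" "Q \<ge> 0" and p: "1 \<le> p" "p \<le> q"
  shows "(\<integral>\<^sup>+x. ennreal (\<bar>f x\<bar> powr p) * indicator B x \<partial>lborel) \<le> ennreal (V powr (1 - p / q) * Q powr (p / q))"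
proof -
  let ?c = "\<lambda>x. \<bar>f x\<bar> powr p * indicator B x"
  have iB: "integrable lborel (indicator B :: 'a \<Rightarrow> real)" using V by simp
  have pq: "q / p \<ge> 1" "p > 0" "q > 0" using p by auto
  have if': "integrable lborel (\<lambda>x. \<bar>f x\<bar> powr q)"
    using f by (intro integrableI_nonneg) (auto simp: Lp_mass_def intro: le_less_trans)
  have int: "integrable lborel ?c"
  proof (rule Bochner_Integration.integrable_bound[OF Bochner_Integration.integrable_add[OF iB if']])
    have "\<bar>f x\<bar> powr p \<le> 1 + \<bar>f x\<bar> powr q" for x
      using le_one_add_powr[of "\<bar>f x\<bar> powr p" "q / p"] pq by (simp add: powr_powr)
    then show "AE x in lborel. norm (?c x) \<le> norm (indicator B x + \<bar>f x\<bar> powr q)"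
      by (auto simp: indicator_def)
  qed measurable
  let ?I = "\<integral>x. ?c x \<partial>lborel"
  have "ennreal (\<bar>?I\<bar> powr (q / p)) \<le> ennreal (V powr (q / p - 1)) * (\<integral>\<^sup>+x. ennreal ((\<bar>f x\<bar> powr p) powr (q / p) * indicator B x) \<partial>lborel)"
    by (rule kernel_jensen) (use iB V pq in auto)
  also have "\<dots> \<le> ennreal (V powr (q / p - 1)) * Lp_mass q f"
    unfolding Lp_mass_def using pq
    by (intro mult_left_mono nn_integral_mono) (auto simp: powr_powr indicator_def)
  also have "\<dots> \<le> ennreal (V powr (q / p - 1) * Q)"
    using f by (simp add: ennreal_mult' mult_left_mono)
  finally have "\<bar>?I\<bar> powr (q / p) \<le> V powr (q / p - 1) * Q"
    using f by (subst (asm) ennreal_le_iff) auto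
  then have "(\<bar>?I\<bar> powr (q / p)) powr (p / q) \<le> (V powr (q / p - 1) * Q) powr (p / q)"
    using pq by (intro powr_mono2) auto
  then have "?I \<le> V powr (1 - p / q) * Q powr (p / q)"
    using pq f V by (simp add: powr_powr powr_mult left_diff_distrib diff_divide_distrib)
  moreover have "(\<integral>\<^sup>+x. ennreal (\<bar>f x\<bar> powr p) * indicator B x \<partial>lborel) = ennreal ?I"
    by (subst nn_integral_eq_integral[OF int, symmetric]) (auto simp: ennreal_mult' ennreal_indicator)
  ultimately show ?thesis by (simp add: ennreal_leI)
qed

text \<open>The elementary t \<le> 1 + t^r takes the place of Hoelder with a conjugate exponent. The
  bound is not homogeneous, but it depends on \<open>f\<close> only through its mass, hence is the
  same for all translates of \<open>f\<close>; this uniformity is what the Fubini arguments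
  use.\<close>

lemma Lp_mass_mult_bounded:
  fixes f \<Phi> :: "'a :: euclidean_space \<Rightarrow> real"
  assumes [measurable]: "f \<in> borel_measurable borel"
    and \<Phi>: "integrable lborel \<Phi>" "\<And>x. \<bar>\<Phi> x\<bar> \<le> C" and r: "r \<ge> 1"
  shows "(\<integral>\<^sup>+x. ennreal \<bar>f x * \<Phi> x\<bar> \<partial>lborel) \<le> ennreal (\<integral>x. \<bar>\<Phi> x\<bar> \<partial>lborel) + ennreal C * Lp_mass r f"
proof -
  have [measurable]: "\<Phi> \<in> borel_measurable borel" using \<Phi>(1) by auto
  have "(\<integral>\<^sup>+x. ennreal \<bar>f x * \<Phi> x\<bar> \<partial>lborel) \<le> (\<integral>\<^sup>+x. ennreal \<bar>\<Phi> x\<bar> + ennreal C * ennreal (\<bar>f x\<bar> powr r) \<partial>lborel)"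
  proof (rule nn_integral_mono)
    fix x
    have C: "C \<ge> 0" using \<Phi>(2)[of x] by linarith
    have "\<bar>f x * \<Phi> x\<bar> \<le> (1 + \<bar>f x\<bar> powr r) * \<bar>\<Phi> x\<bar>"
      using r by (simp add: abs_mult mult_right_mono le_one_add_powr)
    also have "\<dots> = \<bar>\<Phi> x\<bar> + \<bar>\<Phi> x\<bar> * \<bar>f x\<bar> powr r" by (simp add: algebra_simps)
    also have "\<dots> \<le> \<bar>\<Phi> x\<bar> + C * \<bar>f x\<bar> powr r" using \<Phi>(2)[of x] by (simp add: mult_right_mono)
    finally show "ennreal \<bar>f x * \<Phi> x\<bar> \<le> ennreal \<bar>\<Phi> x\<bar> + ennreal C * ennreal (\<bar>f x\<bar> powr r)"
      using C by (simp add: ennreal_mult'[symmetric] ennreal_plus[symmetric] ennreal_leI del: ennreal_plus)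
  qed
  also have "\<dots> = ennreal (\<integral>x. \<bar>\<Phi> x\<bar> \<partial>lborel) + ennreal C * Lp_mass r f"
    unfolding Lp_mass_def using \<Phi>(1)
    by (simp add: nn_integral_add nn_integral_cmult nn_integral_eq_integral)
  finally show ?thesis .
qed

lemma integrable_Lp_mult_bounded:
  fixes f \<Phi> :: "'a :: euclidean_space \<Rightarrow> real"
  assumes f: "f \<in> borel_measurable borel" "Lp_mass r f < \<infinity>"
    and \<Phi>: "integrable lborel \<Phi>" "\<And>x. \<bar>\<Phi> x\<bar> \<le> C" and r: "r \<ge> 1"
  shows "integrable lborel (\<lambda>x. f x * \<Phi> x)"
proof (rule integrableI_bounded)
  have "\<Phi> \<in> borel_measurable borel" using \<Phi>(1) by auto
  with f(1) show "(\<lambda>x. f x * \<Phi> x) \<in> borel_measurable lborel" by simp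
  have "(\<integral>\<^sup>+x. ennreal \<bar>f x * \<Phi> x\<bar> \<partial>lborel) \<le> ennreal (\<integral>x. \<bar>\<Phi> x\<bar> \<partial>lborel) + ennreal C * Lp_mass r f"
    by (rule Lp_mass_mult_bounded[OF f(1) \<Phi> r])
  also have "\<dots> < \<infinity>" using f(2) by (auto simp: less_top[symmetric] ennreal_mult_eq_top_iff)
  finally show "(\<integral>\<^sup>+x. ennreal (norm (f x * \<Phi> x)) \<partial>lborel) < \<infinity>" by simp
qed

section \<open>Mollification as averaging over translates\<close>

definition smear :: "('a :: euclidean_space \<Rightarrow> real) \<Rightarrow> ('a \<Rightarrow> real) \<Rightarrow> 'a \<Rightarrow> real" where
  "smear \<rho> f x = (\<integral>z. \<rho> z * f (x + z) \<partial>lborel)"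

lemma smear_borel [measurable]:
  assumes [measurable]: "\<rho> \<in> borel_measurable borel" "f \<in> borel_measurable borel"
  shows "smear \<rho> f \<in> borel_measurable borel"
  unfolding smear_def[abs_def] by (rule lborel.borel_measurable_lebesgue_integral) measurable

text \<open>Moves the averaging from \<open>f\<close> to the other factor. Both sides of a
  distributional identity for the fractional gradient are pairings of this kind, with
  \<open>\<Phi>\<close> the adjoint of a test function on one side and the test function itself on
  the other. As \<open>smear\<close> uses \<open>f (x + z)\<close>, it is convolution with the
  reflection of \<open>\<rho>\<close>.\<close>

lemma smear_duality:
  fixes f \<Phi> \<rho> :: "'a :: euclidean_space \<Rightarrow> real"
  assumes f: "f \<in> borel_measurable borel" "Lp_mass r f < \<infinity>"
    and \<Phi>: "integrable lborel \<Phi>" "\<And>x. \<bar>\<Phi> x\<bar> \<le> C" and r: "r \<ge> 1"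
    and \<rho>: "integrable lborel \<rho>"
  shows "(\<integral>x. smear \<rho> f x * \<Phi> x \<partial>lborel) = (\<integral>z. \<rho> z * (\<integral>y. f y * \<Phi> (y - z) \<partial>lborel) \<partial>lborel)"
proof -
  have [measurable]: "\<Phi> \<in> borel_measurable borel" "\<rho> \<in> borel_measurable borel" "f \<in> borel_measurable borel"
    using \<Phi>(1) \<rho> f by auto
  \<comment> \<open>A bound for the inner integral that does not depend on the translation
    \<open>z\<close>, so the double integral is at most the L^1 norm of \<open>\<rho>\<close> times
    \<open>?K\<close>.\<close>
  let ?K = "ennreal (\<integral>x. \<bar>\<Phi> x\<bar> \<partial>lborel) + ennreal C * Lp_mass r f"
  have K: "?K < \<infinity>" using f(2) by (auto simp: less_top[symmetric] ennreal_mult_eq_top_iff)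
  have int: "integrable (lborel \<Otimes>\<^sub>M lborel) (\<lambda>(z, x). \<rho> z * (f (x + z) * \<Phi> x))"
  proof (rule integrableI_bounded)
    show "(\<lambda>(z, x). \<rho> z * (f (x + z) * \<Phi> x)) \<in> borel_measurable (lborel \<Otimes>\<^sub>M lborel)" by measurable
    have "(\<integral>\<^sup>+w. ennreal (norm ((\<lambda>(z, x). \<rho> z * (f (x + z) * \<Phi> x)) w)) \<partial>(lborel \<Otimes>\<^sub>M lborel)) =
        (\<integral>\<^sup>+z. ennreal \<bar>\<rho> z\<bar> * (\<integral>\<^sup>+x. ennreal \<bar>f (x + z) * \<Phi> x\<bar> \<partial>lborel) \<partial>lborel)"
      by (subst lborel.nn_integral_fst[symmetric])
        (auto simp: abs_mult ennreal_mult' nn_integral_cmult)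
    also have "\<dots> \<le> (\<integral>\<^sup>+z. ennreal \<bar>\<rho> z\<bar> * ?K \<partial>lborel)"
    proof (intro nn_integral_mono mult_left_mono)
      fix z
      show "(\<integral>\<^sup>+x. ennreal \<bar>f (x + z) * \<Phi> x\<bar> \<partial>lborel) \<le> ?K"
        using Lp_mass_mult_bounded[of "\<lambda>x. f (x + z)" \<Phi> C r] \<Phi> r by (simp add: Lp_mass_translate)
    qed auto
    also have "\<dots> = ennreal (\<integral>z. \<bar>\<rho> z\<bar> \<partial>lborel) * ?K"
      using \<rho> by (simp add: nn_integral_multc nn_integral_eq_integral)
    also have "\<dots> < \<infinity>" using K by (auto simp: ennreal_mult_less_top)
    finally show "(\<integral>\<^sup>+w. ennreal (norm ((\<lambda>(z, x). \<rho> z * (f (x + z) * \<Phi> x)) w)) \<partial>(lborel \<Otimes>\<^sub>M lborel)) < \<infinity>" .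
  qed
  have "(\<integral>x. smear \<rho> f x * \<Phi> x \<partial>lborel) = (\<integral>x. (\<integral>z. \<rho> z * (f (x + z) * \<Phi> x) \<partial>lborel) \<partial>lborel)"
    unfolding smear_def by (simp flip: Bochner_Integration.integral_mult_left_zero add: mult.assoc)
  also have "\<dots> = (\<integral>z. (\<integral>x. \<rho> z * (f (x + z) * \<Phi> x) \<partial>lborel) \<partial>lborel)"
    by (rule lborel_pair.Fubini_integral[OF int])
  also have "\<dots> = (\<integral>z. \<rho> z * (\<integral>y. f y * \<Phi> (y - z) \<partial>lborel) \<partial>lborel)"
  proof (rule Bochner_Integration.integral_cong[OF refl])
    fix z
    have "(\<integral>x. f (x + z) * \<Phi> (x + z - z) \<partial>lborel) = (\<integral>y. f y * \<Phi> (y - z) \<partial>lborel)"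
      by (rule integral_lborel_translate[of "\<lambda>y. f y * \<Phi> (y - z)"]) measurable
    then show "(\<integral>x. \<rho> z * (f (x + z) * \<Phi> x) \<partial>lborel) = \<rho> z * (\<integral>y. f y * \<Phi> (y - z) \<partial>lborel)"
      by simp
  qed
  finally show ?thesis .
qed

text \<open>The error at \<open>x\<close> is an average of increments f(x + z) - f(x) over the
  probability density \<open>\<rho>\<close>. Jensen and Tonelli bound its mass by the average of the
  masses of these increments. The bound \<open>C\<close> on \<open>\<rho>\<close> makes f(x + z)
  \<rho>(z) integrable in z, so that f(x) can be moved under the integral.\<close>

lemma smear_approx:
  fixes f \<rho> :: "'a :: euclidean_space \<Rightarrow> real"
  assumes f: "f \<in> borel_measurable borel" "Lp_mass r f < \<infinity>" and r: "r \<ge> 1"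
    and \<rho>: "integrable lborel \<rho>" "\<And>z. \<rho> z \<ge> 0" "\<And>z. \<rho> z \<le> C" "(\<integral>z. \<rho> z \<partial>lborel) = 1"
    and supp: "\<And>z. norm z \<ge> \<delta> \<Longrightarrow> \<rho> z = 0"
    and close: "\<And>u. norm u < \<delta> \<Longrightarrow> Lp_mass r (\<lambda>x. f (x + u) - f x) \<le> E"
  shows "Lp_mass r (\<lambda>x. smear \<rho> f x - f x) \<le> E"
proof -
  have [measurable]: "\<rho> \<in> borel_measurable borel" "f \<in> borel_measurable borel"
    using \<rho> f by auto
  have diff: "smear \<rho> f x - f x = (\<integral>z. \<rho> z * (f (x + z) - f x) \<partial>lborel)" for x
  proof -
    have "integrable lborel (\<lambda>z. f (x + z) * \<rho> z)"
      by (rule integrable_Lp_mult_bounded[where r = r and C = C])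
        (use f \<rho> r Lp_mass_translate[OF f(1), of r x] in \<open>auto simp: add.commute[of _ x]\<close>)
    then show ?thesis
      using \<rho> by (simp add: smear_def right_diff_distrib mult.commute Bochner_Integration.integral_diff)
  qed
  have "Lp_mass r (\<lambda>x. smear \<rho> f x - f x) \<le> (\<integral>\<^sup>+x. (\<integral>\<^sup>+z. ennreal (\<bar>f (x + z) - f x\<bar> powr r * \<rho> z) \<partial>lborel) \<partial>lborel)"
    unfolding Lp_mass_def diff
  proof (rule nn_integral_mono)
    fix x
    have "ennreal (\<bar>\<integral>z. \<rho> z * (f (x + z) - f x) \<partial>lborel\<bar> powr r) \<le>
        ennreal (1 powr (r - 1)) * (\<integral>\<^sup>+z. ennreal (\<bar>f (x + z) - f x\<bar> powr r * \<rho> z) \<partial>lborel)"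
      by (rule kernel_jensen) (use \<rho> r in \<open>auto simp: abs_mult mult.commute\<close>)
    then show "ennreal (\<bar>\<integral>z. \<rho> z * (f (x + z) - f x) \<partial>lborel\<bar> powr r) \<le> (\<integral>\<^sup>+z. ennreal (\<bar>f (x + z) - f x\<bar> powr r * \<rho> z) \<partial>lborel)"
      by simp
  qed
  also have "\<dots> = (\<integral>\<^sup>+z. (\<integral>\<^sup>+x. ennreal (\<bar>f (x + z) - f x\<bar> powr r * \<rho> z) \<partial>lborel) \<partial>lborel)"
    by (rule lborel_pair.Fubini'[symmetric]) measurable
  also have "\<dots> = (\<integral>\<^sup>+z. Lp_mass r (\<lambda>x. f (x + z) - f x) * ennreal (\<rho> z) \<partial>lborel)"
    unfolding Lp_mass_def using \<rho>(2) by (simp add: ennreal_mult' ennreal_mult nn_integral_multc)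
  also have "\<dots> \<le> (\<integral>\<^sup>+z. E * ennreal (\<rho> z) \<partial>lborel)"
  proof (rule nn_integral_mono)
    fix z
    show "Lp_mass r (\<lambda>x. f (x + z) - f x) * ennreal (\<rho> z) \<le> E * ennreal (\<rho> z)"
      using close[of z] supp[of z] by (cases "norm z < \<delta>") (auto intro: mult_right_mono)
  qed
  also have "\<dots> = E"
    using \<rho> by (simp add: nn_integral_cmult nn_integral_eq_integral)
  finally show ?thesis .
qed

section \<open>The stable Levy measure\<close>

text \<open>Split at r = R. Below, the integrand is r^(1 - \<alpha>)/R, integrable at 0 because
  \<open>\<alpha> < 2\<close>; above, it is r^(-\<alpha>), integrable at infinity because
  \<open>\<alpha> > 1\<close>. The two pieces yield the two summands of the constant, with the same
  power of R.\<close>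

lemma nn_integral_truncated_powr:
  fixes \<alpha> R :: real
  assumes \<alpha>: "1 < \<alpha>" "\<alpha> < 2" and R: "R > 0"
  shows "(\<integral>\<^sup>+r\<in>{0<..}. ennreal (min 1 (r / R) * r) * ennreal (1 / r powr (\<alpha> + 1)) \<partial>lborel)
    \<le> ennreal ((1 / (2 - \<alpha>) + 1 / (\<alpha> - 1)) * R powr (1 - \<alpha>))"
proof -
  have 1: "(\<integral>\<^sup>+r. ennreal (r powr (1 - \<alpha>)) * indicator {0..R} r \<partial>lborel) = ennreal (R powr (2 - \<alpha>) / (2 - \<alpha>))"
    using has_integral_powr_from_0[of "1 - \<alpha>" R] \<alpha> R by (intro nn_integral_has_integral_lebesgue') auto
  have 2: "(\<integral>\<^sup>+r. ennreal (r powr (- \<alpha>)) * indicator {R..} r \<partial>lborel) = ennreal (R powr (1 - \<alpha>) / (\<alpha> - 1))"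
  proof (rule nn_integral_has_integral_lebesgue')
    have "- (R powr (- \<alpha> + 1)) / (- \<alpha> + 1) = R powr (1 - \<alpha>) / (\<alpha> - 1)"
      using \<alpha> by (simp add: divide_simps) (simp add: algebra_simps)
    then show "((\<lambda>r. r powr - \<alpha>) has_integral R powr (1 - \<alpha>) / (\<alpha> - 1)) {R..}"
      using has_integral_powr_to_inf[of "- \<alpha>" R] \<alpha> R by simp
  qed simp
  have "(\<integral>\<^sup>+r\<in>{0<..}. ennreal (min 1 (r / R) * r) * ennreal (1 / r powr (\<alpha> + 1)) \<partial>lborel) \<le>
    (\<integral>\<^sup>+r. ennreal (1 / R) * (ennreal (r powr (1 - \<alpha>)) * indicator {0..R} r) + ennreal (r powr (- \<alpha>)) * indicator {R..} r \<partial>lborel)"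
  proof (rule nn_integral_mono)
    fix r :: real
    show "ennreal (min 1 (r / R) * r) * ennreal (1 / r powr (\<alpha> + 1)) * indicator {0<..} r \<le>
      ennreal (1 / R) * (ennreal (r powr (1 - \<alpha>)) * indicator {0..R} r) + ennreal (r powr (- \<alpha>)) * indicator {R..} r"
    proof (cases "r > 0")
      case True
      have e: "r * (1 / r powr (\<alpha> + 1)) = r powr (- \<alpha>)" "r * r powr (- \<alpha>) = r powr (1 - \<alpha>)"
        using True by (auto simp: powr_add powr_minus powr_diff field_simps)
      have "ennreal (min 1 (r / R) * r) * ennreal (1 / r powr (\<alpha> + 1)) = ennreal (min 1 (r / R) * r powr (- \<alpha>))"
        using True R by (subst ennreal_mult'[symmetric]) (auto simp: mult.assoc e(1)[symmetric])
      moreover have "ennreal (min 1 (r / R) * r powr (- \<alpha>)) \<le>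
         ennreal (1 / R) * (ennreal (r powr (1 - \<alpha>)) * indicator {0..R} r) + ennreal (r powr (- \<alpha>)) * indicator {R..} r"
      proof (cases "r \<le> R")
        case le: True
        have "ennreal (min 1 (r / R) * r powr (- \<alpha>)) = ennreal (1 / R) * ennreal (r powr (1 - \<alpha>))"
          using True le R by (simp add: ennreal_mult'[symmetric] e(2)[symmetric] min_def divide_simps)
        also have "\<dots> \<le> ennreal (1 / R) * (ennreal (r powr (1 - \<alpha>)) * indicator {0..R} r) + ennreal (r powr (- \<alpha>)) * indicator {R..} r"
          using True le by simp
        finally show ?thesis .
      qed (use R in \<open>simp add: min_def\<close>)
      ultimately show ?thesis using True by simp
    qed simp
  qed
  also have "\<dots> = ennreal (1 / R) * ennreal (R powr (2 - \<alpha>) / (2 - \<alpha>)) + ennreal (R powr (1 - \<alpha>) / (\<alpha> - 1))"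
    by (subst nn_integral_add, simp, simp, subst nn_integral_cmult, simp) (simp only: 1 2)
  also have "\<dots> = ennreal (1 / R * (R powr (2 - \<alpha>) / (2 - \<alpha>)) + R powr (1 - \<alpha>) / (\<alpha> - 1))"
    using \<alpha> R by (simp add: ennreal_mult'[symmetric] ennreal_plus[symmetric] del: ennreal_plus)
  also have "1 / R * (R powr (2 - \<alpha>) / (2 - \<alpha>)) + R powr (1 - \<alpha>) / (\<alpha> - 1) = (1 / (2 - \<alpha>) + 1 / (\<alpha> - 1)) * R powr (1 - \<alpha>)"
  proof -
    have "R powr (2 - \<alpha>) = R * R powr (1 - \<alpha>)" using R by (simp add: powr_mult_base)
    then show ?thesis using R by (simp add: algebra_simps)
  qed
  finally show ?thesis .
qed

text \<open>The factor \<open>min 1 (norm u / R)\<close> measures the increment of a cutoff at scale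
  \<open>R\<close>, and \<open>norm u\<close> dominates a component of \<open>u\<close>. With
  \<open>R = 1\<close> the same weight controls the integrand of \<open>frac_grad_adj\<close> on
  Schwartz functions.\<close>

definition trunc_weight :: "real \<Rightarrow> real ^ 'n \<Rightarrow> real" where
  "trunc_weight R u = min 1 (norm u / R) * norm u"

lemma trunc_weight_borel [measurable]: "trunc_weight R \<in> borel_measurable borel"
  unfolding trunc_weight_def[abs_def] by measurable

lemma trunc_weight_nonneg: "R > 0 \<Longrightarrow> trunc_weight R u \<ge> 0"
  by (simp add: trunc_weight_def)

locale stable_levy =
  fixes \<alpha> :: real and \<sigma> \<nu> :: "(real ^ 'n) measure"
  assumes \<alpha>: "1 < \<alpha>" "\<alpha> < 2"
    and \<sigma>: "symmetric_spherical_measure \<sigma>"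
    and \<nu>: "\<nu> = stable_levy_measure \<alpha> \<sigma>"
begin

lemma sets_\<nu> [simp, measurable_cong]: "sets \<nu> = sets borel"
  by (simp add: \<nu>)

lemma space_\<nu> [simp]: "space \<nu> = UNIV"
  by (simp add: \<nu>)

lemma measurable_\<nu> [simp]: "borel_measurable \<nu> = borel_measurable borel"
  by (rule measurable_cong_sets) auto

lemma borel_measurable_\<sigma>_id: "(\<lambda>y. y) \<in> borel_measurable \<sigma>"
  using \<sigma> measurable_cong_sets[OF _ refl, of \<sigma> "restrict_space borel (sphere 0 1)"]
    measurable_restrict_space1[OF measurable_ident_sets[OF refl]]
  by (auto simp: symmetric_spherical_measure_def)

lemma norm_space_\<sigma>: "y \<in> space \<sigma> \<Longrightarrow> norm y = 1"
  using \<sigma> sets_eq_imp_space_eq[of \<sigma> "restrict_space borel (sphere 0 1)"]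
  by (auto simp: symmetric_spherical_measure_def space_restrict_space)

text \<open>The measure is the image, under (y, r) \<mapsto> r y, of a density on the product of
  \<open>\<sigma>\<close> and Lebesgue measure. Once this is checked on Borel sets, the polar
  formula extends from indicators to all nonnegative Borel functions.\<close>

lemma nn_integral_\<nu>:
  assumes [measurable]: "g \<in> borel_measurable borel"
  shows "(\<integral>\<^sup>+u. g u \<partial>\<nu>) = (\<integral>\<^sup>+y. (\<integral>\<^sup>+r\<in>{0<..}. g (r *\<^sub>R y) * ennreal (1 / r powr (\<alpha> + 1)) \<partial>lborel) \<partial>\<sigma>)"
proof -
  let ?h = "\<lambda>(y, r). ennreal (1 / r powr (\<alpha> + 1)) * indicator {0<..} (r :: real)"
  let ?T = "\<lambda>(y :: real ^ 'n, r). r *\<^sub>R y"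
  note [measurable] = borel_measurable_\<sigma>_id
  have [measurable]: "?h \<in> borel_measurable (\<sigma> \<Otimes>\<^sub>M lborel)" "?T \<in> borel_measurable (\<sigma> \<Otimes>\<^sub>M lborel)"
    by measurable
  have eq: "\<nu> = distr (density (\<sigma> \<Otimes>\<^sub>M lborel) ?h) borel ?T"
  proof (rule measure_eqI)
    fix A assume "A \<in> sets \<nu>"
    then have A [measurable]: "A \<in> sets borel" by simp
    have "emeasure (distr (density (\<sigma> \<Otimes>\<^sub>M lborel) ?h) borel ?T) A =
        (\<integral>\<^sup>+w. ?h w * indicator (?T -` A \<inter> space (\<sigma> \<Otimes>\<^sub>M lborel)) w \<partial>(\<sigma> \<Otimes>\<^sub>M lborel))"
      by (subst emeasure_distr, simp, simp, simp, rule emeasure_density) measurable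
    also have "\<dots> = (\<integral>\<^sup>+w. ?h w * indicator A (?T w) \<partial>(\<sigma> \<Otimes>\<^sub>M lborel))"
      by (intro nn_integral_cong) (auto simp: indicator_def)
    also have "\<dots> = (\<integral>\<^sup>+y. (\<integral>\<^sup>+r. ?h (y, r) * indicator A (?T (y, r)) \<partial>lborel) \<partial>\<sigma>)"
      by (rule lborel.nn_integral_fst[symmetric]) measurable
    also have "\<dots> = emeasure \<nu> A"
      unfolding \<nu> emeasure_stable_levy_measure[OF \<sigma> A] by (simp add: mult_ac)
    finally show "emeasure \<nu> A = emeasure (distr (density (\<sigma> \<Otimes>\<^sub>M lborel) ?h) borel ?T) A" ..
  qed simp
  have "(\<integral>\<^sup>+u. g u \<partial>\<nu>) = (\<integral>\<^sup>+w. ?h w * g (?T w) \<partial>(\<sigma> \<Otimes>\<^sub>M lborel))"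
    unfolding eq by (subst nn_integral_distr) (auto simp: nn_integral_density)
  also have "\<dots> = (\<integral>\<^sup>+y. (\<integral>\<^sup>+r. ?h (y, r) * g (?T (y, r)) \<partial>lborel) \<partial>\<sigma>)"
    by (rule lborel.nn_integral_fst[symmetric]) measurable
  finally show ?thesis by (simp add: mult_ac)
qed

text \<open>The summand \<open>1\<close> keeps the constant positive when \<open>\<sigma>\<close> vanishes.\<close>

definition moment :: real where
  "moment = (1 / (2 - \<alpha>) + 1 / (\<alpha> - 1)) * (measure \<sigma> (space \<sigma>) + 1)"

lemma moment_pos: "moment > 0"
  using \<alpha> unfolding moment_def by (intro mult_pos_pos add_pos_pos add_nonneg_pos) auto

lemma nn_integral_trunc_weight:
  assumes R: "R > 0"
  shows "(\<integral>\<^sup>+u. ennreal (trunc_weight R u) \<partial>\<nu>) \<le> ennreal (moment * R powr (1 - \<alpha>))"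
proof -
  interpret \<sigma>: finite_measure \<sigma> using \<sigma> by (simp add: symmetric_spherical_measure_def)
  let ?K = "(1 / (2 - \<alpha>) + 1 / (\<alpha> - 1)) * R powr (1 - \<alpha>)"
  have "(\<integral>\<^sup>+u. ennreal (trunc_weight R u) \<partial>\<nu>) =
      (\<integral>\<^sup>+y. (\<integral>\<^sup>+r\<in>{0<..}. ennreal (trunc_weight R (r *\<^sub>R y)) * ennreal (1 / r powr (\<alpha> + 1)) \<partial>lborel) \<partial>\<sigma>)"
    by (rule nn_integral_\<nu>) measurable
  also have "\<dots> \<le> (\<integral>\<^sup>+y. ennreal ?K \<partial>\<sigma>)"
  proof (rule nn_integral_mono)
    fix y assume y: "y \<in> space \<sigma>"
    have "(\<integral>\<^sup>+r\<in>{0<..}. ennreal (trunc_weight R (r *\<^sub>R y)) * ennreal (1 / r powr (\<alpha> + 1)) \<partial>lborel) =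
      (\<integral>\<^sup>+r\<in>{0<..}. ennreal (min 1 (r / R) * r) * ennreal (1 / r powr (\<alpha> + 1)) \<partial>lborel)"
      using norm_space_\<sigma>[OF y] by (intro nn_integral_cong) (auto simp: trunc_weight_def indicator_def)
    with nn_integral_truncated_powr[OF \<alpha> R]
    show "(\<integral>\<^sup>+r\<in>{0<..}. ennreal (trunc_weight R (r *\<^sub>R y)) * ennreal (1 / r powr (\<alpha> + 1)) \<partial>lborel) \<le> ennreal ?K"
      by simp
  qed
  also have "\<dots> = ennreal (?K * measure \<sigma> (space \<sigma>))"
    using \<alpha> by (simp add: \<sigma>.emeasure_eq_measure ennreal_mult'[symmetric])
  also have "\<dots> \<le> ennreal (moment * R powr (1 - \<alpha>))"
  proof (rule ennreal_leI)
    define a where "a = 1 / (2 - \<alpha>) + 1 / (\<alpha> - 1)"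
    have "a \<ge> 0" using \<alpha> by (simp add: a_def)
    then show "?K * measure \<sigma> (space \<sigma>) \<le> moment * R powr (1 - \<alpha>)"
      unfolding moment_def a_def[symmetric] by (simp add: algebra_simps)
  qed
  finally show ?thesis .
qed

lemma integrable_trunc_weight:
  assumes "R > 0" shows "integrable \<nu> (trunc_weight R)"
proof (rule integrableI_bounded)
  show "(\<integral>\<^sup>+u. ennreal (norm (trunc_weight R u)) \<partial>\<nu>) < \<infinity>"
    using le_less_trans[OF nn_integral_trunc_weight[OF assms] ennreal_less_top]
    by (simp add: abs_of_nonneg trunc_weight_nonneg[OF assms])
qed simp

lemma integral_trunc_weight_le:
  assumes "R > 0" shows "(\<integral>u. trunc_weight R u \<partial>\<nu>) \<le> moment * R powr (1 - \<alpha>)"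
proof -
  have "ennreal (\<integral>u. trunc_weight R u \<partial>\<nu>) \<le> ennreal (moment * R powr (1 - \<alpha>))"
    using nn_integral_trunc_weight[OF assms] trunc_weight_nonneg[OF assms]
    by (subst nn_integral_eq_integral[symmetric, OF integrable_trunc_weight[OF assms]]) auto
  then show ?thesis using moment_pos by (subst (asm) ennreal_le_iff) auto
qed

lemma emeasure_\<nu>_0: "emeasure \<nu> {0} = 0"
proof -
  have "emeasure \<nu> {0} = (\<integral>\<^sup>+u. indicator {0} u \<partial>\<nu>)" by simp
  also have "\<dots> = (\<integral>\<^sup>+y. (\<integral>\<^sup>+r\<in>{0<..}. indicator {0} (r *\<^sub>R y) * ennreal (1 / r powr (\<alpha> + 1)) \<partial>lborel) \<partial>\<sigma>)"
    by (rule nn_integral_\<nu>) measurable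
  also have "\<dots> = (\<integral>\<^sup>+y. 0 \<partial>\<sigma>)"
  proof (rule nn_integral_cong)
    fix y assume "y \<in> space \<sigma>"
    then have "y \<noteq> 0" using norm_space_\<sigma>[of y] by auto
    then have "indicator {0} (r *\<^sub>R y) * ennreal (1 / r powr (\<alpha> + 1)) * indicator {0<..} r = 0" for r
      by (auto simp: indicator_def)
    then show "(\<integral>\<^sup>+r\<in>{0<..}. indicator {0} (r *\<^sub>R y) * ennreal (1 / r powr (\<alpha> + 1)) \<partial>lborel) = 0"
      by (simp only: nn_integral_const mult_zero_left)
  qed
  finally show ?thesis by simp
qed

text \<open>Needed for Fubini, as the mass may be infinite near the origin. The sets where n times
  the weight is at least 1 have finite measure by Markov's inequality and exhaust everything but the
  origin, which is a null set.\<close>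

lemma sigma_finite_\<nu>: "sigma_finite_measure \<nu>"
proof
  define A where "A n = {u :: real ^ 'n. 1 \<le> real n * trunc_weight 1 u}" for n
  have A [measurable]: "A n \<in> sets borel" for n unfolding A_def by measurable
  have "emeasure \<nu> (A n) \<noteq> \<infinity>" for n
  proof -
    have "emeasure \<nu> ({u \<in> UNIV. 1 \<le> ennreal (real n) * ennreal (trunc_weight 1 u)}) \<le>
        ennreal (real n) * (\<integral>\<^sup>+u. ennreal (trunc_weight 1 u) * indicator UNIV u \<partial>\<nu>)"
      by (rule nn_integral_Markov_inequality) auto
    moreover have "{u \<in> UNIV. 1 \<le> ennreal (real n) * ennreal (trunc_weight 1 u)} = A n"
      by (auto simp: A_def ennreal_mult'[symmetric] trunc_weight_nonneg)
    moreover have "(\<integral>\<^sup>+u. ennreal (trunc_weight 1 u) * indicator UNIV u \<partial>\<nu>) < \<infinity>"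
      using le_less_trans[OF nn_integral_trunc_weight[of 1] ennreal_less_top] by simp
    ultimately show ?thesis
      by (auto simp: top_unique ennreal_mult_eq_top_iff)
  qed
  moreover have "\<Union> (insert {0} (range A)) = UNIV"
  proof -
    have "u = 0 \<or> (\<exists>n. u \<in> A n)" for u :: "real ^ 'n"
    proof (cases "u = 0")
      case False
      then have "trunc_weight 1 u > 0" by (simp add: trunc_weight_def)
      then obtain n where "1 < real n * trunc_weight 1 u" using reals_Archimedean3 by blast
      then show ?thesis by (auto simp: A_def intro!: exI[of _ n])
    qed simp
    then show ?thesis by auto
  qed
  ultimately show "\<exists>A. countable A \<and> A \<subseteq> sets \<nu> \<and> \<Union> A = space \<nu> \<and> (\<forall>a\<in>A. emeasure \<nu> a \<noteq> \<infinity>)"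
    using A by (intro exI[of _ "insert {0} (range A)"]) (auto simp: emeasure_\<nu>_0)
qed

sublocale \<nu>: sigma_finite_measure \<nu>
  by (rule sigma_finite_\<nu>)

sublocale pair: pair_sigma_finite "lborel :: (real ^ 'n) measure" \<nu> ..

text \<open>The criterion behind each exchange of signed integrals over space and
  \<open>\<nu>\<close>: an L^1 bound in \<open>x\<close> proportional to the weight, whose
  \<open>\<nu>\<close>-integral is finite.\<close>

lemma integrable_pair:
  fixes J :: "real ^ 'n \<Rightarrow> real ^ 'n \<Rightarrow> real"
  assumes [measurable]: "case_prod J \<in> borel_measurable (borel \<Otimes>\<^sub>M borel)"
    and R: "R > 0" and A: "A < \<infinity>"
    and le: "\<And>u. (\<integral>\<^sup>+x. ennreal \<bar>J x u\<bar> \<partial>lborel) \<le> A * ennreal (trunc_weight R u)"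
  shows "integrable (lborel \<Otimes>\<^sub>M \<nu>) (case_prod J)"
proof (rule integrableI_bounded)
  show m: "case_prod J \<in> borel_measurable (lborel \<Otimes>\<^sub>M \<nu>)"
    by measurable
  have "(\<integral>\<^sup>+w. ennreal (norm (case_prod J w)) \<partial>(lborel \<Otimes>\<^sub>M \<nu>)) = (\<integral>\<^sup>+u. (\<integral>\<^sup>+x. ennreal \<bar>J x u\<bar> \<partial>lborel) \<partial>\<nu>)"
    by (subst pair.nn_integral_snd[symmetric]) (use m in auto)
  also have "\<dots> \<le> (\<integral>\<^sup>+u. A * ennreal (trunc_weight R u) \<partial>\<nu>)"
    by (intro nn_integral_mono le)
  also have "\<dots> = A * (\<integral>\<^sup>+u. ennreal (trunc_weight R u) \<partial>\<nu>)"
    by (rule nn_integral_cmult) simp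
  also have "\<dots> < \<infinity>"
    using A le_less_trans[OF nn_integral_trunc_weight[OF R] ennreal_less_top]
    by (auto simp: ennreal_mult_less_top)
  finally show "(\<integral>\<^sup>+w. ennreal (norm (case_prod J w)) \<partial>(lborel \<Otimes>\<^sub>M \<nu>)) < \<infinity>" .
qed

section \<open>The adjoint on Schwartz functions\<close>

lemma schwartz_increment_le:
  assumes "\<phi> \<in> schwartz"
  obtains C where "C > 0" "\<And>x u :: real ^ 'n. \<bar>\<phi> (x - u) - \<phi> x\<bar> \<le>
    min 1 (norm u) * (C * (1 / (1 + norm x) ^ (CARD('n) + 2)) + \<bar>\<phi> (x - u)\<bar> + \<bar>\<phi> x\<bar>)"
proof -
  let ?N = "CARD('n) + 2"
  have d: "\<phi> differentiable_on UNIV" using assms by (intro C_inf_differentiable schwartz_C_inf)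
  have "\<exists>C>0. \<forall>x. \<bar>partial_deriv i \<phi> x\<bar> \<le> C / (1 + norm x) ^ ?N" for i
    using schwartz_decay[OF schwartz_partial_deriv[OF assms], where N = ?N] by metis
  then obtain D where D: "\<And>i. D i > 0" "\<And>i x. \<bar>partial_deriv i \<phi> x\<bar> \<le> D i / (1 + norm x) ^ ?N"
    by metis
  define C where "C = (\<Sum>i\<in>UNIV. D i)"
  have C: "C > 0" unfolding C_def using D(1) by (intro sum_pos) auto
  have DC: "D i \<le> C" for i unfolding C_def using D(1) by (intro member_le_sum) (auto intro: less_imp_le)
  \<comment> \<open>\<open>CARD('n)\<close> comes from the mean value inequality, and
    \<open>2 ^ ?N\<close> from comparing the decay at \<open>x\<close> with the decay at a point
    \<open>z\<close> of the unit ball around \<open>x\<close>, where 1 + |x| \<le> 2 (1 +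
    |z|).\<close>
  define C' where "C' = CARD('n) * (2 ^ ?N * C)"
  have "\<bar>\<phi> (x - u) - \<phi> x\<bar> \<le> min 1 (norm u) * (C' * (1 / (1 + norm x) ^ ?N) + \<bar>\<phi> (x - u)\<bar> + \<bar>\<phi> x\<bar>)" for x u
  proof (cases "norm u \<le> 1")
    case True
    \<comment> \<open>For short \<open>u\<close> the mean value inequality is applied on the unit
      ball around \<open>x\<close> rather than on the whole space: this keeps the decay in
      \<open>x\<close>, and with it integrability. For long \<open>u\<close> the last two summands
      of the claim suffice.\<close>
    have "\<bar>\<phi> (x - u) - \<phi> x\<bar> \<le> CARD('n) * (2 ^ ?N * C / (1 + norm x) ^ ?N) * norm (x - u - x)"
    proof (rule abs_diff_le_partial_deriv[OF d convex_cball[of x 1]])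
      fix z i assume z: "z \<in> cball x 1"
      have "norm x \<le> 1 + norm z"
        using z norm_triangle_ineq4[of x z] norm_triangle_sub[of x z] by (auto simp: dist_norm)
      moreover have "0 \<le> norm z" by simp
      ultimately have "1 + norm x \<le> 2 * (1 + norm z)" by argo
      then have "(1 + norm x) ^ ?N \<le> (2 * (1 + norm z)) ^ ?N" by (intro power_mono) auto
      then have le: "(1 + norm x) ^ ?N \<le> 2 ^ ?N * (1 + norm z) ^ ?N" by (simp only: power_mult_distrib)
      have pos: "(1 + norm x) ^ ?N > 0" "(1 + norm z) ^ ?N > 0"
        by (auto intro!: zero_less_power simp: add_pos_nonneg simp del: power_Suc power_add_numeral)
      have "\<bar>partial_deriv i \<phi> z\<bar> \<le> C / (1 + norm z) ^ ?N"
        using D(2)[of i z] DC[of i] pos by (meson divide_right_mono less_imp_le order_trans)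
      also have "\<dots> \<le> 2 ^ ?N * C / (1 + norm x) ^ ?N"
      proof -
        have "c / b \<le> k * c / a" if "a \<le> k * b" "a > 0" "b > 0" "c > 0" for a b c k :: real
          using that mult_left_mono[OF that(1), of c] by (simp add: divide_simps mult_ac)
        from this[OF le pos C] show ?thesis .
      qed
      finally show "\<bar>partial_deriv i \<phi> z\<bar> \<le> 2 ^ ?N * C / (1 + norm x) ^ ?N" .
    qed (use True in \<open>auto simp: dist_norm\<close>)
    also have "\<dots> = min 1 (norm u) * (C' * (1 / (1 + norm x) ^ ?N))"
      using True by (simp add: C'_def)
    also have "\<dots> \<le> min 1 (norm u) * (C' * (1 / (1 + norm x) ^ ?N) + \<bar>\<phi> (x - u)\<bar> + \<bar>\<phi> x\<bar>)"
      by (intro mult_left_mono) auto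
    finally show ?thesis .
  next
    case False
    have "0 \<le> C' * (1 / (1 + norm x) ^ ?N)" using C by (simp add: C'_def)
    then show ?thesis using False abs_triangle_ineq4[of "\<phi> (x - u)" "\<phi> x"] by simp
  qed
  moreover have "C' > 0" using C by (simp add: C'_def)
  ultimately show ?thesis using that by blast
qed

end

lemma borel_measurable_vec_nth [measurable (raw)]:
  fixes f :: "'a \<Rightarrow> real ^ 'n"
  shows "f \<in> borel_measurable M \<Longrightarrow> (\<lambda>x. f x $ k) \<in> borel_measurable M"
  by (rule borel_measurable_continuous_on[of "\<lambda>v. v $ k"]) (auto intro!: continuous_intros)

context stable_levy
begin

lemma nn_integral_schwartz_increment_le:
  fixes \<phi> :: "real ^ 'n \<Rightarrow> real"
  assumes "\<phi> \<in> schwartz"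
  shows "\<exists>A\<ge>0. \<forall>u. (\<integral>\<^sup>+x. ennreal \<bar>(\<phi> (x - u) - \<phi> x) * u $ k\<bar> \<partial>lborel) \<le> ennreal A * ennreal (trunc_weight 1 u)"
proof -
  define w where "w x = 1 / (1 + norm x) ^ (CARD('n) + 2)" for x :: "real ^ 'n"
  have w: "integrable lborel w" "w x \<ge> 0" for x
    using integrable_decay[where 'n = 'n] unfolding w_def[abs_def] by simp_all
  obtain C where C: "C > 0" "\<And>x u :: real ^ 'n. \<bar>\<phi> (x - u) - \<phi> x\<bar> \<le>
    min 1 (norm u) * (C * w x + \<bar>\<phi> (x - u)\<bar> + \<bar>\<phi> x\<bar>)"
    using schwartz_increment_le[OF assms, folded w_def] by blast
  have int: "integrable lborel \<phi>" by (rule schwartz_integrable[OF assms])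
  have int': "integrable lborel (\<lambda>x. \<phi> (x - u))" for u
    using integrable_lborel_translate[OF int, of "- u"] by simp
  have [measurable]: "\<phi> \<in> borel_measurable borel" using assms by (intro C_inf_borel schwartz_C_inf)
  define A where "A = C * (\<integral>x. w x \<partial>lborel) + 2 * (\<integral>x. \<bar>\<phi> x\<bar> \<partial>lborel)"
  have "A \<ge> 0"
    unfolding A_def using C(1) w by (intro add_nonneg_nonneg mult_nonneg_nonneg Bochner_Integration.integral_nonneg) auto
  moreover have "(\<integral>\<^sup>+x. ennreal \<bar>(\<phi> (x - u) - \<phi> x) * u $ k\<bar> \<partial>lborel) \<le> ennreal A * ennreal (trunc_weight 1 u)" for u
  proof -
    have "\<bar>(\<phi> (x - u) - \<phi> x) * u $ k\<bar> \<le> (C * w x + \<bar>\<phi> (x - u)\<bar> + \<bar>\<phi> x\<bar>) * trunc_weight 1 u" for x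
    proof -
      have "\<bar>(\<phi> (x - u) - \<phi> x) * u $ k\<bar> \<le> (min 1 (norm u) * (C * w x + \<bar>\<phi> (x - u)\<bar> + \<bar>\<phi> x\<bar>)) * norm u"
        unfolding abs_mult using C w by (intro mult_mono component_le_norm_cart) (auto intro!: mult_nonneg_nonneg add_nonneg_nonneg)
      then show ?thesis by (simp add: trunc_weight_def mult_ac)
    qed
    then have "(\<integral>\<^sup>+x. ennreal \<bar>(\<phi> (x - u) - \<phi> x) * u $ k\<bar> \<partial>lborel) \<le>
        (\<integral>\<^sup>+x. ennreal ((C * w x + \<bar>\<phi> (x - u)\<bar> + \<bar>\<phi> x\<bar>) * trunc_weight 1 u) \<partial>lborel)"
      by (intro nn_integral_mono ennreal_leI)
    also have "\<dots> = ennreal (\<integral>x. (C * w x + \<bar>\<phi> (x - u)\<bar> + \<bar>\<phi> x\<bar>) * trunc_weight 1 u \<partial>lborel)"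
      using C(1) w int int'[of u]
      by (intro nn_integral_eq_integral) (auto intro!: mult_nonneg_nonneg add_nonneg_nonneg trunc_weight_nonneg)
    also have "(\<integral>x. (C * w x + \<bar>\<phi> (x - u)\<bar> + \<bar>\<phi> x\<bar>) * trunc_weight 1 u \<partial>lborel) = A * trunc_weight 1 u"
    proof -
      have "(\<integral>x. \<bar>\<phi> (x - u)\<bar> \<partial>lborel) = (\<integral>x. \<bar>\<phi> x\<bar> \<partial>lborel)"
        using integral_lborel_translate[of "\<lambda>x. \<bar>\<phi> x\<bar>" "- u"] by simp
      then show ?thesis
        using w int int'[of u] unfolding A_def by simp
    qed
    finally show ?thesis using \<open>A \<ge> 0\<close> by (simp add: ennreal_mult')
  qed
  ultimately show ?thesis by blast
qed

lemma frac_grad_adj_integrable: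
  assumes "\<phi> \<in> schwartz"
  shows "integrable lborel (frac_grad_adj \<nu> k \<phi>)"
proof -
  have [measurable]: "\<phi> \<in> borel_measurable borel" using assms by (intro C_inf_borel schwartz_C_inf)
  obtain A where A: "A \<ge> 0" "\<And>u. (\<integral>\<^sup>+x. ennreal \<bar>(\<phi> (x - u) - \<phi> x) * u $ k\<bar> \<partial>lborel) \<le> ennreal A * ennreal (trunc_weight 1 u)"
    using nn_integral_schwartz_increment_le[OF assms, of k] by blast
  have "integrable (lborel \<Otimes>\<^sub>M \<nu>) (\<lambda>(x, u). (\<phi> (x - u) - \<phi> x) * u $ k)"
    by (rule integrable_pair[where R = 1 and A = "ennreal A"]) (use A in auto)
  from pair.integrable_fst'[OF this] show ?thesis
    by (simp add: frac_grad_adj_def[abs_def])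
qed

text \<open>The counterpart, uniform in \<open>x\<close>, of the preceding bound on the integral
  over \<open>x\<close>: it makes the integral over \<open>u\<close> absolutely convergent at every
  single \<open>x\<close>.\<close>

lemma schwartz_increment_bound:
  fixes \<phi> :: "real ^ 'n \<Rightarrow> real"
  assumes "\<phi> \<in> schwartz"
  obtains C where "C > 0" "\<And>x u (k :: 'n). \<bar>(\<phi> (x - u) - \<phi> x) * u $ k\<bar> \<le> C * trunc_weight 1 u"
proof -
  have \<phi>: "\<phi> \<in> C_inf_b" by (rule schwartz_C_inf_b[OF assms])
  obtain B where B: "B > 0" "\<And>x. \<bar>\<phi> x\<bar> \<le> B" "\<And>x i. \<bar>partial_deriv i \<phi> x\<bar> \<le> B"
    using C_inf_b_partial_deriv_bound[OF \<phi>] by blast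
  have 1: "\<bar>\<phi> (x - u) - \<phi> x\<bar> \<le> CARD('n) * B * norm u" for x u
    using abs_diff_le_partial_deriv[OF C_inf_differentiable[OF C_inf_b_C_inf[OF \<phi>]] convex_UNIV _ _ B(3), of "x - u" x] by simp
  have 2: "\<bar>\<phi> (x - u) - \<phi> x\<bar> \<le> 2 * B" for x u using B(2)[of x] B(2)[of "x - u"] by linarith
  define C where "C = real CARD('n) * B + 2 * B"
  have "C > 0" using B(1) by (simp add: C_def add_nonneg_pos)
  moreover have "\<bar>(\<phi> (x - u) - \<phi> x) * u $ k\<bar> \<le> C * trunc_weight 1 u" for x u k
  proof -
    have "\<bar>\<phi> (x - u) - \<phi> x\<bar> \<le> C * min 1 (norm u)"
    proof (cases "norm u \<le> 1")
      case True
      have "CARD('n) * B * norm u \<le> C * norm u" using B(1) by (intro mult_right_mono) (auto simp: C_def)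
      with 1[of x u] True show ?thesis by simp
    next
      case False
      have "2 * B \<le> C" using B(1) by (simp add: C_def)
      with 2[of x u] False show ?thesis by simp
    qed
    then have "\<bar>(\<phi> (x - u) - \<phi> x) * u $ k\<bar> \<le> (C * min 1 (norm u)) * norm u"
      unfolding abs_mult using \<open>C > 0\<close> by (intro mult_mono component_le_norm_cart) auto
    then show ?thesis by (simp add: trunc_weight_def mult_ac)
  qed
  ultimately show ?thesis using that by blast
qed

lemma frac_grad_adj_integrand_integrable:
  assumes "\<phi> \<in> schwartz"
  shows "integrable \<nu> (\<lambda>u. (\<phi> (x - u) - \<phi> x) * u $ k)"
proof -
  have [measurable]: "\<phi> \<in> borel_measurable borel" using assms by (intro C_inf_borel schwartz_C_inf)
  obtain C where C: "C > 0" "\<And>x u (k :: 'n). \<bar>(\<phi> (x - u) - \<phi> x) * u $ k\<bar> \<le> C * trunc_weight 1 u"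
    using schwartz_increment_bound[OF assms] by blast
  show ?thesis
  proof (rule Bochner_Integration.integrable_bound)
    show "integrable \<nu> (\<lambda>u. C * trunc_weight 1 u)" by (intro integrable_mult_right integrable_trunc_weight) simp
    show "AE u in \<nu>. norm ((\<phi> (x - u) - \<phi> x) * u $ k) \<le> norm (C * trunc_weight 1 u)"
      using C by (auto intro!: AE_I2 order_trans[OF _ abs_ge_self])
  qed (simp, measurable)
qed

text \<open>Together with \<open>frac_grad_adj_integrable\<close> this makes the adjoint of a
  Schwartz function both integrable and bounded, which is what
  \<open>integrable_Lp_mult_bounded\<close> and \<open>smear_duality\<close> demand of a partner of
  an L^r function. The adjoint itself need not be Schwartz.\<close>

lemma frac_grad_adj_bounded:
  assumes "\<phi> \<in> schwartz"
  obtains B where "\<And>x. \<bar>frac_grad_adj \<nu> k \<phi> x\<bar> \<le> B"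
proof -
  obtain C where C: "C > 0" "\<And>x u (k :: 'n). \<bar>(\<phi> (x - u) - \<phi> x) * u $ k\<bar> \<le> C * trunc_weight 1 u"
    using schwartz_increment_bound[OF assms] by blast
  have "\<bar>frac_grad_adj \<nu> k \<phi> x\<bar> \<le> C * (\<integral>u. trunc_weight 1 u \<partial>\<nu>)" for x
  proof -
    have "\<bar>frac_grad_adj \<nu> k \<phi> x\<bar> \<le> (\<integral>u. \<bar>(\<phi> (x - u) - \<phi> x) * u $ k\<bar> \<partial>\<nu>)"
      unfolding frac_grad_adj_def by (rule integral_abs_bound)
    also have "\<dots> \<le> (\<integral>u. C * trunc_weight 1 u \<partial>\<nu>)"
      using C(2) by (intro integral_mono integrable_abs frac_grad_adj_integrand_integrable assms
        integrable_mult_right integrable_trunc_weight) auto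
    finally show ?thesis by simp
  qed
  then show ?thesis using that by blast
qed

lemma frac_grad_adj_translate:
  "frac_grad_adj \<nu> k (\<lambda>x. \<phi> (x + z)) x = frac_grad_adj \<nu> k \<phi> (x + z)"
  by (simp add: frac_grad_adj_def algebra_simps)

section \<open>The cutoff identity and its remainder\<close>

definition commutator :: "(real ^ 'n \<Rightarrow> real) \<Rightarrow> (real ^ 'n \<Rightarrow> real) \<Rightarrow> 'n \<Rightarrow> real ^ 'n \<Rightarrow> real" where
  "commutator \<eta> f k y = (\<integral>u. f (y + u) * (\<eta> (y + u) - \<eta> y) * u $ k \<partial>\<nu>)"

lemma commutator_borel [measurable]:
  assumes [measurable]: "\<eta> \<in> borel_measurable borel" "f \<in> borel_measurable borel"
  shows "commutator \<eta> f k \<in> borel_measurable borel"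
  unfolding commutator_def[abs_def] by (rule \<nu>.borel_measurable_lebesgue_integral) measurable

text \<open>Pointwise, \<eta>(x) (\<phi>(x-u) - \<phi>(x)) is the increment of the product \<eta>
  \<phi> plus (\<eta>(x) - \<eta>(x-u)) \<phi>(x-u). Integrated against u_k, the first part is the
  adjoint of \<eta> \<phi>; the second, paired with \<open>f\<close> and shifted by x = y + u,
  becomes the commutator.\<close>

lemma frac_grad_cutoff:
  assumes \<eta>: "\<eta> \<in> C_inf_b" and L: "L \<ge> 0" and R: "R > 0"
    and lip: "\<And>x u. \<bar>\<eta> (x + u) - \<eta> x\<bar> \<le> L * min 1 (norm u / R)"
    and f: "f \<in> borel_measurable borel" "Lp_mass r f < \<infinity>" and r: "r \<ge> 1"
    and \<phi>: "\<phi> \<in> schwartz"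
  shows "frac_grad \<nu> (\<lambda>x. \<eta> x * f x) k \<phi> =
    frac_grad \<nu> f k (\<lambda>x. \<eta> x * \<phi> x) + (\<integral>y. commutator \<eta> f k y * \<phi> y \<partial>lborel)"
proof -
  have [measurable]: "\<phi> \<in> borel_measurable borel" "\<eta> \<in> borel_measurable borel" "f \<in> borel_measurable borel"
    using C_inf_borel[OF schwartz_C_inf[OF \<phi>]] C_inf_borel[OF C_inf_b_C_inf[OF \<eta>]] f by auto
  obtain B where B: "B > 0" "\<And>x. \<bar>\<phi> x\<bar> \<le> B" "\<And>x i. \<bar>partial_deriv i \<phi> x\<bar> \<le> B"
    using C_inf_b_partial_deriv_bound[OF schwartz_C_inf_b[OF \<phi>]] by blast
  have \<phi>int: "integrable lborel \<phi>" by (rule schwartz_integrable[OF \<phi>])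
  have \<eta>\<phi>: "(\<lambda>x. \<eta> x * \<phi> x) \<in> schwartz" by (rule schwartz_mult[OF \<eta> \<phi>])
  let ?D = "frac_grad_adj \<nu> k"
  let ?J = "\<lambda>x u. f x * ((\<eta> x - \<eta> (x - u)) * \<phi> (x - u) * u $ k)"
  let ?J' = "\<lambda>y u. f (y + u) * (\<eta> (y + u) - \<eta> y) * u $ k * \<phi> y"
  \<comment> \<open>The bracket bounds the integral of |f(y + u) \<phi>(y)| over \<open>y\<close>
    simultaneously for all \<open>u\<close>, which leaves exactly the weight in \<open>u\<close>
    that \<open>integrable_pair\<close> asks for.\<close>
  define A where "A = ennreal L * (ennreal (\<integral>x. \<bar>\<phi> x\<bar> \<partial>lborel) + ennreal B * Lp_mass r f)"
  have A: "A < \<infinity>" unfolding A_def using f(2) by (auto simp: ennreal_mult_less_top less_top[symmetric] ennreal_mult_eq_top_iff)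
  have trans: "(\<integral>\<^sup>+x. ennreal \<bar>?J x u\<bar> \<partial>lborel) = (\<integral>\<^sup>+y. ennreal \<bar>?J' y u\<bar> \<partial>lborel)" for u
    using nn_integral_lborel_translate[of "\<lambda>x. ennreal \<bar>?J x u\<bar>" u]
    by (simp add: mult_ac)
  have le': "(\<integral>\<^sup>+y. ennreal \<bar>?J' y u\<bar> \<partial>lborel) \<le> A * ennreal (trunc_weight R u)" for u
  proof -
    have "(\<integral>\<^sup>+y. ennreal \<bar>?J' y u\<bar> \<partial>lborel) \<le> (\<integral>\<^sup>+y. (ennreal L * ennreal (trunc_weight R u)) * ennreal \<bar>f (y + u) * \<phi> y\<bar> \<partial>lborel)"
    proof (rule nn_integral_mono)
      fix y
      have "\<bar>(\<eta> (y + u) - \<eta> y) * u $ k\<bar> \<le> (L * min 1 (norm u / R)) * norm u"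
        unfolding abs_mult using L R by (intro mult_mono lip component_le_norm_cart) auto
      then have "\<bar>(\<eta> (y + u) - \<eta> y) * u $ k\<bar> * \<bar>f (y + u) * \<phi> y\<bar> \<le> (L * trunc_weight R u) * \<bar>f (y + u) * \<phi> y\<bar>"
        by (intro mult_right_mono) (auto simp: trunc_weight_def mult_ac)
      then have "\<bar>?J' y u\<bar> \<le> (L * trunc_weight R u) * \<bar>f (y + u) * \<phi> y\<bar>"
        by (simp add: abs_mult mult_ac)
      then show "ennreal \<bar>?J' y u\<bar> \<le> (ennreal L * ennreal (trunc_weight R u)) * ennreal \<bar>f (y + u) * \<phi> y\<bar>"
        using L R by (simp add: ennreal_mult[symmetric] trunc_weight_nonneg ennreal_leI)
    qed
    also have "\<dots> = (ennreal L * ennreal (trunc_weight R u)) * (\<integral>\<^sup>+y. ennreal \<bar>f (y + u) * \<phi> y\<bar> \<partial>lborel)"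
      by (rule nn_integral_cmult) measurable
    also have "\<dots> \<le> (ennreal L * ennreal (trunc_weight R u)) * (ennreal (\<integral>x. \<bar>\<phi> x\<bar> \<partial>lborel) + ennreal B * Lp_mass r f)"
      using Lp_mass_mult_bounded[of "\<lambda>y. f (y + u)" \<phi> B r] \<phi>int B(2) r
      by (intro mult_left_mono) (auto simp: Lp_mass_translate)
    finally show ?thesis by (simp add: A_def mult_ac)
  qed
  have int: "integrable (lborel \<Otimes>\<^sub>M \<nu>) (case_prod ?J)"
    by (rule integrable_pair[OF _ R A]) (use trans le' in auto)
  have int': "integrable (lborel \<Otimes>\<^sub>M \<nu>) (case_prod ?J')"
    by (rule integrable_pair[OF _ R A]) (use le' in auto)
  obtain B1 where B1: "\<And>x. \<bar>?D (\<lambda>x. \<eta> x * \<phi> x) x\<bar> \<le> B1"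
    using frac_grad_adj_bounded[OF \<eta>\<phi>, of k] by blast
  have i1: "integrable lborel (\<lambda>x. f x * ?D (\<lambda>x. \<eta> x * \<phi> x) x)"
    by (rule integrable_Lp_mult_bounded[OF f frac_grad_adj_integrable[OF \<eta>\<phi>] B1 r])
  have i2: "integrable lborel (\<lambda>x. \<integral>u. ?J x u \<partial>\<nu>)"
    using pair.integrable_fst'[OF int] by simp
  have pw: "\<eta> x * f x * ?D \<phi> x = f x * ?D (\<lambda>x. \<eta> x * \<phi> x) x + (\<integral>u. ?J x u \<partial>\<nu>)" for x
  proof -
    note ia = frac_grad_adj_integrand_integrable[OF \<phi>, of x k] frac_grad_adj_integrand_integrable[OF \<eta>\<phi>, of x k]
    have "(\<integral>u. (\<eta> x - \<eta> (x - u)) * \<phi> (x - u) * u $ k \<partial>\<nu>) =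
      (\<integral>u. \<eta> x * ((\<phi> (x - u) - \<phi> x) * u $ k) - (\<eta> (x - u) * \<phi> (x - u) - \<eta> x * \<phi> x) * u $ k \<partial>\<nu>)"
      by (intro Bochner_Integration.integral_cong) (auto simp: algebra_simps)
    also have "\<dots> = \<eta> x * ?D \<phi> x - ?D (\<lambda>x. \<eta> x * \<phi> x) x"
      unfolding frac_grad_adj_def using ia by (subst Bochner_Integration.integral_diff) auto
    finally have "(\<integral>u. ?J x u \<partial>\<nu>) = f x * (\<eta> x * ?D \<phi> x - ?D (\<lambda>x. \<eta> x * \<phi> x) x)"
      by (simp only: integral_mult_right_zero)
    then show ?thesis by (simp only:) (simp add: algebra_simps)
  qed
  have "frac_grad \<nu> (\<lambda>x. \<eta> x * f x) k \<phi> = frac_grad \<nu> f k (\<lambda>x. \<eta> x * \<phi> x) + (\<integral>x. (\<integral>u. ?J x u \<partial>\<nu>) \<partial>lborel)"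
    unfolding frac_grad_def pw using i1 i2 by (rule Bochner_Integration.integral_add)
  \<comment> \<open>The substitution x = y + u is made with \<open>u\<close> fixed, so the order of
    integration is exchanged before it and exchanged back afterwards; both integrands have to be
    integrable on the product.\<close>
  also have "(\<integral>x. (\<integral>u. ?J x u \<partial>\<nu>) \<partial>lborel) = (\<integral>u. (\<integral>x. ?J x u \<partial>lborel) \<partial>\<nu>)"
    by (rule pair.Fubini_integral[OF int, symmetric])
  also have "\<dots> = (\<integral>u. (\<integral>y. ?J' y u \<partial>lborel) \<partial>\<nu>)"
  proof (rule Bochner_Integration.integral_cong[OF refl])
    fix u
    show "(\<integral>x. ?J x u \<partial>lborel) = (\<integral>y. ?J' y u \<partial>lborel)"
      using integral_lborel_translate[of "\<lambda>x. ?J x u" u] by (simp add: mult_ac)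
  qed
  also have "\<dots> = (\<integral>y. (\<integral>u. ?J' y u \<partial>\<nu>) \<partial>lborel)"
    by (rule pair.Fubini_integral[OF int'])
  also have "\<dots> = (\<integral>y. commutator \<eta> f k y * \<phi> y \<partial>lborel)"
    by (simp add: commutator_def)
  finally show ?thesis .
qed

text \<open>The increment of \<open>\<eta>\<close> can be nonzero although only \<open>y\<close>
  lies in the ball, while \<open>f\<close> is evaluated at \<open>y + u\<close>; hence the
  hypothesis on \<open>A\<close> ranges over all translates of \<open>f\<close>. At points where the
  integral defining the commutator diverges its value is 0 by convention, a case included in
  \<open>kernel_jensen\<close>.\<close>

lemma Lp_mass_commutator_le:
  assumes [measurable]: "\<eta> \<in> borel_measurable borel" "f \<in> borel_measurable borel"
    and L: "L > 0" and R: "R > 0"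
    and lip: "\<And>x u. \<bar>\<eta> (x + u) - \<eta> x\<bar> \<le> L * min 1 (norm u / R)"
    and supp: "\<And>x. norm x > R \<Longrightarrow> \<eta> x = 0" and p: "p \<ge> 1"
    and A: "\<And>u. (\<integral>\<^sup>+y. ennreal (\<bar>f (y + u)\<bar> powr p) * indicator (cball 0 R) y \<partial>lborel) \<le> A"
  shows "Lp_mass p (commutator \<eta> f k) \<le> ennreal ((L * moment * R powr (1 - \<alpha>)) powr p * 2 powr p * 2) * A"
proof -
  define K where "K = L * moment * R powr (1 - \<alpha>)"
  have K: "K > 0" using L moment_pos R by (simp add: K_def)
  let ?I = "indicator (cball 0 R) :: real ^ 'n \<Rightarrow> real"
  \<comment> \<open>One summand for each of the two points that may lie in the ball; if both do,
    \<open>f\<close> is counted twice, which is harmless in an upper bound. Splitting the p-th power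
    of this sum costs \<open>2 powr p\<close>, and its two integrals give the further factor
    2.\<close>
  define b where "b y u = \<bar>f (y + u)\<bar> * ?I y + \<bar>f (y + u)\<bar> * ?I (y + u)" for y u
  let ?\<kappa> = "\<lambda>u. L * trunc_weight R u"
  have [measurable]: "cball 0 R \<in> sets (borel :: (real ^ 'n) measure)" by simp
  have [measurable]: "(\<lambda>(y, u). b y u) \<in> borel_measurable (borel \<Otimes>\<^sub>M borel)"
    unfolding b_def by measurable
  have b: "b y u \<ge> 0" for y u by (simp add: b_def)
  have \<kappa>: "?\<kappa> u \<ge> 0" for u using L R by (simp add: trunc_weight_nonneg)
  have \<kappa>int: "integrable \<nu> ?\<kappa>" using R by (intro integrable_mult_right integrable_trunc_weight)
  have \<kappa>le: "(\<integral>u. ?\<kappa> u \<partial>\<nu>) \<le> K"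
    using mult_left_mono[OF integral_trunc_weight_le[OF R], of L] L by (simp add: K_def mult.assoc)
  have le: "\<bar>f (y + u) * (\<eta> (y + u) - \<eta> y) * u $ k\<bar> \<le> b y u * ?\<kappa> u" for y u
  proof (cases "norm y \<le> R \<or> norm (y + u) \<le> R")
    case True
    have "\<bar>(\<eta> (y + u) - \<eta> y) * u $ k\<bar> \<le> (L * min 1 (norm u / R)) * norm u"
      unfolding abs_mult using L R by (intro mult_mono lip component_le_norm_cart) auto
    then have "\<bar>f (y + u)\<bar> * \<bar>(\<eta> (y + u) - \<eta> y) * u $ k\<bar> \<le> \<bar>f (y + u)\<bar> * ?\<kappa> u"
      by (intro mult_left_mono) (auto simp: trunc_weight_def mult_ac)
    also have "\<dots> \<le> b y u * ?\<kappa> u"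
      using True by (intro mult_right_mono \<kappa>) (auto simp: b_def)
    finally show ?thesis by (simp add: abs_mult mult_ac)
  next
    case False
    then have "\<eta> (y + u) = 0" "\<eta> y = 0" by (auto intro!: supp)
    then show ?thesis using b[of y u] \<kappa>[of u] by simp
  qed
  have inner: "(\<integral>\<^sup>+y. ennreal (b y u powr p) \<partial>lborel) \<le> ennreal (2 powr p * 2) * A" for u
  proof -
    have "(\<integral>\<^sup>+y. ennreal (b y u powr p) \<partial>lborel) \<le> (\<integral>\<^sup>+y. ennreal (2 powr p) *
       (ennreal (\<bar>f (y + u)\<bar> powr p) * indicator (cball 0 R) y + ennreal (\<bar>f (y + u)\<bar> powr p) * indicator (cball 0 R) (y + u)) \<partial>lborel)"
    proof (rule nn_integral_mono)
      fix y
      have "b y u powr p \<le> 2 powr p * (\<bar>\<bar>f (y + u)\<bar> * ?I y\<bar> powr p + \<bar>\<bar>f (y + u)\<bar> * ?I (y + u)\<bar> powr p)"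
        using powr_add_le[of p "\<bar>f (y + u)\<bar> * ?I y" "\<bar>f (y + u)\<bar> * ?I (y + u)"] p b[of y u] by (simp add: b_def)
      also have "\<dots> = 2 powr p * (\<bar>f (y + u)\<bar> powr p * ?I y + \<bar>f (y + u)\<bar> powr p * ?I (y + u))"
        using p by (auto simp: indicator_def)
      finally have "ennreal (b y u powr p) \<le> ennreal (2 powr p * (\<bar>f (y + u)\<bar> powr p * ?I y + \<bar>f (y + u)\<bar> powr p * ?I (y + u)))"
        by (rule ennreal_leI)
      then show "ennreal (b y u powr p) \<le> ennreal (2 powr p) *
       (ennreal (\<bar>f (y + u)\<bar> powr p) * indicator (cball 0 R) y + ennreal (\<bar>f (y + u)\<bar> powr p) * indicator (cball 0 R) (y + u))"
        by (simp add: ennreal_mult' ennreal_indicator)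
    qed
    also have "\<dots> = ennreal (2 powr p) * ((\<integral>\<^sup>+y. ennreal (\<bar>f (y + u)\<bar> powr p) * indicator (cball 0 R) y \<partial>lborel) +
        (\<integral>\<^sup>+y. ennreal (\<bar>f (y + u)\<bar> powr p) * indicator (cball 0 R) (y + u) \<partial>lborel))"
      by (simp add: nn_integral_cmult nn_integral_add)
    \<comment> \<open>The summand \<open>y + 0\<close> is kept so that the hypothesis on translates
      applies with the zero shift.\<close>
    also have "(\<integral>\<^sup>+y. ennreal (\<bar>f (y + u)\<bar> powr p) * indicator (cball 0 R) (y + u) \<partial>lborel) =
        (\<integral>\<^sup>+y. ennreal (\<bar>f (y + 0)\<bar> powr p) * indicator (cball 0 R) y \<partial>lborel)"
      using nn_integral_lborel_translate[of "\<lambda>y. ennreal (\<bar>f y\<bar> powr p) * indicator (cball 0 R) y" u] by simp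
    also have "ennreal (2 powr p) * ((\<integral>\<^sup>+y. ennreal (\<bar>f (y + u)\<bar> powr p) * indicator (cball 0 R) y \<partial>lborel) +
        (\<integral>\<^sup>+y. ennreal (\<bar>f (y + 0)\<bar> powr p) * indicator (cball 0 R) y \<partial>lborel)) \<le> ennreal (2 powr p) * (A + A)"
      by (intro mult_left_mono add_mono A) auto
    also have "\<dots> = ennreal (2 powr p * 2) * A" by (simp add: ennreal_mult' mult_2[symmetric] mult.assoc)
    finally show ?thesis .
  qed
  have "(\<integral>\<^sup>+y. (\<integral>\<^sup>+u. ennreal (b y u powr p * ?\<kappa> u) \<partial>\<nu>) \<partial>lborel) = (\<integral>\<^sup>+u. (\<integral>\<^sup>+y. ennreal (b y u powr p * ?\<kappa> u) \<partial>lborel) \<partial>\<nu>)"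
    by (rule pair.Fubini'[symmetric]) measurable
  also have "\<dots> = (\<integral>\<^sup>+u. (\<integral>\<^sup>+y. ennreal (b y u powr p) \<partial>lborel) * ennreal (?\<kappa> u) \<partial>\<nu>)"
    by (simp only: ennreal_mult''[OF \<kappa>]) (simp add: nn_integral_multc)
  also have "\<dots> \<le> (\<integral>\<^sup>+u. (ennreal (2 powr p * 2) * A) * ennreal (?\<kappa> u) \<partial>\<nu>)"
    by (intro nn_integral_mono mult_right_mono inner) auto
  also have "\<dots> = (ennreal (2 powr p * 2) * A) * ennreal (\<integral>u. ?\<kappa> u \<partial>\<nu>)"
  proof (subst nn_integral_cmult)
    have "(\<integral>\<^sup>+u. ennreal (?\<kappa> u) \<partial>\<nu>) = ennreal (\<integral>u. ?\<kappa> u \<partial>\<nu>)"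
      by (rule nn_integral_eq_integral[OF \<kappa>int]) (simp add: \<kappa>)
    then show "ennreal (2 powr p * 2) * A * (\<integral>\<^sup>+u. ennreal (?\<kappa> u) \<partial>\<nu>) =
        ennreal (2 powr p * 2) * A * ennreal (\<integral>u. ?\<kappa> u \<partial>\<nu>)" by (simp only:)
  qed measurable
  also have "\<dots> \<le> (ennreal (2 powr p * 2) * A) * ennreal K"
    by (intro mult_left_mono ennreal_leI \<kappa>le) auto
  finally have iterated: "(\<integral>\<^sup>+y. (\<integral>\<^sup>+u. ennreal (b y u powr p * ?\<kappa> u) \<partial>\<nu>) \<partial>lborel) \<le> (ennreal (2 powr p * 2) * A) * ennreal K" .
  have "Lp_mass p (commutator \<eta> f k) \<le> (\<integral>\<^sup>+y. ennreal (K powr (p - 1)) * (\<integral>\<^sup>+u. ennreal (b y u powr p * ?\<kappa> u) \<partial>\<nu>) \<partial>lborel)"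
    unfolding Lp_mass_def commutator_def
  proof (rule nn_integral_mono)
    fix y
    show "ennreal (\<bar>\<integral>u. f (y + u) * (\<eta> (y + u) - \<eta> y) * u $ k \<partial>\<nu>\<bar> powr p) \<le>
      ennreal (K powr (p - 1)) * (\<integral>\<^sup>+u. ennreal (b y u powr p * ?\<kappa> u) \<partial>\<nu>)"
      by (rule kernel_jensen[OF _ \<kappa>int \<kappa> b le \<kappa>le K p]) simp
  qed
  also have "\<dots> = ennreal (K powr (p - 1)) * (\<integral>\<^sup>+y. (\<integral>\<^sup>+u. ennreal (b y u powr p * ?\<kappa> u) \<partial>\<nu>) \<partial>lborel)"
    by (rule nn_integral_cmult) measurable
  also have "\<dots> \<le> ennreal (K powr (p - 1)) * ((ennreal (2 powr p * 2) * A) * ennreal K)"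
    by (intro mult_left_mono iterated) auto
  also have "\<dots> = ennreal (K powr (p - 1) * K * 2 powr p * 2) * A"
    using K by (simp add: ennreal_mult' ennreal_mult mult_ac)
  also have "K powr (p - 1) * K = K powr p" using K by (simp add: powr_diff)
  finally show ?thesis by (simp add: K_def)
qed

end

section \<open>Cutoff and mollification\<close>

lemma bump_le: "bump x \<le> bump 0"
proof (cases "1 - x \<bullet> x > 0")
  case True
  then have "1 \<le> 1 / (1 - x \<bullet> x)" by (simp add: divide_simps)
  with True show ?thesis by (simp add: bump_def flat_def)
next
  case False
  then show ?thesis using bump_nonneg[of 0] by (simp add: bump_def flat_def)
qed

text \<open>A normalised bump, with no plateau around the origin: \<open>\<eta> 0 = 1\<close> and
  continuity already give \<eta>(x/n) \<longlonglongrightarrow> 1 at each \<open>x\<close>, which is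
  enough for dominated convergence.\<close>

lemma cutoff_function_exists:
  obtains \<eta> :: "real ^ 'n \<Rightarrow> real" and L where "L > 0" "\<eta> \<in> C_inf_c" "\<And>x. 0 \<le> \<eta> x" "\<And>x. \<eta> x \<le> 1"
    "\<eta> 0 = 1" "\<And>x. norm x \<ge> 1 \<Longrightarrow> \<eta> x = 0" "\<And>x y. \<bar>\<eta> x - \<eta> y\<bar> \<le> L * min 1 (norm (x - y))"
proof -
  \<comment> \<open>The trivial scaling and shift match the form of
    \<open>C_inf_affine\<close>.\<close>
  define \<eta> where "\<eta> x = inverse (bump (0 :: real ^ 'n)) * bump (1 *\<^sub>R x + 0)" for x :: "real ^ 'n"
  have smooth: "\<eta> \<in> C_inf" unfolding \<eta>_def[abs_def] by (rule C_inf_affine[OF bump_C_inf])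
  have cc: "\<eta> \<in> C_inf_c" by (rule C_inf_cI[OF smooth, of 1]) (simp add: \<eta>_def bump_eq_0)
  obtain B where B: "B > 0" "\<And>x. \<bar>\<eta> x\<bar> \<le> B" "\<And>x i. \<bar>partial_deriv i \<eta> x\<bar> \<le> B"
    using C_inf_b_partial_deriv_bound[OF C_inf_c_C_inf_b[OF cc]] by blast
  \<comment> \<open>The first summand is the Lipschitz constant, for points at distance at most 1.
    The summand 1 bounds the oscillation for points further apart.\<close>
  define L where "L = real CARD('n) * B + 1"
  have b0: "bump (0 :: real ^ 'n) > 0" by (rule bump_0)
  have 0: "0 \<le> \<eta> x" for x using bump_nonneg[of x] b0 by (simp add: \<eta>_def)
  have 1: "\<eta> x \<le> 1" for x using bump_le[of x] b0 by (simp add: \<eta>_def field_simps)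
  have "\<bar>\<eta> x - \<eta> y\<bar> \<le> L * min 1 (norm (x - y))" for x y
  proof (cases "norm (x - y) \<le> 1")
    case True
    have "\<bar>\<eta> x - \<eta> y\<bar> \<le> CARD('n) * B * norm (x - y)"
      by (rule abs_diff_le_partial_deriv[OF C_inf_differentiable[OF smooth] convex_UNIV _ _ B(3)]) auto
    also have "\<dots> \<le> L * norm (x - y)" by (intro mult_right_mono) (auto simp: L_def)
    finally show ?thesis using True by simp
  next
    case False
    have "\<bar>\<eta> x - \<eta> y\<bar> \<le> 1" using 0[of x] 0[of y] 1[of x] 1[of y] by linarith
    also have "1 \<le> L" using B(1) by (simp add: L_def)
    finally show ?thesis using False by simp
  qed
  moreover have "L > 0" using B(1) by (simp add: L_def add_nonneg_pos)
  moreover have "\<eta> 0 = 1" using b0 by (simp add: \<eta>_def)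
  moreover have "\<eta> x = 0" if "norm x \<ge> 1" for x using that by (simp add: \<eta>_def bump_eq_0)
  ultimately show ?thesis using that cc 0 1 by blast
qed

lemma C_inf_c_integrable:
  fixes f :: "real ^ 'n \<Rightarrow> real"
  assumes "f \<in> C_inf_c" shows "integrable lborel f"
proof -
  obtain R where R: "R > 0" "\<And>x. norm x > R \<Longrightarrow> f x = 0" using C_inf_c_vanishes[OF assms] by blast
  obtain B where B: "B > 0" "\<And>x. \<bar>f x\<bar> \<le> B" "\<And>x i. \<bar>partial_deriv i f x\<bar> \<le> B"
    using C_inf_b_partial_deriv_bound[OF C_inf_c_C_inf_b[OF assms]] by blast
  show ?thesis
  proof (rule Bochner_Integration.integrable_bound)
    show "integrable lborel (\<lambda>x :: real ^ 'n. B * indicator (cball 0 R) x)"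
      using emeasure_lborel_cball_finite[of "0 :: real ^ 'n" R]
      by (intro integrable_mult_right integrable_real_indicator) auto
    show "f \<in> borel_measurable lborel"
      using C_inf_borel[of f] assms by (simp add: C_inf_c_def)
    show "AE x in lborel. norm (f x) \<le> norm (B * indicator (cball 0 R) x)"
      using B R by (intro AE_I2) (auto simp: indicator_def abs_of_pos)
  qed
qed

lemma mollifier_exists:
  fixes \<delta> :: real
  assumes "\<delta> > 0"
  obtains \<rho> :: "real ^ 'n \<Rightarrow> real" where "\<rho> \<in> C_inf_c" "\<And>x. \<rho> x \<ge> 0" "(\<integral>x. \<rho> x \<partial>lborel) = 1"
    "\<And>x. norm x \<ge> \<delta> \<Longrightarrow> \<rho> x = 0"
proof -
  define b where "b a x = a * bump ((1 / \<delta>) *\<^sub>R x + 0)" for a and x :: "real ^ 'n"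
  have vanish: "b a x = 0" if "norm x \<ge> \<delta>" for a x
    using that assms by (simp add: b_def bump_eq_0)
  have cc: "b a \<in> C_inf_c" for a
  proof (rule C_inf_cI)
    show "b a \<in> C_inf" unfolding b_def[abs_def] by (rule C_inf_affine[OF bump_C_inf])
    show "b a x = 0" if "norm x > \<delta>" for x using that by (intro vanish) simp
  qed
  \<comment> \<open>For \<open>norm x \<le> \<delta> / 2\<close> the argument of \<open>flat\<close>
    is at least 3/4, so the bump is at least exp(-4/3) there. This makes its integral positive, so
    that it can be normalised.\<close>
  define c where "c = exp (- (4 / 3 :: real))"
  have lower: "c \<le> b 1 x" if x: "norm x \<le> \<delta> / 2" for x
  proof -
    have "norm ((1 / \<delta>) *\<^sub>R x) \<le> 1 / 2" using x assms by (simp add: field_simps)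
    then have "norm ((1 / \<delta>) *\<^sub>R x) ^ 2 \<le> (1 / 2) ^ 2" by (intro power_mono) auto
    then have *: "1 - ((1 / \<delta>) *\<^sub>R x) \<bullet> ((1 / \<delta>) *\<^sub>R x) \<ge> 3 / 4"
      unfolding dot_square_norm by (simp add: power2_eq_square)
    define t where "t = 1 - ((1 / \<delta>) *\<^sub>R x) \<bullet> ((1 / \<delta>) *\<^sub>R x)"
    have "1 / t \<le> 4 / 3" using * unfolding t_def[symmetric] by (simp add: divide_simps)
    then show ?thesis
      using * unfolding b_def c_def bump_def add_0_right t_def[symmetric] flat_def by simp
  qed
  have int: "integrable lborel (b a)" for a by (rule C_inf_c_integrable[OF cc])
  have "0 < c * measure lborel (cball 0 (\<delta> / 2) :: (real ^ 'n) set)"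
    using content_cball_pos[of "\<delta> / 2" "0 :: real ^ 'n"] assms by (simp add: c_def)
  also have "\<dots> = (\<integral>x. c * indicator (cball 0 (\<delta> / 2) :: (real ^ 'n) set) x \<partial>lborel)"
    by simp
  also have "\<dots> \<le> (\<integral>x. b 1 x \<partial>lborel)"
  proof (rule integral_mono)
    show "integrable lborel (\<lambda>x :: real ^ 'n. c * indicator (cball 0 (\<delta> / 2)) x)"
      using emeasure_lborel_cball_finite[of "0 :: real ^ 'n" "\<delta> / 2"]
      by (intro integrable_mult_right integrable_real_indicator) auto
    show "c * indicator (cball 0 (\<delta> / 2)) x \<le> b 1 x" for x
      using lower[of x] bump_nonneg by (auto simp: indicator_def b_def)
  qed (rule int)
  finally have I: "0 < (\<integral>x. b 1 x \<partial>lborel)" (is "0 < ?I") .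
  show ?thesis
  proof (rule that)
    show "b (inverse ?I) \<in> C_inf_c" by (rule cc)
    show "b (inverse ?I) x \<ge> 0" for x using I bump_nonneg by (auto simp: b_def intro!: mult_nonneg_nonneg)
    show "(\<integral>x. b (inverse ?I) x \<partial>lborel) = 1"
      using I by (simp add: b_def)
    show "b (inverse ?I) x = 0" if "norm x \<ge> \<delta>" for x by (rule vanish[OF that])
  qed
qed

lemma smear_C_inf_c:
  fixes h \<rho> :: "real ^ 'n \<Rightarrow> real"
  assumes \<rho>: "\<rho> \<in> C_inf_c" and h: "integrable lborel h" "\<And>x. norm x > R \<Longrightarrow> h x = 0"
  shows "smear \<rho> h \<in> C_inf_c"
proof -
  obtain R' where R': "R' > 0" "\<And>x. norm x > R' \<Longrightarrow> \<rho> x = 0" using C_inf_c_vanishes[OF \<rho>] by blast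
  \<comment> \<open>The reflection of \<open>\<rho>\<close>, which turns \<open>smear\<close> into
    an ordinary convolution.\<close>
  define \<rho>' where "\<rho>' x = 1 * \<rho> ((- 1) *\<^sub>R x + 0)" for x
  have "\<rho>' \<in> C_inf" unfolding \<rho>'_def[abs_def] using \<rho> by (intro C_inf_affine) (simp add: C_inf_c_def)
  then have "\<rho>' \<in> C_inf_c" by (rule C_inf_cI[of _ R']) (simp add: \<rho>'_def R')
  then have \<rho>': "\<rho>' \<in> C_inf_b" by (rule C_inf_c_C_inf_b)
  have [measurable]: "\<rho> \<in> borel_measurable borel" "h \<in> borel_measurable borel"
    using \<rho> h(1) by (auto simp: C_inf_c_def intro!: C_inf_borel)
  have "smear \<rho> h x = (\<integral>y. h y * \<rho>' (x - y) \<partial>lborel)" for x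
    using integral_lborel_translate[of "\<lambda>y. h y * \<rho>' (x - y)" x]
    by (simp add: smear_def \<rho>'_def add.commute mult.commute)
  then have "smear \<rho> h = (\<lambda>x. \<integral>y. h y * \<rho>' (x - y) \<partial>lborel)" by auto
  then have "smear \<rho> h \<in> C_inf" using convolution_C_inf[OF h(1) \<rho>'] by simp
  then show ?thesis
  proof (rule C_inf_cI)
    fix x :: "real ^ 'n" assume x: "norm x > R + R'"
    have "\<rho> z * h (x + z) = 0" for z
    proof (cases "norm z > R'")
      case False
      then have "norm (x + z) > R" using x norm_triangle_ineq4[of "x + z" z] by simp
      then show ?thesis by (simp add: h(2))
    qed (simp add: R')
    then show "smear \<rho> h x = 0" by (simp only: smear_def Bochner_Integration.integral_zero)
  qed
qed

lemma Lp_mass_finite_of_diff: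
  assumes [measurable]: "f \<in> borel_measurable borel" "h \<in> borel_measurable borel"
    and "Lp_mass r f < \<infinity>" "Lp_mass r (\<lambda>x. h x - f x) < \<infinity>" "r \<ge> 0"
  shows "Lp_mass r h < \<infinity>"
proof -
  have "Lp_mass r h \<le> ennreal (2 powr r) * (Lp_mass r (\<lambda>x. h x - f x) + Lp_mass r f)"
    using Lp_mass_add[of "\<lambda>x. h x - f x" f r] assms by simp
  also have "\<dots> < \<infinity>" using assms by (auto simp: ennreal_mult_less_top)
  finally show ?thesis .
qed

text \<open>Dominated convergence with \<open>f\<close> itself as majorant. For \<open>n = 0\<close>
  the division by zero makes the cutoff constantly \<open>\<eta> 0\<close>, so the majorant is valid
  for every index.\<close>

lemma Lp_mass_cutoff_tendsto_0:
  fixes f \<eta> :: "real ^ 'n \<Rightarrow> real"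
  assumes \<eta>: "continuous_on UNIV \<eta>" "\<eta> 0 = 1" "\<And>x. 0 \<le> \<eta> x" "\<And>x. \<eta> x \<le> 1"
    and f [measurable]: "f \<in> borel_measurable borel" "Lp_mass r f < \<infinity>" and r: "r > 0"
  shows "(\<lambda>n. Lp_mass r (\<lambda>x. \<eta> ((1 / real n) *\<^sub>R x) * f x - f x)) \<longlonglongrightarrow> 0"
proof (rule Lp_mass_dominated[OF f(1) _ f(2) r])
  have [measurable]: "\<eta> \<in> borel_measurable borel" by (rule borel_measurable_continuous_onI[OF \<eta>(1)])
  show "(\<lambda>x. \<eta> ((1 / real n) *\<^sub>R x) * f x - f x) \<in> borel_measurable borel" for n by measurable
  show "\<bar>\<eta> ((1 / real n) *\<^sub>R x) * f x - f x\<bar> \<le> \<bar>f x\<bar>" for n x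
  proof -
    have "\<bar>\<eta> ((1 / real n) *\<^sub>R x) - 1\<bar> * \<bar>f x\<bar> \<le> 1 * \<bar>f x\<bar>"
      using \<eta>(3,4)[of "(1 / real n) *\<^sub>R x"] by (intro mult_right_mono) auto
    then show ?thesis by (simp add: abs_mult[symmetric] left_diff_distrib)
  qed
  show "(\<lambda>n. \<eta> ((1 / real n) *\<^sub>R x) * f x - f x) \<longlonglongrightarrow> 0" for x
  proof -
    have "(\<lambda>n. (1 / real n) *\<^sub>R x) \<longlonglongrightarrow> 0 *\<^sub>R x"
      by (intro tendsto_scaleR tendsto_const lim_1_over_n)
    then have "(\<lambda>n. \<eta> ((1 / real n) *\<^sub>R x)) \<longlonglongrightarrow> \<eta> 0"
      using continuous_on_tendsto_compose[OF \<eta>(1)] by auto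
    then have "(\<lambda>n. \<eta> ((1 / real n) *\<^sub>R x) * f x - f x) \<longlonglongrightarrow> \<eta> 0 * f x - f x"
      by (intro tendsto_intros)
    then show ?thesis by (simp add: \<eta>(2))
  qed
qed

text \<open>The exponent enters the estimates only through this ratio: Hoelder on a ball of radius R
  contributes the volume to the power 1 - p/q, hence R^(p(\<alpha> - 1)).\<close>

lemma sobolev_exponent:
  fixes \<alpha> p d :: real
  assumes "1 < \<alpha>" "1 \<le> p" "p < d / (\<alpha> - 1)"
  shows "p / sobolev_exponent d \<alpha> p = 1 - p * (\<alpha> - 1) / d" and "p \<le> sobolev_exponent d \<alpha> p"
proof -
  have pa: "p * (\<alpha> - 1) > 0" using assms by simp
  have den: "d - p * (\<alpha> - 1) > 0" using assms by (simp add: pos_less_divide_eq)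
  with pa have d: "d > 0" by linarith
  show eq: "p / sobolev_exponent d \<alpha> p = 1 - p * (\<alpha> - 1) / d"
    using assms den d by (simp add: sobolev_exponent_def field_simps)
  have "sobolev_exponent d \<alpha> p > 0" using assms den d by (simp add: sobolev_exponent_def)
  moreover have "p / sobolev_exponent d \<alpha> p \<le> 1" unfolding eq using pa d by simp
  ultimately show "p \<le> sobolev_exponent d \<alpha> p" by (simp add: divide_le_eq)
qed

context stable_levy
begin

text \<open>Both pairings are rewritten by \<open>smear_duality\<close> as averages over
  \<open>z\<close>. For each fixed \<open>z\<close> the representation of the gradient of
  \<open>f\<close> is then tested against the translate of \<open>\<phi>\<close> by
  \<open>- z\<close>.\<close>

lemma frac_grad_smear:
  fixes f g \<rho> :: "real ^ 'n \<Rightarrow> real"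
  assumes f: "f \<in> borel_measurable borel" "Lp_mass q f < \<infinity>" "q \<ge> 1"
    and g: "g \<in> borel_measurable borel" "Lp_mass p g < \<infinity>" "p \<ge> 1"
    and rep: "\<And>\<phi>. \<phi> \<in> schwartz \<Longrightarrow> frac_grad \<nu> f k \<phi> = (\<integral>x. g x * \<phi> x \<partial>lborel)"
    and \<rho>: "integrable lborel \<rho>" and \<phi>: "\<phi> \<in> schwartz"
  shows "frac_grad \<nu> (smear \<rho> f) k \<phi> = (\<integral>x. smear \<rho> g x * \<phi> x \<partial>lborel)"
proof -
  obtain B where B: "\<And>x. \<bar>frac_grad_adj \<nu> k \<phi> x\<bar> \<le> B"
    using frac_grad_adj_bounded[OF \<phi>, of k] by blast
  obtain C where C: "C > 0" "\<And>x. \<bar>\<phi> x\<bar> \<le> C" "\<And>x i. \<bar>partial_deriv i \<phi> x\<bar> \<le> C"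
    using C_inf_b_partial_deriv_bound[OF schwartz_C_inf_b[OF \<phi>]] by blast
  have "frac_grad \<nu> (smear \<rho> f) k \<phi> = (\<integral>z. \<rho> z * (\<integral>y. f y * frac_grad_adj \<nu> k \<phi> (y - z) \<partial>lborel) \<partial>lborel)"
    unfolding frac_grad_def by (rule smear_duality[OF f(1,2) frac_grad_adj_integrable[OF \<phi>] B f(3) \<rho>])
  also have "\<dots> = (\<integral>z. \<rho> z * (\<integral>y. g y * \<phi> (y - z) \<partial>lborel) \<partial>lborel)"
  proof (rule Bochner_Integration.integral_cong[OF refl])
    fix z
    show "\<rho> z * (\<integral>y. f y * frac_grad_adj \<nu> k \<phi> (y - z) \<partial>lborel) = \<rho> z * (\<integral>y. g y * \<phi> (y - z) \<partial>lborel)"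
      using rep[OF schwartz_translate[OF \<phi>, of "- z"]]
      by (simp add: frac_grad_def frac_grad_adj_translate[of k \<phi> "- z", simplified])
  qed
  also have "\<dots> = (\<integral>x. smear \<rho> g x * \<phi> x \<partial>lborel)"
    by (rule smear_duality[OF g(1,2) schwartz_integrable[OF \<phi>] C(2) g(3) \<rho>, symmetric])
  finally show ?thesis .
qed

text \<open>The part of \<open>f\<close> in a large fixed ball has finite p-mass \<open>n1\<close>
  and contributes a multiple of n^(-p(\<alpha> - 1)), which decays. The rest has tiny q-mass and
  contributes at most \<open>\<delta> / 2\<close> for every \<open>n > 0\<close>, by exact
  cancellation of the powers of n.\<close>

lemma Lp_mass_commutator_tendsto_0:
  fixes f \<eta> :: "real ^ 'n \<Rightarrow> real"
  assumes [measurable]: "\<eta> \<in> borel_measurable borel" "f \<in> borel_measurable borel"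
    and L: "L > 0" and lip: "\<And>x y. \<bar>\<eta> x - \<eta> y\<bar> \<le> L * min 1 (norm (x - y))"
    and supp: "\<And>x. norm x \<ge> 1 \<Longrightarrow> \<eta> x = 0"
    and p: "1 \<le> p" "p < CARD('n) / (\<alpha> - 1)" and q: "q = sobolev_exponent CARD('n) \<alpha> p"
    and f: "Lp_mass q f < \<infinity>" and \<delta>: "\<delta> > (0 :: real)"
  shows "\<forall>\<^sub>F n in sequentially. Lp_mass p (commutator (\<lambda>x. \<eta> ((1 / real n) *\<^sub>R x)) f k) \<le> ennreal \<delta>"
proof -
  let ?d = "real CARD('n)"
  have d: "?d > 0" by simp
  have pa: "p * (\<alpha> - 1) > 0" using p \<alpha> by simp
  note exponent = sobolev_exponent[OF \<alpha>(1) p, folded q]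
  have q0: "q > 0" and pleq: "p \<le> q" using exponent p by auto
  \<comment> \<open>The left side is the power of the radius coming from the ball volume in
    Hoelder's inequality, the right side the one gained from the p-th power of the weight's
    mass.\<close>
  have scale: "?d * (1 - p / q) = p * (\<alpha> - 1)" unfolding exponent(1) using d by simp
  have pqpos: "p / q > 0" using p q0 by simp
  define c0 where "c0 = unit_ball_vol ?d"
  have c0: "c0 > 0" by (simp add: c0_def)
  define C where "C = (L * moment) powr p * 2 powr p * 2"
  have C: "C > 0" using L moment_pos by (simp add: C_def)
  define C' where "C' = C * c0 powr (1 - p / q)"
  have C': "C' > 0" using C c0 by (simp add: C'_def)
  \<comment> \<open>Solves \<open>C' * Q powr (p / q) = \<delta> / 2\<close>, where
    \<open>C'\<close> collects every constant that multiplies the tail.\<close>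
  define Q where "Q = (\<delta> / (2 * C')) powr (q / p)"
  have Q: "Q > 0" using \<delta> C' by (simp add: Q_def)
  have Qp: "C' * Q powr (p / q) = \<delta> / 2"
    using \<delta> C' p q0 by (simp add: Q_def powr_powr)
  have "(\<lambda>m. Lp_mass q (\<lambda>x. f x * indicator (- cball 0 (real m)) x)) \<longlonglongrightarrow> 0"
  proof (rule Lp_mass_dominated[OF _ _ f q0])
    show "(\<lambda>x. f x * indicator (- cball 0 (real m)) x) \<in> borel_measurable borel" for m
      by (intro borel_measurable_times borel_measurable_indicator) auto
    fix x :: "real ^ 'n"
    have "\<forall>\<^sub>F m in sequentially. f x * indicator (- cball 0 (real m)) x = 0"
      using eventually_ge_at_top[of "nat \<lceil>norm x\<rceil>"]
      by eventually_elim (auto simp: indicator_def nat_le_iff ceiling_le_iff)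
    then show "(\<lambda>m. f x * indicator (- cball 0 (real m)) x) \<longlonglongrightarrow> 0" by (rule tendsto_eventually)
  qed (auto simp: indicator_def)
  from eventually_happens'[OF sequentially_bot tendsto_0_ennrealD[OF this Q]]
  obtain m where m: "Lp_mass q (\<lambda>x. f x * indicator (- cball 0 (real m)) x) \<le> ennreal Q" by blast
  define f1 where "f1 x = f x * indicator (cball 0 (real m)) x" for x
  define f2 where "f2 x = f x * indicator (- cball 0 (real m)) x" for x
  have [measurable]: "f1 \<in> borel_measurable borel" "f2 \<in> borel_measurable borel"
    unfolding f1_def[abs_def] f2_def[abs_def]
    by (auto intro!: borel_measurable_times borel_measurable_indicator)
  have ball [measurable]: "cball 0 R \<in> sets (borel :: (real ^ 'n) measure)" for R by simp
  have vol: "emeasure lborel (cball (0 :: real ^ 'n) R) < \<infinity>"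
      "measure lborel (cball (0 :: real ^ 'n) R) \<le> c0 * R powr ?d" if "R > 0" for R
    using that emeasure_cball[of R "0 :: real ^ 'n"]
    by (auto simp: measure_def c0_def powr_realpow enn2real_ennreal)
  have "\<exists>n1\<ge>0. Lp_mass p f1 \<le> ennreal n1"
  proof -
    have fin: "Lp_mass q f = ennreal (enn2real (Lp_mass q f))" using f by simp
    have "Lp_mass p f1 = (\<integral>\<^sup>+x. ennreal (\<bar>f x\<bar> powr p) * indicator (cball 0 (real m)) x \<partial>lborel)"
      unfolding Lp_mass_def f1_def using p by (intro nn_integral_cong) (auto simp: indicator_def)
    \<comment> \<open>The radius is enlarged by 1 because \<open>m\<close> may be 0, while the
      volume bound requires a positive radius.\<close>
    also have "\<dots> \<le> (\<integral>\<^sup>+x. ennreal (\<bar>f x\<bar> powr p) * indicator (cball 0 (real m + 1)) x \<partial>lborel)"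
      by (intro nn_integral_mono) (auto simp: indicator_def)
    also have "\<dots> \<le> ennreal ((c0 * (real m + 1) powr ?d) powr (1 - p / q) * enn2real (Lp_mass q f) powr (p / q))"
      by (rule Lp_mass_local_le) (use vol[of "real m + 1"] c0 fin p pleq in auto)
    finally show ?thesis by (intro exI[of _ "(c0 * (real m + 1) powr ?d) powr (1 - p / q) * enn2real (Lp_mass q f) powr (p / q)"]) simp
  qed
  then obtain n1 where n1: "n1 \<ge> 0" "Lp_mass p f1 \<le> ennreal n1" by blast
  have bound: "Lp_mass p (commutator (\<lambda>x. \<eta> ((1 / real n) *\<^sub>R x)) f k) \<le>
      ennreal (C * n1 * real n powr - (p * (\<alpha> - 1)) + \<delta> / 2)" if n: "n > 0" for n
  proof -
    let ?R = "real n"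
    have R: "?R > 0" using n by simp
    define A where "A = n1 + (c0 * ?R powr ?d) powr (1 - p / q) * Q powr (p / q)"
    have A0: "A \<ge> 0" using n1 by (simp add: A_def)
    have "Lp_mass p (commutator (\<lambda>x. \<eta> ((1 / ?R) *\<^sub>R x)) f k) \<le>
        ennreal ((L * moment * ?R powr (1 - \<alpha>)) powr p * 2 powr p * 2) * ennreal A"
    proof (rule Lp_mass_commutator_le[OF _ _ L R _ _ p(1)])
      show "\<bar>\<eta> ((1 / ?R) *\<^sub>R (x + u)) - \<eta> ((1 / ?R) *\<^sub>R x)\<bar> \<le> L * min 1 (norm u / ?R)" for x u
        using lip[of "(1 / ?R) *\<^sub>R (x + u)" "(1 / ?R) *\<^sub>R x"] by (simp add: scaleR_right_diff_distrib[symmetric])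
      show "\<eta> ((1 / ?R) *\<^sub>R x) = 0" if "norm x > ?R" for x
        using that R by (intro supp) simp
      fix u
      \<comment> \<open>At each point one of \<open>f1\<close> and \<open>f2\<close> vanishes, so
        the p-th powers split without a constant. For \<open>f1\<close> the restriction to the ball
        is dropped, so its mass does not depend on \<open>n\<close> or \<open>u\<close>; for
        \<open>f2\<close> it is kept and Hoelder is used.\<close>
      have "(\<integral>\<^sup>+y. ennreal (\<bar>f (y + u)\<bar> powr p) * indicator (cball 0 ?R) y \<partial>lborel) \<le>
        (\<integral>\<^sup>+y. ennreal (\<bar>f1 (y + u)\<bar> powr p) + ennreal (\<bar>f2 (y + u)\<bar> powr p) * indicator (cball 0 ?R) y \<partial>lborel)"
        using p by (intro nn_integral_mono) (auto simp: f1_def f2_def indicator_def)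
      also have "\<dots> = Lp_mass p (\<lambda>y. f1 (y + u)) + (\<integral>\<^sup>+y. ennreal (\<bar>f2 (y + u)\<bar> powr p) * indicator (cball 0 ?R) y \<partial>lborel)"
        unfolding Lp_mass_def by (rule nn_integral_add) measurable
      also have "\<dots> \<le> ennreal n1 + ennreal ((c0 * ?R powr ?d) powr (1 - p / q) * Q powr (p / q))"
      proof (rule add_mono)
        show "Lp_mass p (\<lambda>y. f1 (y + u)) \<le> ennreal n1" using n1 by (simp add: Lp_mass_translate)
        show "(\<integral>\<^sup>+y. ennreal (\<bar>f2 (y + u)\<bar> powr p) * indicator (cball 0 ?R) y \<partial>lborel) \<le>
          ennreal ((c0 * ?R powr ?d) powr (1 - p / q) * Q powr (p / q))"
        proof (rule Lp_mass_local_le[where f = "\<lambda>y. f2 (y + u)"])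
          show "Lp_mass q (\<lambda>y. f2 (y + u)) \<le> ennreal Q"
            using m by (subst Lp_mass_translate) (simp_all add: f2_def[abs_def, symmetric])
        qed (use vol[OF R] c0 R Q p pleq in auto)
      qed
      also have "\<dots> = ennreal A" using n1 by (simp add: A_def)
      finally show "(\<integral>\<^sup>+y. ennreal (\<bar>f (y + u)\<bar> powr p) * indicator (cball 0 ?R) y \<partial>lborel) \<le> ennreal A" .
    qed measurable
    also have "\<dots> = ennreal ((L * moment * ?R powr (1 - \<alpha>)) powr p * 2 powr p * 2 * A)"
      using A0 by (simp add: ennreal_mult'')
    also have "(L * moment * ?R powr (1 - \<alpha>)) powr p * 2 powr p * 2 * A = C * n1 * ?R powr - (p * (\<alpha> - 1)) + \<delta> / 2"
    proof -
      have 1: "(L * moment * ?R powr (1 - \<alpha>)) powr p * 2 powr p * 2 = C * ?R powr - (p * (\<alpha> - 1))"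
        using L moment_pos R by (simp add: C_def powr_mult powr_powr algebra_simps)
      have 2: "(c0 * ?R powr ?d) powr (1 - p / q) = c0 powr (1 - p / q) * ?R powr (p * (\<alpha> - 1))"
        using c0 R by (simp add: powr_mult powr_powr scale)
      have 3: "?R powr - (p * (\<alpha> - 1)) * ?R powr (p * (\<alpha> - 1)) = 1"
        using R by (simp add: powr_add[symmetric])
      have "C * ?R powr - (p * (\<alpha> - 1)) * A = C * n1 * ?R powr - (p * (\<alpha> - 1)) +
          (?R powr - (p * (\<alpha> - 1)) * ?R powr (p * (\<alpha> - 1))) * (C' * Q powr (p / q))"
        unfolding A_def 2 C'_def by (simp add: distrib_left mult_ac)
      then show ?thesis unfolding 1 3 Qp by simp
    qed
    finally show ?thesis .
  qed
  have "(\<lambda>n. C * n1 * real n powr - (p * (\<alpha> - 1))) \<longlonglongrightarrow> C * n1 * 0"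
    using pa by (intro tendsto_intros tendsto_neg_powr filterlim_real_sequentially) auto
  then have "\<forall>\<^sub>F n in sequentially. C * n1 * real n powr - (p * (\<alpha> - 1)) < \<delta> / 2"
    using \<delta> by (intro order_tendstoD(2)) auto
  with eventually_gt_at_top[of 0] show ?thesis
  proof eventually_elim
    case (elim n)
    show ?case
      using elim by (intro order_trans[OF bound ennreal_leI]) auto
  qed
qed

text \<open>The cut-off function \<open>h\<close> has bounded support, which smearing preserves. Its
  gradient \<open>v\<close> need not have bounded support, since the operator is nonlocal, but only
  its \<open>L\<^sup>p\<close> class matters.\<close>

lemma smooth_approximation:
  fixes f :: "real ^ 'n \<Rightarrow> real" and g :: "'n \<Rightarrow> real ^ 'n \<Rightarrow> real"
  assumes p: "1 \<le> p" "p < CARD('n) / (\<alpha> - 1)" and q: "q = sobolev_exponent CARD('n) \<alpha> p"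
    and f [measurable]: "f \<in> borel_measurable borel" and ff: "Lp_mass q f < \<infinity>"
    and g [measurable]: "\<And>k. g k \<in> borel_measurable borel" and gf: "\<And>k. Lp_mass p (g k) < \<infinity>"
    and rep: "\<And>k \<phi>. \<phi> \<in> schwartz \<Longrightarrow> frac_grad \<nu> f k \<phi> = (\<integral>x. g k x * \<phi> x \<partial>lborel)"
    and \<delta>: "\<delta> > (0 :: real)"
  shows "\<exists>F G. F \<in> C_inf_c \<and> Lp_mass q (\<lambda>x. F x - f x) \<le> ennreal \<delta> \<and>
    (\<forall>k. G k \<in> borel_measurable borel \<and> Lp_mass p (\<lambda>x. G k x - g k x) \<le> ennreal \<delta> \<and>
      (\<forall>\<phi>\<in>schwartz. frac_grad \<nu> F k \<phi> = (\<integral>x. G k x * \<phi> x \<partial>lborel)))"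
proof -
  have pq: "p \<le> q" using sobolev_exponent(2)[OF \<alpha>(1) p] by (simp add: q)
  then have q1: "q \<ge> 1" using p by simp
  \<comment> \<open>The first summand is the cost of passing from \<open>f\<close> to
    \<open>h\<close> to the mollified function. In the second, the inner \<open>2 powr p * 2\<close>
    pays for the cutoff of \<open>g\<close> and the commutator, the 1 for the mollification. Their
    sum lets a single \<open>e\<close> serve both estimates.\<close>
  define D where "D = 2 powr q * 2 + 2 powr p * (1 + 2 powr p * 2)"
  have D: "D > 0" by (simp add: D_def add_pos_pos)
  define e where "e = \<delta> / D"
  have e: "e > 0" using \<delta> D by (simp add: e_def)
  have eD: "e * D = \<delta>" using D by (simp add: e_def)
  obtain \<eta> :: "real ^ 'n \<Rightarrow> real" and L where L: "L > 0" and \<eta>: "\<eta> \<in> C_inf_c" "\<And>x. 0 \<le> \<eta> x" "\<And>x. \<eta> x \<le> 1"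
    "\<eta> 0 = 1" "\<And>x. norm x \<ge> 1 \<Longrightarrow> \<eta> x = 0" "\<And>x y. \<bar>\<eta> x - \<eta> y\<bar> \<le> L * min 1 (norm (x - y))"
    by (rule cutoff_function_exists) (rule that)
  have \<eta>C: "\<eta> \<in> C_inf" using \<eta>(1) by (simp add: C_inf_c_def)
  have [measurable]: "\<eta> \<in> borel_measurable borel" by (rule C_inf_borel[OF \<eta>C])
  note tendsto = Lp_mass_cutoff_tendsto_0[OF C_inf_continuous[OF \<eta>C] \<eta>(4,2,3)]
  have "\<forall>\<^sub>F n in sequentially. n > 0 \<and> Lp_mass q (\<lambda>x. \<eta> ((1 / real n) *\<^sub>R x) * f x - f x) \<le> ennreal e \<and>
    (\<forall>k. Lp_mass p (\<lambda>x. \<eta> ((1 / real n) *\<^sub>R x) * g k x - g k x) \<le> ennreal e) \<and>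
    (\<forall>k. Lp_mass p (commutator (\<lambda>x. \<eta> ((1 / real n) *\<^sub>R x)) f k) \<le> ennreal e)"
    using p q1
    by (intro eventually_conj eventually_gt_at_top eventually_all_finite tendsto_0_ennrealD e
        tendsto f ff g gf Lp_mass_commutator_tendsto_0[OF _ f L \<eta>(6,5) p q ff e]) auto
  then obtain n where n: "n > 0" "Lp_mass q (\<lambda>x. \<eta> ((1 / real n) *\<^sub>R x) * f x - f x) \<le> ennreal e"
    "\<And>k. Lp_mass p (\<lambda>x. \<eta> ((1 / real n) *\<^sub>R x) * g k x - g k x) \<le> ennreal e"
    "\<And>k. Lp_mass p (commutator (\<lambda>x. \<eta> ((1 / real n) *\<^sub>R x)) f k) \<le> ennreal e"
    using eventually_happens'[OF sequentially_bot] by blast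
  define \<theta> where "\<theta> x = \<eta> ((1 / real n) *\<^sub>R x)" for x
  have R: "real n > 0" using n by simp
  have \<theta>: "\<theta> \<in> C_inf_c"
  proof (rule C_inf_cI[of _ "real n"])
    show "\<theta> \<in> C_inf" using C_inf_affine[OF \<eta>C, of 1 "1 / real n" 0] by (simp add: \<theta>_def[abs_def])
    show "\<theta> x = 0" if "norm x > real n" for x using that R unfolding \<theta>_def by (intro \<eta>(5)) simp
  qed
  have \<theta>1: "\<bar>\<theta> x\<bar> \<le> 1" for x using \<eta>(2,3) by (simp add: \<theta>_def abs_of_nonneg)
  have \<theta>b: "\<theta> \<in> C_inf_b" by (rule C_inf_c_C_inf_b[OF \<theta>])
  have [measurable]: "\<theta> \<in> borel_measurable borel" by (intro C_inf_borel C_inf_b_C_inf \<theta>b)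
  have lip: "\<bar>\<theta> (x + u) - \<theta> x\<bar> \<le> L * min 1 (norm u / real n)" for x u
    using \<eta>(6)[of "(1 / real n) *\<^sub>R (x + u)" "(1 / real n) *\<^sub>R x"]
    by (simp add: \<theta>_def scaleR_right_diff_distrib[symmetric])
  define h where "h x = \<theta> x * f x" for x
  define v where "v k x = \<theta> x * g k x + commutator \<theta> f k x" for k x
  have [measurable]: "h \<in> borel_measurable borel" "v k \<in> borel_measurable borel" for k
    unfolding h_def[abs_def] v_def[abs_def] by measurable
  have hd: "Lp_mass q (\<lambda>x. h x - f x) \<le> ennreal e" using n(2) by (simp add: h_def \<theta>_def)
  have hf: "Lp_mass q h < \<infinity>"
    by (rule Lp_mass_finite_of_diff[OF _ _ ff]) (use le_less_trans[OF hd ennreal_less_top] q1 in auto)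
  have vd: "Lp_mass p (\<lambda>x. v k x - g k x) \<le> ennreal (2 powr p * (2 * e))" for k
  proof -
    have "Lp_mass p (\<lambda>x. v k x - g k x) = Lp_mass p (\<lambda>x. (\<theta> x * g k x - g k x) + commutator \<theta> f k x)"
      by (simp add: v_def algebra_simps)
    also have "\<dots> \<le> ennreal (2 powr p) * (Lp_mass p (\<lambda>x. \<theta> x * g k x - g k x) + Lp_mass p (commutator \<theta> f k))"
      using p by (intro Lp_mass_add) auto
    also have "\<dots> \<le> ennreal (2 powr p) * (ennreal e + ennreal e)"
      using n(3,4)[of k] by (intro mult_left_mono add_mono) (auto simp: \<theta>_def[abs_def])
    also have "\<dots> = ennreal (2 powr p * (2 * e))"
      using e by (simp add: ennreal_mult'[symmetric] ennreal_plus[symmetric] del: ennreal_plus)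
    finally show ?thesis .
  qed
  have vf: "Lp_mass p (v k) < \<infinity>" for k
    by (rule Lp_mass_finite_of_diff[OF _ _ gf[of k]]) (use le_less_trans[OF vd[of k] ennreal_less_top] p in auto)
  have vrep: "frac_grad \<nu> h k \<phi> = (\<integral>x. v k x * \<phi> x \<partial>lborel)" if \<phi>: "\<phi> \<in> schwartz" for k \<phi>
  proof -
    have \<theta>\<phi>: "(\<lambda>x. \<theta> x * \<phi> x) \<in> schwartz" by (rule schwartz_mult[OF \<theta>b \<phi>])
    have int: "integrable lborel (\<lambda>x. a x * \<psi> x)"
      if \<psi>: "\<psi> \<in> schwartz" and a: "a \<in> borel_measurable borel" "Lp_mass p a < \<infinity>" for a \<psi> :: "real ^ 'n \<Rightarrow> real"
    proof -
      obtain C where "C > 0" "\<And>x. \<bar>\<psi> x\<bar> \<le> C" "\<And>x i. \<bar>partial_deriv i \<psi> x\<bar> \<le> C"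
        using C_inf_b_partial_deriv_bound[OF schwartz_C_inf_b[OF \<psi>]] by blast
      then show ?thesis by (intro integrable_Lp_mult_bounded[OF a schwartz_integrable[OF \<psi>] _ p(1)]) auto
    qed
    have "frac_grad \<nu> h k \<phi> = frac_grad \<nu> f k (\<lambda>x. \<theta> x * \<phi> x) + (\<integral>y. commutator \<theta> f k y * \<phi> y \<partial>lborel)"
      unfolding h_def by (rule frac_grad_cutoff[OF \<theta>b _ R lip f ff q1 \<phi>]) (use L in simp)
    also have "\<dots> = (\<integral>x. g k x * (\<theta> x * \<phi> x) \<partial>lborel) + (\<integral>y. commutator \<theta> f k y * \<phi> y \<partial>lborel)"
      by (simp only: rep[OF \<theta>\<phi>])
    also have "\<dots> = (\<integral>x. g k x * (\<theta> x * \<phi> x) + commutator \<theta> f k x * \<phi> x \<partial>lborel)"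
    proof (rule Bochner_Integration.integral_add[symmetric])
      show "integrable lborel (\<lambda>x. g k x * (\<theta> x * \<phi> x))" by (rule int[OF \<theta>\<phi> g gf])
      have "Lp_mass p (commutator \<theta> f k) < \<infinity>"
        using le_less_trans[OF n(4)[of k] ennreal_less_top] by (simp add: \<theta>_def[abs_def])
      then show "integrable lborel (\<lambda>x. commutator \<theta> f k x * \<phi> x)" by (intro int[OF \<phi>]) measurable
    qed
    also have "\<dots> = (\<integral>x. v k x * \<phi> x \<partial>lborel)" by (simp add: v_def algebra_simps)
    finally show ?thesis .
  qed
  obtain \<delta>1 where \<delta>1: "\<delta>1 > 0" "\<And>u. norm u < \<delta>1 \<Longrightarrow> Lp_mass q (\<lambda>x. h (x + u) - h x) \<le> ennreal e"
    using Lp_translation_continuity[OF _ hf q1 e] by auto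
  have "\<exists>\<delta>2>0. \<forall>u. norm u < \<delta>2 \<longrightarrow> Lp_mass p (\<lambda>x. v k (x + u) - v k x) \<le> ennreal e" for k
    by (rule Lp_translation_continuity[OF _ vf p(1) e]) measurable
  then obtain \<delta>2 where \<delta>2: "\<And>k. \<delta>2 k > 0" "\<And>k u. norm u < \<delta>2 k \<Longrightarrow> Lp_mass p (\<lambda>x. v k (x + u) - v k x) \<le> ennreal e"
    by metis
  \<comment> \<open>One mollifier must serve \<open>h\<close> and all components of \<open>v\<close>
    at once; there are finitely many components, so the minimum is positive.\<close>
  define s where "s = min \<delta>1 (Min (range \<delta>2))"
  have s: "s > 0" "s \<le> \<delta>1" "\<And>k. s \<le> \<delta>2 k"
    using \<delta>1(1) \<delta>2(1) by (auto simp: s_def min.coboundedI2)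
  obtain \<rho> :: "real ^ 'n \<Rightarrow> real" where \<rho>: "\<rho> \<in> C_inf_c" "\<And>x. \<rho> x \<ge> 0" "(\<integral>x. \<rho> x \<partial>lborel) = 1"
    "\<And>x. norm x \<ge> s \<Longrightarrow> \<rho> x = 0"
    by (rule mollifier_exists[OF s(1)]) (rule that)
  have \<rho>int: "integrable lborel \<rho>" by (rule C_inf_c_integrable[OF \<rho>(1)])
  obtain B where B: "B > 0" "\<And>x. \<bar>\<rho> x\<bar> \<le> B" "\<And>x i. \<bar>partial_deriv i \<rho> x\<bar> \<le> B"
    using C_inf_b_partial_deriv_bound[OF C_inf_c_C_inf_b[OF \<rho>(1)]] by blast
  have \<rho>B: "\<rho> x \<le> B" for x using B(2)[of x] by simp
  have [measurable]: "\<rho> \<in> borel_measurable borel" using \<rho>int by auto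
  have hint: "integrable lborel h"
    using integrable_Lp_mult_bounded[OF f ff C_inf_c_integrable[OF \<theta>] \<theta>1 q1] by (simp add: h_def[abs_def] mult.commute)
  have hsupp: "h x = 0" if "norm x > real n" for x
    using that R unfolding h_def \<theta>_def by (subst \<eta>(5)) auto
  let ?F = "smear \<rho> h" and ?G = "\<lambda>k. smear \<rho> (v k)"
  have "?F \<in> C_inf_c" by (rule smear_C_inf_c[OF \<rho>(1) hint hsupp])
  moreover have "Lp_mass q (\<lambda>x. ?F x - f x) \<le> ennreal \<delta>"
  proof -
    have "Lp_mass q (\<lambda>x. ?F x - h x) \<le> ennreal e"
      by (rule smear_approx[OF _ hf q1 \<rho>int \<rho>(2) \<rho>B \<rho>(3,4)]) (use \<delta>1(2) s(2) in auto)
    then have "ennreal (2 powr q) * (Lp_mass q (\<lambda>x. ?F x - h x) + Lp_mass q (\<lambda>x. h x - f x)) \<le> ennreal (2 powr q) * (ennreal e + ennreal e)"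
      using hd by (intro mult_left_mono add_mono) auto
    also have "\<dots> = ennreal (2 powr q * (2 * e))"
      using e by (simp add: ennreal_mult'[symmetric] ennreal_plus[symmetric] del: ennreal_plus)
    also have "\<dots> \<le> ennreal \<delta>"
      unfolding eD[symmetric] D_def using e by (intro ennreal_leI) (simp add: algebra_simps)
    finally show ?thesis
      using Lp_mass_add[of "\<lambda>x. ?F x - h x" "\<lambda>x. h x - f x" q] q1 by simp
  qed
  moreover have "?G k \<in> borel_measurable borel" for k by measurable
  moreover have "Lp_mass p (\<lambda>x. ?G k x - g k x) \<le> ennreal \<delta>" for k
  proof -
    have "Lp_mass p (\<lambda>x. ?G k x - v k x) \<le> ennreal e"
      by (rule smear_approx[OF _ vf p(1) \<rho>int \<rho>(2) \<rho>B \<rho>(3,4)]) (use \<delta>2(2)[of _ k] s(3)[of k] in auto)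
    then have "ennreal (2 powr p) * (Lp_mass p (\<lambda>x. ?G k x - v k x) + Lp_mass p (\<lambda>x. v k x - g k x)) \<le>
        ennreal (2 powr p) * (ennreal e + ennreal (2 powr p * (2 * e)))"
      using vd[of k] by (intro mult_left_mono add_mono) auto
    also have "\<dots> = ennreal (2 powr p * (e + 2 powr p * (2 * e)))"
      using e by (simp add: ennreal_mult'[symmetric] ennreal_plus[symmetric] del: ennreal_plus)
    also have "\<dots> \<le> ennreal \<delta>"
      unfolding eD[symmetric] D_def using e by (intro ennreal_leI) (simp add: algebra_simps)
    finally show ?thesis
      using Lp_mass_add[of "\<lambda>x. ?G k x - v k x" "\<lambda>x. v k x - g k x" p] p by simp
  qed
  moreover have "frac_grad \<nu> ?F k \<phi> = (\<integral>x. ?G k x * \<phi> x \<partial>lborel)" if "\<phi> \<in> schwartz" for k \<phi>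
    by (rule frac_grad_smear[OF _ hf q1 _ vf p(1) vrep \<rho>int that]) measurable
  ultimately show ?thesis by (intro exI[of _ ?F] exI[of _ ?G]) blast
qed

end

section \<open>From components to vector fields and to the convergence notions\<close>

lemma norm_powr_le_sum:
  fixes v :: "real ^ 'n"
  assumes "p \<ge> 0"
  shows "norm v powr p \<le> real CARD('n) powr p * (\<Sum>k\<in>UNIV. \<bar>v $ k\<bar> powr p)"
proof -
  obtain j where j: "\<And>k. \<bar>v $ k\<bar> \<le> \<bar>v $ j\<bar>"
  proof -
    have "finite (range (\<lambda>k. \<bar>v $ k\<bar>))" "range (\<lambda>k. \<bar>v $ k\<bar>) \<noteq> {}" by auto
    from Max_in[OF this] obtain j where j: "Max (range (\<lambda>k. \<bar>v $ k\<bar>)) = \<bar>v $ j\<bar>" by blast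
    have "\<bar>v $ k\<bar> \<le> \<bar>v $ j\<bar>" for k unfolding j[symmetric] by (rule Max_ge) auto
    then show ?thesis using that by blast
  qed
  have "norm v \<le> (\<Sum>k\<in>UNIV. \<bar>v $ k\<bar>)" by (rule norm_le_l1_cart)
  also have "\<dots> \<le> real CARD('n) * \<bar>v $ j\<bar>"
    by (rule sum_bounded_above) (rule j)
  finally have "norm v powr p \<le> (real CARD('n) * \<bar>v $ j\<bar>) powr p" using assms by (intro powr_mono2) auto
  also have "\<dots> = real CARD('n) powr p * \<bar>v $ j\<bar> powr p" by (simp add: powr_mult)
  also have "\<dots> \<le> real CARD('n) powr p * (\<Sum>k\<in>UNIV. \<bar>v $ k\<bar> powr p)"
    by (intro mult_left_mono member_le_sum) auto
  finally show ?thesis .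
qed

lemma Lp_space_nn_integral:
  fixes f :: "real ^ 'n \<Rightarrow> 'b :: {banach, second_countable_topology}"
  shows "f \<in> Lp_space q \<longleftrightarrow> f \<in> borel_measurable borel \<and> (\<integral>\<^sup>+x. ennreal (norm (f x) powr q) \<partial>lborel) < \<infinity>"
  by (auto simp: Lp_space_def integrable_iff_bounded)

text \<open>The bounds \<open>e n\<close> concern the q-th power of the norm. Besides convergence
  they yield membership of each \<open>F n\<close> in the space, by adding \<open>f\<close>
  back.\<close>

lemma Lp_tendstoI:
  fixes f :: "real ^ 'n \<Rightarrow> 'b :: {banach, second_countable_topology}"
  assumes f: "f \<in> Lp_space q" and F: "\<And>n. F n \<in> borel_measurable borel" and q: "q > 0"
    and le: "\<And>n. (\<integral>\<^sup>+x. ennreal (norm (F n x - f x) powr q) \<partial>lborel) \<le> ennreal (e n)"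
    and e: "e \<longlonglongrightarrow> 0" "\<And>n. e n \<ge> 0"
  shows "Lp_tendsto q F f"
proof -
  have [measurable]: "f \<in> borel_measurable borel" "F n \<in> borel_measurable borel" for n
    using f F by (auto simp: Lp_space_nn_integral)
  have "F n \<in> Lp_space q" for n
  proof -
    have "norm (F n x) powr q \<le> 2 powr q * (norm (F n x - f x) powr q + norm (f x) powr q)" for x
    proof -
      have "norm (F n x) powr q \<le> \<bar>norm (F n x - f x) + norm (f x)\<bar> powr q"
        using q norm_triangle_sub[of "F n x" "f x"] by (intro powr_mono2) auto
      also have "\<dots> \<le> 2 powr q * (norm (F n x - f x) powr q + norm (f x) powr q)"
        using powr_add_le[of q "norm (F n x - f x)" "norm (f x)"] q by simp
      finally show ?thesis .
    qed
    then have "(\<integral>\<^sup>+x. ennreal (norm (F n x) powr q) \<partial>lborel) \<le>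
        (\<integral>\<^sup>+x. ennreal (2 powr q) * (ennreal (norm (F n x - f x) powr q) + ennreal (norm (f x) powr q)) \<partial>lborel)"
      by (intro nn_integral_mono) (auto simp: ennreal_mult'[symmetric] ennreal_plus[symmetric] simp del: ennreal_plus intro!: ennreal_leI)
    also have "\<dots> = ennreal (2 powr q) * ((\<integral>\<^sup>+x. ennreal (norm (F n x - f x) powr q) \<partial>lborel) + (\<integral>\<^sup>+x. ennreal (norm (f x) powr q) \<partial>lborel))"
      by (simp add: nn_integral_cmult nn_integral_add)
    also have "\<dots> < \<infinity>"
      using le_less_trans[OF le ennreal_less_top] f by (auto simp: ennreal_mult_less_top Lp_space_nn_integral)
    finally show ?thesis by (simp add: Lp_space_nn_integral)
  qed
  moreover have "(\<lambda>n. Lp_norm q (\<lambda>x. F n x - f x)) \<longlonglongrightarrow> 0"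
  proof (rule tendsto_sandwich[OF _ _ tendsto_const])
    have "Lp_norm q (\<lambda>x. F n x - f x) \<le> e n powr (1 / q)" for n
    proof -
      have "(\<integral>x. norm (F n x - f x) powr q \<partial>lborel) \<le> e n"
        using le[of n] e(2)[of n] by (subst integral_eq_nn_integral) (auto intro!: enn2real_leI)
      then show ?thesis unfolding Lp_norm_def using q by (intro powr_mono2) auto
    qed
    then show "\<forall>\<^sub>F n in sequentially. Lp_norm q (\<lambda>x. F n x - f x) \<le> e n powr (1 / q)" by simp
    have "(\<lambda>n. e n powr (1 / q)) \<longlonglongrightarrow> 0 powr (1 / q)"
      using e q by (intro tendsto_powr') auto
    then show "(\<lambda>n. e n powr (1 / q)) \<longlonglongrightarrow> 0" by simp
  qed (simp add: Lp_norm_def)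
  ultimately show ?thesis using f by (simp add: Lp_tendsto_def)
qed

theorem theorem4p3:
  fixes \<alpha> p :: real and \<sigma> \<nu> :: "(real ^ 'n) measure" and f :: "real ^ 'n \<Rightarrow> real"
  assumes "1 < \<alpha>" and "\<alpha> < 2"
    and "CARD('n) \<ge> 2"
    and "symmetric_spherical_measure \<sigma>"
    and "\<nu> = stable_levy_measure \<alpha> \<sigma>"
    and "nondegenerate \<alpha> \<sigma>"
    and "1 < p" and "p < CARD('n) / (\<alpha> - 1)"
    and "f \<in> frac_sobolev \<nu> \<alpha> p"
  shows "\<exists>F :: nat \<Rightarrow> real ^ 'n \<Rightarrow> real.
           (\<forall>n\<ge>1. F n \<in> C_inf_c) \<and>
           Lp_tendsto (sobolev_exponent CARD('n) \<alpha> p) F f \<and>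
           distr_Lp_tendsto p (\<lambda>n. frac_grad \<nu> (F n)) (frac_grad \<nu> f)"
proof -
  interpret stable_levy \<alpha> \<sigma> \<nu> using assms by unfold_locales auto
  define q where "q = sobolev_exponent CARD('n) \<alpha> p"
  have p: "1 \<le> p" "p < CARD('n) / (\<alpha> - 1)" using assms by auto
  have q: "q > 0" using sobolev_exponent(2)[OF \<alpha>(1) p] p by (simp add: q_def)
  have f: "f \<in> Lp_space q" using assms by (simp add: frac_sobolev_def q_def)
  obtain g where g: "g \<in> Lp_space p" and rep: "distr_represents g (frac_grad \<nu> f)"
    using assms by (auto simp: frac_sobolev_def distr_in_Lp_def)
  have [measurable]: "g \<in> borel_measurable borel" using g by (simp add: Lp_space_nn_integral)
  have gf: "Lp_mass p (\<lambda>x. g x $ k) < \<infinity>" for k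
  proof -
    have "Lp_mass p (\<lambda>x. g x $ k) \<le> (\<integral>\<^sup>+x. ennreal (norm (g x) powr p) \<partial>lborel)"
      unfolding Lp_mass_def using p by (intro nn_integral_mono ennreal_leI powr_mono2 component_le_norm_cart) auto
    also have "\<dots> < \<infinity>" using g by (simp add: Lp_space_nn_integral)
    finally show ?thesis .
  qed
  let ?\<delta> = "\<lambda>n. inverse (real (Suc n))"
  \<comment> \<open>Function and gradient are approximated by the same witness at each accuracy, so
    that the two choices below produce one sequence \<open>F\<close> with its gradients
    \<open>G\<close>. The accuracy 1/(n + 1) is meaningful at \<open>n = 0\<close> as well.\<close>
  have "\<forall>n. \<exists>F G. F \<in> C_inf_c \<and> Lp_mass q (\<lambda>x. F x - f x) \<le> ennreal (?\<delta> n) \<and>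
    (\<forall>k. G k \<in> borel_measurable borel \<and> Lp_mass p (\<lambda>x. G k x - g x $ k) \<le> ennreal (?\<delta> n) \<and>
      (\<forall>\<phi>\<in>schwartz. frac_grad \<nu> F k \<phi> = (\<integral>x. G k x * \<phi> x \<partial>lborel)))"
  proof
    fix n
    show "\<exists>F G. F \<in> C_inf_c \<and> Lp_mass q (\<lambda>x. F x - f x) \<le> ennreal (?\<delta> n) \<and>
    (\<forall>k. G k \<in> borel_measurable borel \<and> Lp_mass p (\<lambda>x. G k x - g x $ k) \<le> ennreal (?\<delta> n) \<and>
      (\<forall>\<phi>\<in>schwartz. frac_grad \<nu> F k \<phi> = (\<integral>x. G k x * \<phi> x \<partial>lborel)))"
      using f rep gf
      by (intro smooth_approximation[OF p q_def, where g = "\<lambda>k x. g x $ k"])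
        (auto simp: Lp_space_nn_integral Lp_mass_def distr_represents_def)
  qed
  from choice[OF this] obtain F where "\<forall>n. \<exists>G. F n \<in> C_inf_c \<and> Lp_mass q (\<lambda>x. F n x - f x) \<le> ennreal (?\<delta> n) \<and>
    (\<forall>k. G k \<in> borel_measurable borel \<and> Lp_mass p (\<lambda>x. G k x - g x $ k) \<le> ennreal (?\<delta> n) \<and>
      (\<forall>\<phi>\<in>schwartz. frac_grad \<nu> (F n) k \<phi> = (\<integral>x. G k x * \<phi> x \<partial>lborel)))" ..
  from choice[OF this] obtain G where FG: "\<forall>n. F n \<in> C_inf_c \<and> Lp_mass q (\<lambda>x. F n x - f x) \<le> ennreal (?\<delta> n) \<and>
    (\<forall>k. G n k \<in> borel_measurable borel \<and> Lp_mass p (\<lambda>x. G n k x - g x $ k) \<le> ennreal (?\<delta> n) \<and>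
      (\<forall>\<phi>\<in>schwartz. frac_grad \<nu> (F n) k \<phi> = (\<integral>x. G n k x * \<phi> x \<partial>lborel)))" ..
  have F: "F n \<in> C_inf_c" "Lp_mass q (\<lambda>x. F n x - f x) \<le> ennreal (?\<delta> n)" for n
    using spec[OF FG, of n] by simp_all
  have G: "G n k \<in> borel_measurable borel" "Lp_mass p (\<lambda>x. G n k x - g x $ k) \<le> ennreal (?\<delta> n)"
      "\<phi> \<in> schwartz \<Longrightarrow> frac_grad \<nu> (F n) k \<phi> = (\<integral>x. G n k x * \<phi> x \<partial>lborel)" for n k \<phi>
    using spec[OF FG, of n] by simp_all
  have [measurable]: "F n \<in> borel_measurable borel" "G n k \<in> borel_measurable borel" for n k
    using F(1)[of n] G(1) by (auto simp: C_inf_c_def intro: C_inf_borel)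
  have Ff: "Lp_tendsto q F f"
    by (rule Lp_tendstoI[OF f _ q _ LIMSEQ_inverse_real_of_nat]) (use F(2) in \<open>auto simp: Lp_mass_def\<close>)
  define V where "V n x = (\<chi> k. G n k x)" for n x
  have V [measurable]: "V n \<in> borel_measurable borel" for n
  proof -
    have "V n = (\<lambda>x. \<Sum>k\<in>UNIV. G n k x *\<^sub>R axis k 1)"
      by (auto simp: V_def vec_eq_iff axis_def if_distrib cong: if_cong)
    then show ?thesis by simp
  qed
  \<comment> \<open>\<open>norm_powr_le_sum\<close> gives the power of the dimension; the last
    factor counts the components, each of which has mass at most \<open>?\<delta> n\<close>.\<close>
  define c where "c = real CARD('n) powr p * real CARD('n)"
  have "Lp_tendsto p V g"
  proof (rule Lp_tendstoI[OF g V])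
    fix n
    have "(\<integral>\<^sup>+x. ennreal (norm (V n x - g x) powr p) \<partial>lborel) \<le>
      (\<integral>\<^sup>+x. ennreal (real CARD('n) powr p) * (\<Sum>k\<in>UNIV. ennreal (\<bar>G n k x - g x $ k\<bar> powr p)) \<partial>lborel)"
    proof (rule nn_integral_mono)
      fix x
      have "norm (V n x - g x) powr p \<le> real CARD('n) powr p * (\<Sum>k\<in>UNIV. \<bar>G n k x - g x $ k\<bar> powr p)"
        using norm_powr_le_sum[of p "V n x - g x"] p by (simp add: V_def)
      then have "ennreal (norm (V n x - g x) powr p) \<le> ennreal (real CARD('n) powr p * (\<Sum>k\<in>UNIV. \<bar>G n k x - g x $ k\<bar> powr p))"
        by (rule ennreal_leI)
      then show "ennreal (norm (V n x - g x) powr p) \<le> ennreal (real CARD('n) powr p) * (\<Sum>k\<in>UNIV. ennreal (\<bar>G n k x - g x $ k\<bar> powr p))"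
        by (simp add: ennreal_mult')
    qed
    also have "\<dots> = ennreal (real CARD('n) powr p) * (\<Sum>k\<in>UNIV. Lp_mass p (\<lambda>x. G n k x - g x $ k))"
      unfolding Lp_mass_def by (simp add: nn_integral_cmult nn_integral_sum del: sum_ennreal)
    also have "\<dots> \<le> ennreal (real CARD('n) powr p) * (\<Sum>k\<in>(UNIV :: 'n set). ennreal (?\<delta> n))"
      by (intro mult_left_mono sum_mono G(2)) auto
    also have "\<dots> = ennreal (real CARD('n) powr p) * ennreal (\<Sum>k\<in>(UNIV :: 'n set). ?\<delta> n)"
      by (subst sum_ennreal) auto
    also have "\<dots> = ennreal (c * ?\<delta> n)"
      by (simp add: c_def ennreal_mult'[symmetric] mult.assoc)
    finally show "(\<integral>\<^sup>+x. ennreal (norm (V n x - g x) powr p) \<partial>lborel) \<le> ennreal (c * ?\<delta> n)" .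
  next
    show "(\<lambda>n. c * ?\<delta> n) \<longlonglongrightarrow> 0"
      by (intro tendsto_mult_right_zero LIMSEQ_inverse_real_of_nat)
    show "c * ?\<delta> n \<ge> 0" for n by (simp add: c_def)
  qed (use p in simp)
  moreover have "distr_represents (V n) (frac_grad \<nu> (F n))" for n
    using G(3) by (simp add: distr_represents_def V_def)
  ultimately have "distr_Lp_tendsto p (\<lambda>n. frac_grad \<nu> (F n)) (frac_grad \<nu> f)"
    unfolding distr_Lp_tendsto_def by (intro exI[of _ V] exI[of _ g] conjI rep) simp_all
  with F(1) Ff show ?thesis
    unfolding q_def by (intro exI[of _ F] conjI) simp_all
qed

end
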